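(* Let $R$ be a commutative local noetherian ring of Krull dimension $d$ with $d\geq 2$ and $\frac{1}{d!}\in R$ (i.e. $d!$ is invertible in $R$). Let $n\geq d+1$. Then the map $$\mathrm{Row}_1:\frac{Um_{2,n}(R[X])}{E_n(R[X])}\longrightarrow\frac{Um_{1,n}(R[X])}{E_n(R[X])}$$ is surjective.
   Context: $R[X]$ is the polynomial ring in one variable over $R$. For a commutative ring $A$ with $1\neq0$, $Um_{m,n}(A)$ is the set of right invertible $m\times n$ matrices over $A$, i.e. those $\alpha\in M_{m\times n}(A)$ for which there is $\beta\in M_{n\times m}(A)$ with $\alpha\beta=I_m$; in particular $Um_{1,n}(A)$ is the set of unimodular rows of length $n$. $E_n(A)\subseteq GL_n(A)$ is the subgroup generated by the elementary matrices $I_n+\lambda E_{ij}$ with $\lambda\in A$, $i\neq j$, where $E_{ij}$ has $1$ in position $(i,j)$ and $0$ elsewhere. $E_n(A)$ acts on $Um_{m,n}(A)$ by right multiplication, and $\frac{Um_{m,n}(A)}{E_n(A)}$ denotes the set of orbits. The map $\mathrm{Row}_1$ associates to the orbit of a matrix in $Um_{2,n}(A)$ the orbit of its first row. *)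

theory Defs
  imports
    "HOL-Library.Extended_Nat"
    "HOL-Algebra.Ring_Divisibility"
    "HOL-Algebra.Generated_Groups"
    "HOL-Algebra.Algebraic_Closure_Type"
    "Jordan_Normal_Form.Gauss_Jordan_Elimination"
begin

definition is_local_ring :: "('a, 'b) ring_scheme \<Rightarrow> bool" where
  "is_local_ring R \<longleftrightarrow> cring R \<and> (\<exists>!M. maximalideal M R)"

(* Supremum of the lengths k of chains P 0 < P 1 < ... < P k of prime ideals; it may be infinite.
   For the zero ring, which has no prime ideals, this gives 0. *)
definition krull_dim :: "('a, 'b) ring_scheme \<Rightarrow> enat" where
  "krull_dim R = Sup {enat k | k.
     \<exists>P. (\<forall>i\<le>k. primeideal (P i) R) \<and> (\<forall>i<k. P i \<subset> P (Suc i))}"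

definition Um :: "nat \<Rightarrow> nat \<Rightarrow> 'a :: comm_ring_1 mat set" where
  "Um m n = {\<alpha> \<in> carrier_mat m n. \<exists>\<beta> \<in> carrier_mat n m. \<alpha> * \<beta> = 1\<^sub>m m}"

abbreviation GL :: "nat \<Rightarrow> 'a :: comm_ring_1 mat monoid" where
  "GL n \<equiv> units_of (ring_mat TYPE('a) n ())"

(* addrow_mat n c i j is the identity matrix plus c in position (i, j), indices starting at 0. *)
definition E_grp :: "nat \<Rightarrow> 'a :: comm_ring_1 mat set" where
  "E_grp n = generate (GL n) {addrow_mat n c i j | c i j. i < n \<and> j < n \<and> i \<noteq> j}"

definition E_orbit :: "nat \<Rightarrow> 'a :: comm_ring_1 mat \<Rightarrow> 'a mat set" where
  "E_orbit n \<alpha> = {\<alpha> * \<epsilon> | \<epsilon>. \<epsilon> \<in> E_grp n}"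

definition Um_orbits :: "nat \<Rightarrow> nat \<Rightarrow> 'a :: comm_ring_1 mat set set" where
  "Um_orbits m n = E_orbit n ` Um m n"

definition first_row :: "'a mat \<Rightarrow> 'a mat" where
  "first_row \<alpha> = mat_of_row (row \<alpha> 0)"

(* The map on orbits induced by first_row: all the orbits in the union coincide,
   see Row1_E_orbit below. *)
definition Row1 :: "nat \<Rightarrow> 'a :: comm_ring_1 mat set \<Rightarrow> 'a mat set" where
  "Row1 n C = (\<Union>\<alpha>\<in>C. E_orbit n (first_row \<alpha>))"

lemma monoid_ring_mat: "Group.monoid (ring_mat TYPE('a :: comm_ring_1) n ())"
  by (rule semiring.axioms(2)[OF semiring_mat])

lemma group_GL: "Group.group (GL n :: 'a :: comm_ring_1 mat monoid)"
  by (rule monoid.units_group[OF monoid_ring_mat])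

lemma elementary_in_GL:
  "{addrow_mat n c i j | c i j. i < n \<and> j < n \<and> i \<noteq> j}
     \<subseteq> carrier (GL n :: 'a :: comm_ring_1 mat monoid)"
  by (auto simp: units_of_carrier intro!: addrow_mat_Unit)

lemma subgroup_E_grp: "subgroup (E_grp n) (GL n :: 'a :: comm_ring_1 mat monoid)"
  unfolding E_grp_def by (rule group.generate_is_subgroup[OF group_GL elementary_in_GL])

lemma E_grp_carrier: "\<epsilon> \<in> E_grp n \<Longrightarrow> \<epsilon> \<in> carrier_mat n n"
  using subgroup.subset[OF subgroup_E_grp, of n]
  by (auto simp: units_of_carrier Units_def ring_mat_simps)

lemma E_grp_one: "1\<^sub>m n \<in> E_grp n"
  using subgroup.one_closed[OF subgroup_E_grp, of n] by (simp add: units_of_one ring_mat_simps)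

lemma E_grp_mult: "\<epsilon> \<in> E_grp n \<Longrightarrow> \<delta> \<in> E_grp n \<Longrightarrow> \<epsilon> * \<delta> \<in> E_grp n"
  using subgroup.m_closed[OF subgroup_E_grp, of \<epsilon> n \<delta>] by (simp add: units_of_mult ring_mat_simps)

lemma E_grp_inv:
  assumes "\<epsilon> \<in> E_grp n"
  obtains \<delta> where "\<delta> \<in> E_grp n" "\<epsilon> * \<delta> = 1\<^sub>m n"
proof
  let ?d = "inv\<^bsub>GL n\<^esub> \<epsilon>"
  show "?d \<in> E_grp n"
    using assms by (rule subgroup.m_inv_closed[OF subgroup_E_grp])
  show "\<epsilon> * ?d = 1\<^sub>m n"
    using group.r_inv[OF group_GL, of \<epsilon> n] assms subgroup.subset[OF subgroup_E_grp, of n]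
    by (auto simp: units_of_mult units_of_one ring_mat_simps)
qed

lemma E_orbit_mult:
  fixes \<alpha> :: "'a :: comm_ring_1 mat"
  assumes "\<alpha> \<in> carrier_mat m n" "\<epsilon> \<in> E_grp n"
  shows "E_orbit n (\<alpha> * \<epsilon>) = E_orbit n \<alpha>"
proof
  have "\<alpha> * \<epsilon> * \<gamma> = \<alpha> * (\<epsilon> * \<gamma>)" if "\<gamma> \<in> E_grp n" for \<gamma>
    using assoc_mult_mat[OF assms(1) E_grp_carrier[OF assms(2)] E_grp_carrier[OF that]] .
  thus "E_orbit n (\<alpha> * \<epsilon>) \<subseteq> E_orbit n \<alpha>"
    unfolding E_orbit_def using E_grp_mult[OF assms(2)] by blast
  obtain \<delta> where d: "\<delta> \<in> E_grp n" "\<epsilon> * \<delta> = 1\<^sub>m n"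
    using E_grp_inv[OF assms(2)] .
  show "E_orbit n \<alpha> \<subseteq> E_orbit n (\<alpha> * \<epsilon>)"
  proof
    fix x assume "x \<in> E_orbit n \<alpha>"
    then obtain \<gamma> where g: "\<gamma> \<in> E_grp n" "x = \<alpha> * \<gamma>" by (auto simp: E_orbit_def)
    have c: "\<epsilon> \<in> carrier_mat n n" "\<delta> \<in> carrier_mat n n" "\<gamma> \<in> carrier_mat n n"
      using assms d g by (auto intro: E_grp_carrier)
    have "\<epsilon> * (\<delta> * \<gamma>) = \<gamma>"
      using assoc_mult_mat[OF c] d(2) left_mult_one_mat[OF c(3)] by simp
    hence "x = \<alpha> * \<epsilon> * (\<delta> * \<gamma>)"
      using assoc_mult_mat[OF assms(1) c(1) mult_carrier_mat[OF c(2,3)]] g(2) by simp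
    thus "x \<in> E_orbit n (\<alpha> * \<epsilon>)"
      using E_grp_mult[OF d(1) g(1)] by (auto simp: E_orbit_def)
  qed
qed

lemma first_row_mult:
  assumes "\<alpha> \<in> carrier_mat m n" "\<epsilon> \<in> carrier_mat n k" "0 < m"
  shows "first_row (\<alpha> * \<epsilon>) = first_row \<alpha> * \<epsilon>"
  using assms by (intro eq_matI) (auto simp: first_row_def)

lemma first_row_carrier: "\<alpha> \<in> carrier_mat m n \<Longrightarrow> first_row \<alpha> \<in> carrier_mat 1 n"
  by (auto simp: first_row_def)

lemma first_row_Um:
  fixes \<alpha> :: "'a :: comm_ring_1 mat"
  assumes "\<alpha> \<in> Um m n" "0 < m"
  shows "first_row \<alpha> \<in> Um 1 n"
proof -
  obtain \<beta> where b: "\<alpha> \<in> carrier_mat m n" "\<beta> \<in> carrier_mat n m" "\<alpha> * \<beta> = 1\<^sub>m m"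
    using assms(1) by (auto simp: Um_def)
  define c where "c = mat n 1 (\<lambda>(i, j). \<beta> $$ (i, 0))"
  have "(\<alpha> * \<beta>) $$ (0, 0) = 1"
    using b(3) assms(2) by simp
  hence "row \<alpha> 0 \<bullet> col \<beta> 0 = 1"
    using b(1,2) assms(2) by simp
  moreover have "col c 0 = col \<beta> 0"
    using b assms(2) by (intro eq_vecI) (auto simp: c_def)
  ultimately have "first_row \<alpha> * c = 1\<^sub>m 1"
    by (intro eq_matI) (auto simp: first_row_def c_def)
  thus ?thesis
    using first_row_carrier[OF b(1)] by (auto simp: Um_def c_def intro!: bexI[of _ c])
qed

lemma Row1_E_orbit:
  fixes \<alpha> :: "'a :: comm_ring_1 mat"
  assumes "\<alpha> \<in> Um m n" "0 < m"
  shows "Row1 n (E_orbit n \<alpha>) = E_orbit n (first_row \<alpha>)"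
proof -
  have a: "\<alpha> \<in> carrier_mat m n" using assms by (simp add: Um_def)
  have "E_orbit n (first_row (\<alpha> * \<epsilon>)) = E_orbit n (first_row \<alpha>)" if "\<epsilon> \<in> E_grp n" for \<epsilon>
    using first_row_mult[OF a E_grp_carrier[OF that] assms(2)]
      E_orbit_mult[OF first_row_carrier[OF a] that] by simp
  hence "E_orbit n (first_row \<beta>) = E_orbit n (first_row \<alpha>)" if "\<beta> \<in> E_orbit n \<alpha>" for \<beta>
    using that unfolding E_orbit_def[of n \<alpha>] by blast
  moreover have "\<alpha> \<in> E_orbit n \<alpha>"
    unfolding E_orbit_def mem_Collect_eq
    by (rule exI[of _ "1\<^sub>m n"]) (simp only: right_mult_one_mat[OF a] E_grp_one)
  ultimately show ?thesis
    unfolding Row1_def by blast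
qed

lemma Row1_in_Um_orbits: "Row1 n \<in> Um_orbits 2 n \<rightarrow> Um_orbits 1 n"
proof
  fix C :: "'a mat set" assume "C \<in> Um_orbits 2 n"
  then obtain \<alpha> where "\<alpha> \<in> Um 2 n" "C = E_orbit n \<alpha>" by (auto simp: Um_orbits_def)
  thus "Row1 n C \<in> Um_orbits 1 n"
    using Row1_E_orbit[of \<alpha> 2 n] first_row_Um[of \<alpha> 2 n] by (auto simp: Um_orbits_def)
qed

end

theory Submission
  imports Defs
begin

text \<open>
  A row \<open>v\<close> of length \<open>n\<close> over \<open>R[X]\<close> is the first row of a right invertible \<open>2 \<times> n\<close> matrix iff there is a
  second row \<open>w\<close> such that the \<open>2 \<times> 2\<close> minors of the two rows generate the unit ideal
  (\<open>completable_minors\<close>).  Surjectivity on orbits follows once every unimodular row has such a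
  companion; elementary operations on \<open>v\<close> do not affect the question (\<open>reduces\<close>).

  If \<open>n\<close> is even and \<open>\<Sum>u\<^sub>i v\<^sub>i = 1\<close>, the row \<open>(-u\<^sub>1, u\<^sub>0, -u\<^sub>3, u\<^sub>2, \<dots>)\<close> is a companion
  (\<open>completable_even\<close>).  For odd \<open>n\<close> the statement is proved modulo every ideal \<open>I\<close> of \<open>R\<close> such that
  \<open>R/I\<close> has dimension at most \<open>n - 1\<close>, by induction on \<open>n\<close> in steps of two (\<open>completable_odd\<close>).

  The case \<open>n = 3\<close> is Karoubi's argument.  The row and a solution of \<open>\<Sum>u\<^sub>i v\<^sub>i = 1\<close> are the entries of
  an alternating \<open>4 \<times> 4\<close> matrix, invertible and, after a normalisation, hyperbolic at \<open>X = 0\<close>.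
  Adding hyperbolic planes makes such a matrix linear in \<open>X\<close>, say \<open>J(1 + X N)\<close> with \<open>N\<close> nilpotent, and
  then the power series of \<open>sqrt (1 + X N)\<close>, available because \<open>2\<close> is a unit, exhibits it as the Gram
  matrix of vectors in a symplectic space (\<open>linear_gram\<close>, \<open>linearize\<close>).  The added planes can be
  cancelled, because symplectic transvections act transitively on unimodular vectors of the relevant
  length (\<open>sp_transitive\<close>, \<open>cancel_planes\<close>), and the resulting four vectors in a four-dimensional
  symplectic space contain a companion of the row (\<open>gram_completes\<close>).

  For odd \<open>n \<ge> 5\<close> choose \<open>l\<close> in the maximal ideal lying in no minimal prime over \<open>I\<close>.  As
  \<open>R/(I + (l))\<close> has smaller dimension, \<open>v\<close> can be moved by elementary operations to a row with
  \<open>v\<^sub>0 \<equiv> 1\<close> modulo \<open>l\<close>.  From then on \<open>w = v\<^sub>0\<close> stays fixed; chains of primes of \<open>R[X]\<close> through \<open>w\<close>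
  contract to strict chains of primes of \<open>R\<close> that avoid \<open>l\<close>, so they are short
  (\<open>anchor_ht\<close>), and \<open>l\<close> is a unit modulo \<open>w\<close>.  In analogy with Suslin's proof for monic polynomials, \<open>v\<^sub>1\<close> is
  turned into a polynomial whose leading coefficient is a power of \<open>l\<close> (\<open>exists_lmonic\<close>) and its degree
  is lowered to one (\<open>lower_degree\<close>), so that the entries \<open>v\<^sub>2, \<dots>\<close> can be reduced to constants.  Two
  of these constants are then moved into general position, so that adding them to \<open>I\<close> lowers the
  dimension by two (\<open>two_constants\<close>); the induction hypothesis applies to the other \<open>n - 2\<close> entries,
  and a companion modulo two entries extends to one of the whole row (\<open>completable_absorb\<close>).
\<close>

section \<open>Ideals and prime ideals of a Noetherian ring\<close>

definition is_ideal :: "'a::comm_ring_1 set \<Rightarrow> bool" where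
  "is_ideal I \<longleftrightarrow> 0 \<in> I \<and> (\<forall>x\<in>I. \<forall>y\<in>I. x + y \<in> I) \<and> (\<forall>x\<in>I. \<forall>c. c * x \<in> I)"

definition is_prime :: "'a::comm_ring_1 set \<Rightarrow> bool" where
  "is_prime P \<longleftrightarrow> is_ideal P \<and> 1 \<notin> P \<and> (\<forall>a b. a * b \<in> P \<longrightarrow> a \<in> P \<or> b \<in> P)"

inductive_set ideal_of :: "'a::comm_ring_1 set \<Rightarrow> 'a set" for S where
  zero: "0 \<in> ideal_of S"
| step: "s \<in> S \<Longrightarrow> x \<in> ideal_of S \<Longrightarrow> c * s + x \<in> ideal_of S"

lemma ideal_zero: "is_ideal I \<Longrightarrow> 0 \<in> I" by (simp add: is_ideal_def)
lemma ideal_add: "is_ideal I \<Longrightarrow> x \<in> I \<Longrightarrow> y \<in> I \<Longrightarrow> x + y \<in> I" by (simp add: is_ideal_def)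
lemma ideal_mult: "is_ideal I \<Longrightarrow> x \<in> I \<Longrightarrow> c * x \<in> I" by (simp add: is_ideal_def)
lemma ideal_mult2: "is_ideal I \<Longrightarrow> x \<in> I \<Longrightarrow> x * c \<in> I" by (metis ideal_mult mult.commute)
lemma ideal_uminus: "is_ideal I \<Longrightarrow> x \<in> I \<Longrightarrow> - x \<in> I"
  using ideal_mult[of I x "-1"] by simp
lemma ideal_diff: "is_ideal I \<Longrightarrow> x \<in> I \<Longrightarrow> y \<in> I \<Longrightarrow> x - y \<in> I"
  using ideal_add[of I x "-y"] ideal_uminus[of I y] by simp
lemma ideal_sum: "is_ideal I \<Longrightarrow> (\<And>i. i \<in> K \<Longrightarrow> f i \<in> I) \<Longrightarrow> sum f K \<in> I"
  by (induction K rule: infinite_finite_induct) (auto simp: ideal_zero ideal_add)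

lemma ideal_one: "is_ideal I \<Longrightarrow> 1 \<in> I \<Longrightarrow> x \<in> I"
  using ideal_mult[of I 1 x] by simp

lemma prime_ideal: "is_prime P \<Longrightarrow> is_ideal P" by (simp add: is_prime_def)
lemma prime_mult: "is_prime P \<Longrightarrow> a * b \<in> P \<longleftrightarrow> a \<in> P \<or> b \<in> P"
  unfolding is_prime_def by (metis ideal_mult mult.commute)
lemma prime_one: "is_prime P \<Longrightarrow> 1 \<notin> P" by (simp add: is_prime_def)
lemma prime_power: "is_prime P \<Longrightarrow> a ^ k \<in> P \<Longrightarrow> a \<in> P"
  by (induction k) (auto simp: prime_mult prime_one)
lemma prime_prod: "is_prime P \<Longrightarrow> finite K \<Longrightarrow> (\<And>k. k \<in> K \<Longrightarrow> f k \<notin> P) \<Longrightarrow> prod f K \<notin> P"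
proof (induction K rule: infinite_finite_induct)
  case (insert k K)
  then have "f k \<notin> P" "prod f K \<notin> P" by simp_all
  with insert show ?case by (simp add: prime_mult)
qed (simp_all add: prime_one)

lemma ideal_of_least: "is_ideal J \<Longrightarrow> S \<subseteq> J \<Longrightarrow> ideal_of S \<subseteq> J"
proof
  fix x assume J: "is_ideal J" "S \<subseteq> J" and "x \<in> ideal_of S"
  from this(3) show "x \<in> J" by induction (use J in \<open>auto intro: ideal_zero ideal_add ideal_mult\<close>)
qed

lemma ideal_of_base: "s \<in> S \<Longrightarrow> s \<in> ideal_of S"
  using ideal_of.step[of s S 0 1] ideal_of.zero[of S] by simp

lemma ideal_of_ideal: "is_ideal (ideal_of S)"
proof -
  have add: "x + y \<in> ideal_of S" if "x \<in> ideal_of S" "y \<in> ideal_of S" for x y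
    using that by induction (auto simp: add.assoc intro: ideal_of.step)
  have mult: "c * x \<in> ideal_of S" if "x \<in> ideal_of S" for c x
    using that
  proof induction
    case (step s x d)
    then show ?case using ideal_of.step[of s S "c * x" "c * d"] by (simp add: algebra_simps)
  qed (simp add: ideal_of.zero)
  show ?thesis using add mult by (auto simp: is_ideal_def ideal_of.zero)
qed

lemma ideal_of_mono: "S \<subseteq> T \<Longrightarrow> ideal_of S \<subseteq> ideal_of T"
  by (rule ideal_of_least[OF ideal_of_ideal]) (auto intro: ideal_of_base)

lemma ideal_of_subset_iff: "is_ideal J \<Longrightarrow> ideal_of S \<subseteq> J \<longleftrightarrow> S \<subseteq> J"
  using ideal_of_least ideal_of_base by blast

lemma ideal_of_image:
  assumes "is_ideal A" "finite K" "x \<in> ideal_of (v ` K \<union> A)"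
  shows "\<exists>c. x - (\<Sum>i\<in>K. c i * v i) \<in> A"
  using assms(3)
proof induction
  case zero
  show ?case by (rule exI[of _ "\<lambda>_. 0"]) (use assms in \<open>simp add: ideal_zero\<close>)
next
  case (step s x d)
  then obtain c where c: "x - (\<Sum>i\<in>K. c i * v i) \<in> A" by auto
  show ?case
  proof (cases "s \<in> A")
    case True
    have "d * s + (x - (\<Sum>i\<in>K. c i * v i)) \<in> A"
      using True c assms(1) by (simp add: ideal_add ideal_mult)
    then show ?thesis by (intro exI[of _ c]) (simp add: algebra_simps)
  next
    case False
    then obtain k where k: "k \<in> K" "s = v k" using step by auto
    have "(\<Sum>i\<in>K. (c(k := c k + d)) i * v i) = (\<Sum>i\<in>K. c i * v i) + d * v k"
      using k assms(2) by (simp add: sum.remove[OF assms(2) k(1)] algebra_simps)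
    then show ?thesis using c k by (intro exI[of _ "c(k := c k + d)"]) (simp add: algebra_simps)
  qed
qed

lemma ideal_of_insert:
  assumes "is_ideal A" "x \<in> ideal_of (insert a A)"
  shows "\<exists>c. x - c * a \<in> A"
  using ideal_of_image[OF assms(1), of "{()}" x "\<lambda>_. a"] assms(2) by auto

text \<open>
  Every sequence eventually meets the ideal generated by its earlier terms.  This form passes
  to polynomials by an argument with polynomials of minimal degree.
\<close>
definition noeth :: "'a::comm_ring_1 itself \<Rightarrow> bool" where
  "noeth _ \<longleftrightarrow> (\<forall>f :: nat \<Rightarrow> 'a. \<exists>n. f n \<in> ideal_of (f ` {..<n}))"

lemma noeth_maximal:
  fixes F :: "'a::comm_ring_1 set set"
  assumes N: "noeth TYPE('a)" and "F \<noteq> {}" and F: "\<And>I. I \<in> F \<Longrightarrow> is_ideal I"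
  shows "\<exists>M\<in>F. \<forall>I\<in>F. M \<subseteq> I \<longrightarrow> I = M"
proof (rule ccontr)
  assume "\<not> ?thesis"
  then have "\<forall>M\<in>F. \<exists>I\<in>F. M \<subset> I" by blast
  then obtain nx where nx: "\<And>M. M \<in> F \<Longrightarrow> nx M \<in> F \<and> M \<subset> nx M" by metis
  obtain I0 where I0: "I0 \<in> F" using assms by auto
  define G where "G = rec_nat I0 (\<lambda>_. nx)"
  have G0: "G 0 = I0" and GS: "\<And>n. G (Suc n) = nx (G n)" by (auto simp: G_def)
  have GF: "G n \<in> F" for n by (induction n) (auto simp: G0 GS I0 nx)
  have "\<exists>x. x \<in> G (Suc n) \<and> x \<notin> G n" for n using nx[OF GF[of n]] by (auto simp: GS)
  then obtain f where f: "\<And>n. f n \<in> G (Suc n) \<and> f n \<notin> G n" by metis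
  have mono: "G m \<subseteq> G n" if "m \<le> n" for m n
    using that by (rule lift_Suc_mono_le[rotated]) (use nx GF GS in blast)
  have sub: "f ` {..<n} \<subseteq> G n" for n
  proof
    fix x assume "x \<in> f ` {..<n}"
    then obtain m where m: "m < n" "x = f m" by auto
    then show "x \<in> G n" using f[of m] mono[of "Suc m" n] by auto
  qed
  obtain n where "f n \<in> ideal_of (f ` {..<n})" using N by (auto simp: noeth_def)
  then show False using ideal_of_least[OF F[OF GF] sub] f[of n] by blast
qed

lemma noeth_induct [consumes 2]:
  fixes I :: "'a::comm_ring_1 set"
  assumes N: "noeth TYPE('a)" and "is_ideal I"
    and step: "\<And>I. is_ideal I \<Longrightarrow> (\<And>J. is_ideal J \<Longrightarrow> I \<subset> J \<Longrightarrow> Q J) \<Longrightarrow> Q I"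
  shows "Q I"
proof (rule ccontr)
  assume "\<not> Q I"
  then obtain M where M: "is_ideal M" "\<not> Q M" "\<And>J. is_ideal J \<Longrightarrow> \<not> Q J \<Longrightarrow> M \<subseteq> J \<Longrightarrow> J = M"
    using noeth_maximal[OF N, of "{J. is_ideal J \<and> \<not> Q J}"] assms(2) by blast
  then show False using step[of M] by blast
qed

text \<open>
  An ideal maximal among those containing \<open>J\<close> and disjoint from the multiplicative set is prime.
\<close>
lemma prime_disjoint:
  fixes J :: "'a::comm_ring_1 set"
  assumes N: "noeth TYPE('a)" and J: "is_ideal J" and S1: "1 \<in> S"
    and SM: "\<And>a b. a \<in> S \<Longrightarrow> b \<in> S \<Longrightarrow> a * b \<in> S" and D: "J \<inter> S = {}"
  shows "\<exists>P. is_prime P \<and> J \<subseteq> P \<and> P \<inter> S = {}"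
proof -
  obtain P where P: "is_ideal P" "J \<subseteq> P" "P \<inter> S = {}"
    and mx: "\<And>I. is_ideal I \<Longrightarrow> J \<subseteq> I \<Longrightarrow> I \<inter> S = {} \<Longrightarrow> P \<subseteq> I \<Longrightarrow> I = P"
  proof -
    have "{I. is_ideal I \<and> J \<subseteq> I \<and> I \<inter> S = {}} \<noteq> {}" using J D by auto
    from noeth_maximal[OF N this] show ?thesis using that by auto
  qed
  have ex: "\<exists>s c. s \<in> S \<and> s - c * a \<in> P" if "a \<notin> P" for a
  proof -
    have sub: "insert a P \<subseteq> ideal_of (insert a P)" by (auto intro: ideal_of_base)
    have "ideal_of (insert a P) \<inter> S \<noteq> {}"
    proof
      assume "ideal_of (insert a P) \<inter> S = {}"
      then have "ideal_of (insert a P) = P"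
        by (intro mx) (use sub P in \<open>auto simp: ideal_of_ideal\<close>)
      then show False using sub that by auto
    qed
    then obtain s where "s \<in> S" "s \<in> ideal_of (insert a P)" by auto
    then show ?thesis using ideal_of_insert[OF P(1)] by metis
  qed
  have "a \<in> P \<or> b \<in> P" if ab: "a * b \<in> P" for a b
  proof (rule ccontr)
    assume "\<not> ?thesis"
    then obtain s c t d where st: "s \<in> S" "s - c * a \<in> P" "t \<in> S" "t - d * b \<in> P"
      using ex[of a] ex[of b] by blast
    have "s * t = (s - c * a) * t + (c * a) * (t - d * b) + c * d * (a * b)" by (simp add: algebra_simps)
    then have "s * t \<in> P" using st ab P(1) by (simp add: ideal_add ideal_mult ideal_mult2)
    then show False using SM st P by blast
  qed
  then have "is_prime P" using P S1 by (auto simp: is_prime_def)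
  then show ?thesis using P by blast
qed

lemma prime_over:
  fixes J :: "'a::comm_ring_1 set"
  assumes "noeth TYPE('a)" "is_ideal J" "\<And>k. l ^ k \<notin> J"
  shows "\<exists>P. is_prime P \<and> J \<subseteq> P \<and> l \<notin> P"
proof -
  have "\<exists>P. is_prime P \<and> J \<subseteq> P \<and> P \<inter> range (\<lambda>k. l ^ k) = {}"
    by (rule prime_disjoint[OF assms(1,2)])
       (use assms(3) in \<open>auto simp: power_add[symmetric] intro: range_eqI[of _ _ 0]\<close>)
  then obtain P where P: "is_prime P" "J \<subseteq> P" "P \<inter> range (\<lambda>k. l ^ k) = {}" by auto
  moreover have "l \<in> range (\<lambda>k. l ^ k)" by (rule range_eqI[of _ _ 1]) simp
  ultimately show ?thesis by blast
qed

text \<open>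
  A finite set of primes that contains all minimal primes over \<open>J\<close>.  By Noetherian induction: if
  \<open>a b\<close> lies in \<open>J\<close> but neither factor does, a prime over \<open>J\<close> lies over \<open>J + (a)\<close> or \<open>J + (b)\<close>.
\<close>
lemma prime_cover:
  fixes J :: "'a::comm_ring_1 set"
  assumes N: "noeth TYPE('a)" and "is_ideal J"
  shows "\<exists>S. finite S \<and> (\<forall>P\<in>S. is_prime P \<and> J \<subseteq> P) \<and> (\<forall>P. is_prime P \<longrightarrow> J \<subseteq> P \<longrightarrow> (\<exists>Q\<in>S. Q \<subseteq> P))"
  using assms
proof (induction J rule: noeth_induct)
  case (1 J)
  consider "1 \<in> J" | "is_prime J" | a b where "a * b \<in> J" "a \<notin> J" "b \<notin> J"
    using 1(1) by (auto simp: is_prime_def)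
  then show ?case
  proof cases
    case 1
    then have "\<not> (is_prime P \<and> J \<subseteq> P)" for P by (auto simp: is_prime_def)
    then show ?thesis by (intro exI[of _ "{}"]) auto
  next
    case 2
    then show ?thesis by (intro exI[of _ "{J}"]) auto
  next
    case 3
    have sub: "J \<subset> ideal_of (insert x J)" if "x \<notin> J" for x
      using that ideal_of_base[of _ "insert x J"] by blast
    obtain S where S: "finite S" "\<forall>P\<in>S. is_prime P \<and> ideal_of (insert a J) \<subseteq> P"
        "\<forall>P. is_prime P \<longrightarrow> ideal_of (insert a J) \<subseteq> P \<longrightarrow> (\<exists>Q\<in>S. Q \<subseteq> P)"
      using 1(2)[OF ideal_of_ideal sub[OF 3(2)]] by blast
    obtain T where T: "finite T" "\<forall>P\<in>T. is_prime P \<and> ideal_of (insert b J) \<subseteq> P"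
        "\<forall>P. is_prime P \<longrightarrow> ideal_of (insert b J) \<subseteq> P \<longrightarrow> (\<exists>Q\<in>T. Q \<subseteq> P)"
      using 1(2)[OF ideal_of_ideal sub[OF 3(3)]] by blast
    have "\<exists>Q\<in>S \<union> T. Q \<subseteq> P" if P: "is_prime P" "J \<subseteq> P" for P
    proof -
      have "a \<in> P \<or> b \<in> P" using P 3 prime_mult by blast
      then have "ideal_of (insert a J) \<subseteq> P \<or> ideal_of (insert b J) \<subseteq> P"
        using P by (auto simp: ideal_of_subset_iff prime_ideal)
      then show ?thesis
      proof
        assume "ideal_of (insert a J) \<subseteq> P"
        then obtain Q where "Q \<in> S" "Q \<subseteq> P" using P(1) S(3) by meson
        then show ?thesis by blast
      next
        assume "ideal_of (insert b J) \<subseteq> P"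
        then obtain Q where "Q \<in> T" "Q \<subseteq> P" using P(1) T(3) by meson
        then show ?thesis by blast
      qed
    qed
    moreover have "\<forall>P\<in>S \<union> T. is_prime P \<and> J \<subseteq> P"
    proof
      fix P assume "P \<in> S \<union> T"
      then have "is_prime P" "ideal_of (insert a J) \<subseteq> P \<or> ideal_of (insert b J) \<subseteq> P"
        using S(2) T(2) by (metis UnE)+
      then show "is_prime P \<and> J \<subseteq> P" using sub[OF 3(2)] sub[OF 3(3)] by blast
    qed
    ultimately show ?thesis using S(1) T(1) by (metis finite_UnI)
  qed
qed

text \<open>
  Prime avoidance in a coset.  A minimal member of \<open>S\<close> is treated last: it can be corrected by an
  element lying in all the other primes but not in it.
\<close>
lemma prime_avoid:
  assumes "finite S" "\<And>P. P \<in> S \<Longrightarrow> is_prime P \<and> \<not> J \<subseteq> P" "is_ideal J"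
  shows "\<exists>t\<in>J. \<forall>P\<in>S. a + t \<notin> P"
  using assms
proof (induction "card S" arbitrary: S)
  case 0
  then show ?case using ideal_zero by auto
next
  case (Suc n)
  then have "S \<noteq> {}" by auto
  then obtain q where q: "q \<in> S" "\<And>P. P \<in> S \<Longrightarrow> P \<subseteq> q \<Longrightarrow> P = q"
    using finite_has_minimal[OF Suc.prems(1)] by blast
  have pq: "is_prime q" "\<not> J \<subseteq> q" using q Suc.prems by auto
  obtain t0 where t0: "t0 \<in> J" "\<forall>P\<in>S - {q}. a + t0 \<notin> P"
  proof -
    have "n = card (S - {q})" using Suc.hyps(2) Suc.prems(1) q(1) by simp
    then have "\<exists>t\<in>J. \<forall>P\<in>S - {q}. a + t \<notin> P"
      by (rule Suc.hyps(1)) (use Suc.prems in auto)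
    then show ?thesis using that by blast
  qed
  show ?case
  proof (cases "a + t0 \<in> q")
    case False
    then show ?thesis using t0 q by (intro bexI[of _ t0]) auto
  next
    case True
    have "\<exists>x. x \<in> P \<and> x \<notin> q" if "P \<in> S - {q}" for P using q(2)[of P] that by auto
    then obtain x where x: "\<And>P. P \<in> S - {q} \<Longrightarrow> x P \<in> P \<and> x P \<notin> q" by metis
    obtain j where j: "j \<in> J" "j \<notin> q" using pq by auto
    define s where "s = j * prod x (S - {q})"
    have fin: "finite (S - {q})" using Suc.prems by auto
    have "s \<notin> q" using j x prime_prod[OF pq(1) fin, of x] pq by (auto simp: s_def prime_mult)
    have sJ: "s \<in> J" using j Suc.prems by (auto simp: s_def ideal_mult2)
    have sP: "s \<in> P" if "P \<in> S - {q}" for P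
    proof -
      have "prod x (S - {q}) = x P * prod x (S - {q} - {P})" by (rule prod.remove[OF fin that])
      then have "s = (j * prod x (S - {q} - {P})) * x P" by (simp add: s_def mult_ac)
      moreover have "is_ideal P" using Suc.prems that prime_ideal by auto
      ultimately show ?thesis using x[OF that] by (simp add: ideal_mult)
    qed
    have "a + (t0 + s) \<notin> P" if "P \<in> S" for P
    proof (cases "P = q")
      case True
      have "is_ideal q" using pq prime_ideal by auto
      then show ?thesis
        using \<open>s \<notin> q\<close> \<open>a + t0 \<in> q\<close> True ideal_diff[of q "a + (t0 + s)" "a + t0"] by (auto simp: algebra_simps)
    next
      case False
      then have "s \<in> P" "a + t0 \<notin> P" "is_ideal P" using sP t0 that Suc.prems prime_ideal by auto
      then show ?thesis using ideal_diff[of P "a + (t0 + s)" s] by (auto simp: algebra_simps)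
    qed
    then show ?thesis using t0 sJ Suc.prems by (intro bexI[of _ "t0 + s"]) (auto intro: ideal_add)
  qed
qed

section \<open>Chains of primes and general position\<close>

text \<open>
  A chain of \<open>k + 1\<close> primes containing \<open>W\<close> and ending in \<open>P\<close>: the height of \<open>P/W\<close> is at least \<open>k\<close>.
\<close>
primrec ht_ge :: "'a::comm_ring_1 set \<Rightarrow> nat \<Rightarrow> 'a set \<Rightarrow> bool" where
  "ht_ge W 0 P \<longleftrightarrow> is_prime P \<and> W \<subseteq> P"
| "ht_ge W (Suc k) P \<longleftrightarrow> is_prime P \<and> W \<subseteq> P \<and> (\<exists>Q. ht_ge W k Q \<and> Q \<subset> P)"

definition dim_le :: "'a::comm_ring_1 set \<Rightarrow> nat \<Rightarrow> bool" where
  "dim_le W d \<longleftrightarrow> (\<forall>P. \<not> ht_ge W (Suc d) P)"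

lemma ht_ge_prime: "ht_ge W k P \<Longrightarrow> is_prime P \<and> W \<subseteq> P" by (cases k) auto

lemma ht_ge_Suc: "ht_ge W k Q \<Longrightarrow> is_prime P \<Longrightarrow> Q \<subset> P \<Longrightarrow> ht_ge W (Suc k) P"
  using ht_ge_prime[of W k Q] by (simp only: ht_ge.simps) blast

lemma ht_ge_less: "ht_ge W k P \<Longrightarrow> j \<le> k \<Longrightarrow> ht_ge W j P"
proof (induction k arbitrary: j P)
  case (Suc k)
  show ?case
  proof (cases j)
    case 0
    then show ?thesis using Suc.prems by auto
  next
    case (Suc j')
    obtain Q where "ht_ge W k Q" "Q \<subset> P" using Suc.prems by (simp only: ht_ge.simps) blast
    then show ?thesis using Suc.prems Suc.IH[of Q j'] Suc ht_ge_Suc[of W j' Q P] by simp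
  qed
qed auto

lemma ht_ge_mono: "ht_ge W k Q \<Longrightarrow> is_prime P \<Longrightarrow> Q \<subseteq> P \<Longrightarrow> ht_ge W k P"
proof (cases k)
  case (Suc j)
  assume h: "ht_ge W k Q" "is_prime P" "Q \<subseteq> P"
  then obtain Q' where "ht_ge W j Q'" "Q' \<subset> Q" "W \<subseteq> Q" unfolding Suc ht_ge.simps by (elim conjE exE)
  then have "ht_ge W j Q' \<and> Q' \<subset> P" "W \<subseteq> P" using h by auto
  then show ?thesis unfolding Suc ht_ge.simps using h by blast
qed auto

text \<open>
  Chains are concatenated at the bottom: if every prime over \<open>W'\<close> has height \<open>j\<close> over \<open>W\<close>, then
  passing from \<open>W\<close> to \<open>W'\<close> costs \<open>j\<close> dimensions.
\<close>
lemma ht_ge_base: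
  assumes "ht_ge W' k P" "\<And>Q. is_prime Q \<Longrightarrow> W' \<subseteq> Q \<Longrightarrow> Q \<subseteq> P \<Longrightarrow> ht_ge W j Q"
  shows "ht_ge W (k + j) P"
  using assms
proof (induction k arbitrary: P)
  case (Suc k)
  then obtain Q where Q: "ht_ge W' k Q" "Q \<subset> P" by auto
  have "ht_ge W (k + j) Q" by (rule Suc.IH[OF Q(1)]) (use Suc.prems Q in auto)
  then show ?case using ht_ge_Suc[of W "k + j" Q P] Q Suc.prems(1) by simp
qed auto

text \<open>
  The general position argument behind Bass's stable range theorem.  After modifying \<open>a\<^sub>0, \<dots>, a\<^sub>M\<^sub>-\<^sub>1\<close> by
  elements of \<open>J\<close>, every prime containing \<open>W\<close> and all of them either contains \<open>J\<close> or has height at least \<open>M\<close>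
  over \<open>W\<close>.  The next element is chosen outside the finitely many primes that are minimal over the
  previous ones and do not contain \<open>J\<close>.
\<close>
lemma stable_range:
  fixes W J :: "'a::comm_ring_1 set"
  assumes N: "noeth TYPE('a)" and "is_ideal W" "is_ideal J"
  shows "\<exists>t. (\<forall>k<M. t k \<in> J) \<and>
    (\<forall>P. is_prime P \<longrightarrow> W \<subseteq> P \<longrightarrow> (\<forall>k<M. a k + t k \<in> P) \<longrightarrow> \<not> J \<subseteq> P \<longrightarrow> ht_ge W M P)"
proof (induction M)
  case (Suc M)
  then obtain t where t: "\<forall>k<M. t k \<in> J"
    and t2: "\<forall>P. is_prime P \<longrightarrow> W \<subseteq> P \<longrightarrow> (\<forall>k<M. a k + t k \<in> P) \<longrightarrow> \<not> J \<subseteq> P \<longrightarrow> ht_ge W M P"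
    by (elim exE conjE)
  define V where "V = ideal_of (W \<union> (\<lambda>k. a k + t k) ` {..<M})"
  have V: "is_ideal V" by (simp add: V_def ideal_of_ideal)
  have Viff: "V \<subseteq> P \<longleftrightarrow> W \<subseteq> P \<and> (\<forall>k<M. a k + t k \<in> P)" if "is_prime P" for P
    using that by (auto simp: V_def ideal_of_subset_iff prime_ideal)
  obtain S where S: "finite S" "\<forall>P\<in>S. is_prime P \<and> V \<subseteq> P"
    "\<forall>P. is_prime P \<longrightarrow> V \<subseteq> P \<longrightarrow> (\<exists>Q\<in>S. Q \<subseteq> P)" using prime_cover[OF N V] by (elim exE conjE)
  obtain s where s: "s \<in> J" "\<forall>P\<in>{Q\<in>S. \<not> J \<subseteq> Q}. a M + s \<notin> P"
  proof -
    have "\<exists>t\<in>J. \<forall>P\<in>{Q\<in>S. \<not> J \<subseteq> Q}. a M + t \<notin> P"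
      by (rule prime_avoid) (use S(1,2) assms in simp_all)
    then show ?thesis using that by blast
  qed
  have "ht_ge W (Suc M) P" if P: "is_prime P" "W \<subseteq> P" "\<forall>k<Suc M. a k + (t(M := s)) k \<in> P" "\<not> J \<subseteq> P" for P
  proof -
    have "\<forall>k<M. a k + t k \<in> P" using P(3) by (metis fun_upd_apply less_SucI nat_neq_iff)
    then have "V \<subseteq> P" using Viff P by auto
    then obtain Q where Q: "Q \<in> S" "Q \<subseteq> P" using S(3) P(1) by blast
    then have "\<not> J \<subseteq> Q" using P(4) by blast
    then have "a M + s \<notin> Q" using s(2) Q(1) by blast
    moreover have "a M + s \<in> P" using P(3) by (metis fun_upd_same lessI)
    ultimately have "Q \<subset> P" using Q(2) by blast
    moreover have "ht_ge W M Q" using t2 Viff[of Q] S Q \<open>\<not> J \<subseteq> Q\<close> by blast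
    ultimately show ?thesis using ht_ge_Suc[of W M Q P] P by blast
  qed
  moreover have "\<forall>k<Suc M. (t(M := s)) k \<in> J" using t s by (simp add: less_Suc_eq)
  ultimately show ?case by blast
qed simp

section \<open>Hilbert's basis theorem\<close>

text \<open>
  Starting from a sequence that violates the condition, a sequence \<open>g\<close> of polynomials of
  minimal degree outside the ideal of the earlier ones is built.  Its leading coefficients must satisfy a
  linear relation, and that relation produces a polynomial of smaller degree.
\<close>
lemma hilbert_basis:
  assumes N: "noeth TYPE('a::comm_ring_1)"
  shows "noeth TYPE('a poly)"
  unfolding noeth_def
proof (rule allI, rule ccontr)
  fix f :: "nat \<Rightarrow> 'a poly" assume nf: "\<nexists>n. f n \<in> ideal_of (f ` {..<n})"
  define B where "B = ideal_of (range f)"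
  define pick where "pick T = (ARG_MIN degree x. x \<in> B \<and> x \<notin> ideal_of T)" for T
  have exB: "\<exists>x. x \<in> B \<and> x \<notin> ideal_of T" if T: "finite T" "T \<subseteq> B" for T
  proof (rule ccontr)
    assume c: "\<not> ?thesis"
    have "\<exists>n. x \<in> ideal_of (f ` {..<n})" if "x \<in> B" for x
      using that unfolding B_def
    proof (induction rule: ideal_of.induct)
      case zero
      show ?case by (intro exI ideal_of.zero)
    next
      case (step s x c)
      then obtain m n where mn: "s = f m" "x \<in> ideal_of (f ` {..<n})" by auto
      have "ideal_of (f ` {..<n}) \<subseteq> ideal_of (f ` {..<max n (Suc m)})"
        by (rule ideal_of_mono) auto
      then have "c * s + x \<in> ideal_of (f ` {..<max n (Suc m)})"
        by (intro ideal_of.step) (use mn in auto)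
      then show ?case by (rule exI)
    qed
    then obtain n where n: "\<And>x. x \<in> B \<Longrightarrow> x \<in> ideal_of (f ` {..<n x})" by metis
    define m where "m = Max (insert 0 (n ` T))"
    have "T \<subseteq> ideal_of (f ` {..<m})"
    proof
      fix x assume x: "x \<in> T"
      then have "n x \<le> m" using T by (auto simp: m_def)
      then have "f ` {..<n x} \<subseteq> f ` {..<m}" by auto
      then show "x \<in> ideal_of (f ` {..<m})"
        using n[of x] x T ideal_of_mono[of "f ` {..<n x}" "f ` {..<m}"] by blast
    qed
    then have "ideal_of T \<subseteq> ideal_of (f ` {..<m})" by (simp add: ideal_of_least ideal_of_ideal)
    moreover have "f m \<in> ideal_of T" using c by (auto simp: B_def intro: ideal_of_base)
    ultimately show False using nf by blast
  qed
  have pick: "pick T \<in> B \<and> pick T \<notin> ideal_of T \<and> (\<forall>x. x \<in> B \<and> x \<notin> ideal_of T \<longrightarrow> degree (pick T) \<le> degree x)"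
    if T: "finite T" "T \<subseteq> B" for T
  proof -
    obtain x where "x \<in> B \<and> x \<notin> ideal_of T" using exB[OF T] by (rule exE)
    from arg_min_nat_lemma[of "\<lambda>x. x \<in> B \<and> x \<notin> ideal_of T" x degree, OF this]
    show ?thesis unfolding pick_def by blast
  qed
  define H where "H = rec_nat {} (\<lambda>_ T. insert (pick T) T)"
  define g where "g k = pick (H k)" for k
  have HS: "H (Suc k) = insert (g k) (H k)" and H0: "H 0 = {}" for k by (auto simp: H_def g_def)
  have Hg: "H k = g ` {..<k}" for k by (induction k) (auto simp: HS H0 lessThan_Suc)
  have HB: "finite (H k) \<and> H k \<subseteq> B" for k
    by (induction k) (use pick in \<open>auto simp: HS H0 g_def\<close>)
  have g: "g k \<in> B" "g k \<notin> ideal_of (g ` {..<k})"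
     "\<And>x. x \<in> B \<Longrightarrow> x \<notin> ideal_of (g ` {..<k}) \<Longrightarrow> degree (g k) \<le> degree x" for k
  proof -
    have "g k \<in> B \<and> g k \<notin> ideal_of (H k) \<and> (\<forall>x. x \<in> B \<and> x \<notin> ideal_of (H k) \<longrightarrow> degree (g k) \<le> degree x)"
      unfolding g_def by (rule pick) (use HB[of k] in auto)
    then show "g k \<in> B" "g k \<notin> ideal_of (g ` {..<k})"
     "\<And>x. x \<in> B \<Longrightarrow> x \<notin> ideal_of (g ` {..<k}) \<Longrightarrow> degree (g k) \<le> degree x"
      unfolding Hg by simp_all
  qed
  have Bid: "is_ideal B" by (simp add: B_def ideal_of_ideal)
  have deg: "degree (g i) \<le> degree (g j)" if "i \<le> j" for i j
  proof (rule g(3)[OF g(1)])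
    have "g ` {..<i} \<subseteq> g ` {..<j}" using that by auto
    then show "g j \<notin> ideal_of (g ` {..<i})"
      using g(2)[of j] ideal_of_mono[of "g ` {..<i}" "g ` {..<j}"] by blast
  qed
  obtain n where "lead_coeff (g n) \<in> ideal_of ((\<lambda>k. lead_coeff (g k)) ` {..<n})"
    using N unfolding noeth_def by meson
  then have "lead_coeff (g n) \<in> ideal_of ((\<lambda>k. lead_coeff (g k)) ` {..<n} \<union> {0})"
    using ideal_of_mono[of "(\<lambda>k. lead_coeff (g k)) ` {..<n}" "(\<lambda>k. lead_coeff (g k)) ` {..<n} \<union> {0}"] by blast
  moreover have "is_ideal {0 :: 'a}" by (simp add: is_ideal_def)
  ultimately obtain c where c: "lead_coeff (g n) = (\<Sum>i<n. c i * lead_coeff (g i))"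
    using ideal_of_image[of "{0::'a}" "{..<n}" "lead_coeff (g n)" "\<lambda>k. lead_coeff (g k)"] by auto
  define s where "s = (\<Sum>i<n. monom (c i) (degree (g n) - degree (g i)) * g i)"
  have s_in: "s \<in> ideal_of (g ` {..<n})" unfolding s_def
    by (intro ideal_sum[OF ideal_of_ideal] ideal_mult[OF ideal_of_ideal] ideal_of_base) auto
  have "degree s \<le> degree (g n)" unfolding s_def
  proof (rule degree_sum_le)
    fix i assume i: "i \<in> {..<n}"
    have "degree (monom (c i) (degree (g n) - degree (g i)) * g i) \<le> (degree (g n) - degree (g i)) + degree (g i)"
      by (rule order.trans[OF degree_mult_le]) (simp add: degree_monom_le)
    then show "degree (monom (c i) (degree (g n) - degree (g i)) * g i) \<le> degree (g n)"
      using deg[of i n] i by simp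
  qed simp
  moreover have "coeff s (degree (g n)) = lead_coeff (g n)"
    unfolding s_def coeff_sum c
    by (rule sum.cong[OF refl]) (use deg in \<open>auto simp: coeff_monom_mult less_imp_le\<close>)
  moreover define p where "p = g n - s"
  ultimately have p: "degree p \<le> degree (g n)" "coeff p (degree (g n)) = 0"
    by (auto simp: degree_diff_le)
  have "s \<in> B" using s_in ideal_of_least[OF Bid, of "g ` {..<n}"] g(1) by blast
  then have pB: "p \<in> B" using g(1) Bid by (simp add: p_def ideal_diff)
  have pn: "p \<notin> ideal_of (g ` {..<n})"
  proof
    assume "p \<in> ideal_of (g ` {..<n})"
    then have "p + s \<in> ideal_of (g ` {..<n})" by (intro ideal_add[OF ideal_of_ideal] s_in)
    then show False using g(2)[of n] by (simp add: p_def)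
  qed
  then have "p \<noteq> 0" using ideal_of.zero[of "g ` {..<n}"] by auto
  moreover have "degree p = degree (g n)" using g(3)[OF pB pn] p by simp
  ultimately show False using p(2) by (metis leading_coeff_0_iff)
qed

section \<open>Primes of a polynomial ring and their contractions\<close>

text \<open>
  The ideal \<open>I[X]\<close>.
\<close>
definition ext :: "'a::comm_ring_1 set \<Rightarrow> 'a poly set" where
  "ext I = {p. \<forall>i. coeff p i \<in> I}"

text \<open>
  The intersection with the coefficient ring.
\<close>
definition contr :: "'a::comm_ring_1 poly set \<Rightarrow> 'a set" where
  "contr P = {r. [:r:] \<in> P}"

lemma ext_ideal: "is_ideal I \<Longrightarrow> is_ideal (ext I)"
  unfolding is_ideal_def[of "ext I"]
  by (auto simp: ext_def coeff_mult ideal_zero ideal_add intro!: ideal_sum ideal_mult)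

lemma ext_const: "is_ideal I \<Longrightarrow> [:r:] \<in> ext I \<longleftrightarrow> r \<in> I"
  by (auto simp: ext_def coeff_pCons ideal_zero split: nat.splits)

lemma ext_mono: "I \<subseteq> J \<Longrightarrow> ext I \<subseteq> ext J" by (auto simp: ext_def)

lemma ext_UNIV: "is_ideal I \<Longrightarrow> 1 \<in> I \<Longrightarrow> ext I = UNIV"
  by (auto simp: ext_def ideal_one)

lemma contr_ideal: "is_ideal P \<Longrightarrow> is_ideal (contr P)"
proof -
  assume P: "is_ideal P"
  have "[:x + y:] \<in> P" if "[:x:] \<in> P" "[:y:] \<in> P" for x y
    using ideal_add[OF P that] by simp
  moreover have "[:c * x:] \<in> P" if "[:x:] \<in> P" for x c
    using ideal_mult[OF P that, of "[:c:]"] by (simp add: mult.commute)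
  ultimately show ?thesis
    unfolding is_ideal_def[of "contr P"] using ideal_zero[OF P] by (simp add: contr_def)
qed

lemma contr_prime: "is_prime P \<Longrightarrow> is_prime (contr P)"
proof -
  assume P: "is_prime P"
  have "a \<in> contr P \<or> b \<in> contr P" if "a * b \<in> contr P" for a b
    using that prime_mult[OF P, of "[:a:]" "[:b:]"] by (simp add: contr_def mult.commute)
  moreover have "1 \<notin> contr P" using prime_one[OF P] by (simp add: contr_def one_pCons)
  ultimately show ?thesis using contr_ideal[OF prime_ideal[OF P]] by (simp add: is_prime_def)
qed

lemma ext_subset: "is_ideal P \<Longrightarrow> ext I \<subseteq> P \<longleftrightarrow> I \<subseteq> contr P \<or> 0 \<notin> I"
proof -
  assume P: "is_ideal P"
  have "p \<in> P" if p: "p \<in> ext I" "I \<subseteq> contr P" for p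
  proof -
    have "[:coeff p i:] * monom 1 i \<in> P" for i
      by (rule ideal_mult2[OF P]) (use p in \<open>auto simp: ext_def contr_def\<close>)
    then have "(\<Sum>i\<le>degree p. [:coeff p i:] * monom 1 i) \<in> P"
      by (intro ideal_sum[OF P])
    then show ?thesis by (simp add: smult_monom poly_as_sum_of_monoms)
  qed
  moreover have "[:r:] \<in> ext I" if "r \<in> I" "0 \<in> I" for r
    using that by (auto simp: ext_def coeff_pCons split: nat.splits)
  moreover have "ext I = {}" if "0 \<notin> I"
  proof -
    have "coeff p (Suc (degree p)) = 0" for p :: "'a poly" by (rule coeff_eq_0) simp
    then show ?thesis using that by (auto simp: ext_def) metis
  qed
  ultimately show ?thesis by (auto simp: contr_def)
qed

lemma ext_subset_iff: "is_ideal P \<Longrightarrow> is_ideal I \<Longrightarrow> ext I \<subseteq> P \<longleftrightarrow> I \<subseteq> contr P"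
  by (simp add: ext_subset ideal_zero)

text \<open>
  Cutting off the top coefficients that lie in \<open>p\<close>.
\<close>
lemma drop_lead:
  assumes "is_ideal p" "w \<notin> ext p"
  shows "\<exists>v. w - v \<in> ext p \<and> lead_coeff v \<notin> p \<and> degree v \<le> degree w"
proof -
  define K where "K = {i. i \<le> degree w \<and> coeff w i \<notin> p}"
  have "finite K" by (simp add: K_def)
  obtain i where i: "coeff w i \<notin> p" using assms by (auto simp: ext_def)
  then have "i \<le> degree w" using le_degree[of w i] ideal_zero[OF assms(1)] by metis
  then have "K \<noteq> {}" using i by (auto simp: K_def)
  define n where "n = Max K"
  have n: "n \<in> K" "\<And>j. j \<in> K \<Longrightarrow> j \<le> n" using \<open>finite K\<close> \<open>K \<noteq> {}\<close> by (auto simp: n_def)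
  have big: "coeff w j \<in> p" if "j > n" for j
    using n(2)[of j] that le_degree[of w j] ideal_zero[OF assms(1)] by (force simp: K_def)
  define v where "v = poly_cutoff (Suc n) w"
  have v: "coeff v j = (if j \<le> n then coeff w j else 0)" for j by (auto simp: v_def coeff_poly_cutoff)
  have nz: "coeff w n \<notin> p" "coeff w n \<noteq> 0" using n(1) ideal_zero[OF assms(1)] by (auto simp: K_def)
  have "degree v = n"
    by (intro antisym degree_le le_degree) (use v nz in auto)
  then have "lead_coeff v \<notin> p" using v nz by simp
  moreover have "w - v \<in> ext p" using big v ideal_zero[OF assms(1)] by (auto simp: ext_def not_le)
  moreover have "degree v \<le> degree w" using \<open>degree v = n\<close> n(1) by (simp add: K_def)
  ultimately show ?thesis by blast
qed

text \<open>
  Division by \<open>f\<close> after multiplying with powers of its leading coefficient \<open>s\<close>.  The ideal \<open>I\<close> keeps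
  track of the quotient: its coefficients only involve those coefficients of \<open>g\<close> that are removed.
\<close>
lemma pseudo_division:
  fixes f g :: "'a::comm_ring_1 poly"
  assumes I: "is_ideal I" and f: "degree f \<le> d" "coeff f d = s" "0 < d"
    and g: "\<And>i. d \<le> i \<Longrightarrow> coeff g i \<in> I"
  shows "\<exists>k h. h \<in> ext I \<and> degree (smult (s ^ k) g - h * f) < d"
proof -
  have "degree g < d + n \<Longrightarrow> ?thesis" if "\<And>i. d \<le> i \<Longrightarrow> coeff g i \<in> I" for n
    using that
  proof (induction n arbitrary: g)
    case 0
    then show ?case
      by (intro exI[of _ 0]) (auto simp: ideal_zero[OF ext_ideal[OF I]])
  next
    case (Suc n)
    define a where "a = coeff g (d + n)"
    define g' where "g' = smult s g - monom a n * f"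
    have a: "a \<in> I" using Suc.prems(2) by (simp add: a_def)
    have "coeff g' i = 0" if "i \<ge> d + n" for i
    proof (cases "i = d + n")
      case True
      then show ?thesis by (simp add: g'_def coeff_monom_mult a_def f)
    next
      case False
      then have "i > d + n" using that by simp
      then have "coeff g i = 0" "coeff f (i - n) = 0"
        using Suc.prems(1) f(1) by (auto intro: coeff_eq_0)
      then show ?thesis using \<open>i > d + n\<close> by (simp add: g'_def coeff_monom_mult)
    qed
    then have "degree g' < d + n" using f(3) by (intro degree_lessI) auto
    moreover have "coeff g' i \<in> I" if "i \<ge> d" for i
      unfolding g'_def coeff_diff coeff_smult coeff_monom_mult
      by (rule ideal_diff[OF I ideal_mult[OF I Suc.prems(2)[OF that]]])
         (simp add: ideal_zero[OF I] ideal_mult2[OF I a])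
    ultimately obtain k h where kh: "h \<in> ext I" "degree (smult (s ^ k) g' - h * f) < d"
      using Suc.IH[of g'] by blast
    have eq: "smult (s ^ k) g' - h * f = smult (s ^ Suc k) g - (smult (s ^ k) (monom a n) + h) * f"
      by (simp add: g'_def smult_diff_right algebra_simps)
    have "smult (s ^ k) (monom a n) + h \<in> ext I"
      by (intro ideal_add[OF ext_ideal[OF I]] kh)
         (auto simp: ext_def ideal_zero[OF I] smult_monom intro!: ideal_mult[OF I] a)
    then show ?case using kh(2) eq by metis
  qed
  then show ?thesis using g f(3) by (metis less_add_same_cancel2)
qed

text \<open>
  The fibre of \<open>Spec R[X]\<close> over \<open>p\<close> is one-dimensional: over the residue field of \<open>p\<close>, the
  polynomial \<open>f0\<close> makes \<open>P\<close> a nonzero prime of a principal ideal domain, hence maximal.  The proof runs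
  Euclid's algorithm with pseudo-division by a polynomial \<open>h\<close> of least degree in \<open>P'\<close>.
\<close>
lemma fibre_unique:
  fixes P P' :: "'a::comm_ring_1 poly set"
  assumes P: "is_prime P" "is_prime P'" "P \<subseteq> P'" and c: "contr P = p" "contr P' = p"
    and f0: "f0 \<in> P" "f0 \<notin> ext p"
  shows "P = P'"
proof -
  have pp: "is_prime p" using P(1) c contr_prime by blast
  have pI: "is_ideal p" "is_ideal P" "is_ideal P'" using pp P prime_ideal by auto
  have ext: "ext p \<subseteq> P" "ext p \<subseteq> P'" using c by (auto simp: ext_subset_iff pI)
  define L where "L Q h \<longleftrightarrow> h \<in> Q \<and> lead_coeff h \<notin> p" for Q and h :: "'a poly"
  have low: "\<exists>v. L Q v \<and> degree v \<le> degree w \<and> w - v \<in> ext p"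
    if Q: "Q = P \<or> Q = P'" "w \<in> Q" "w \<notin> ext p" for Q w
  proof -
    obtain v where v: "w - v \<in> ext p" "lead_coeff v \<notin> p" "degree v \<le> degree w"
      using drop_lead[OF pI(1) Q(3)] by blast
    have "is_ideal Q" "w - v \<in> Q" using Q ext v pI by auto
    then have "w - (w - v) \<in> Q" using ideal_diff Q(2) by blast
    then show ?thesis using v by (auto simp: L_def)
  qed
  obtain f1 where "L P f1" using low[of P f0] f0 by blast
  then obtain f where f: "L P f" "\<And>g. L P g \<Longrightarrow> degree f \<le> degree g"
    using ex_has_least_nat[of "L P" f1 degree] by blast
  have "L P' f" using f(1) P by (auto simp: L_def)
  then obtain h where h: "L P' h" "\<And>g. L P' g \<Longrightarrow> degree h \<le> degree g"
    using ex_has_least_nat[of "L P'" f degree] by blast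
  define s where "s = lead_coeff h"
  have s: "s \<notin> p" using h by (simp add: L_def s_def)
  have d: "0 < degree h"
  proof (rule ccontr)
    assume "\<not> ?thesis"
    then obtain r where "h = [:r:]" by (metis degree_eq_zeroE gr0I)
    then show False using h(1) c by (auto simp: L_def contr_def)
  qed
  have div: "\<exists>k q. smult (s ^ k) g - q * h \<in> ext p" if g: "g \<in> P'" for g
  proof -
    obtain k q where kq: "degree (smult (s ^ k) g - q * h) < degree h"
      using pseudo_division[of UNIV h "degree h" s g] d by (auto simp: is_ideal_def s_def)
    define r where "r = smult (s ^ k) g - q * h"
    have "smult (s ^ k) g \<in> P'" using ideal_mult[OF pI(3) g, of "[:s ^ k:]"] by simp
    then have "r \<in> P'" using h by (auto simp: r_def L_def intro!: ideal_diff[OF pI(3)] ideal_mult[OF pI(3)])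
    have "r \<in> ext p"
    proof (rule ccontr)
      assume "r \<notin> ext p"
      then obtain v where "L P' v" "degree v \<le> degree r" using low[of P' r] \<open>r \<in> P'\<close> by blast
      then show False using h(2)[of v] kq by (simp add: r_def)
    qed
    then show ?thesis by (auto simp: r_def)
  qed
  have canc: "g \<in> P" if "smult (s ^ k) g \<in> P" for g k
  proof -
    have "[:s ^ k:] \<notin> P" using s c(1) prime_power[OF pp] by (auto simp: contr_def)
    then show ?thesis using prime_mult[OF P(1), of "[:s ^ k:]" g] that by simp
  qed
  have "h \<in> P"
  proof (rule ccontr)
    assume hP: "h \<notin> P"
    obtain k q where kq: "smult (s ^ k) f - q * h \<in> ext p" using div[of f] f(1) P(3) by (auto simp: L_def)
    have "smult (s ^ k) f \<in> P" using ideal_mult[OF pI(2), of f "[:s ^ k:]"] f(1) by (simp add: L_def)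
    then have "q * h \<in> P" using ideal_diff[OF pI(2), of "smult (s ^ k) f" "smult (s ^ k) f - q * h"] kq ext by auto
    then have q: "q \<in> P" using prime_mult[OF P(1)] hP by blast
    have "q \<notin> ext p"
    proof
      assume "q \<in> ext p"
      then have "smult (s ^ k) f \<in> ext p"
        using ideal_add[OF ext_ideal[OF pI(1)] kq, of "q * h"] ideal_mult2[OF ext_ideal[OF pI(1)]] by auto
      then have "s ^ k * lead_coeff f \<in> p" by (auto simp: ext_def)
      then show False using s f(1) prime_mult[OF pp] prime_power[OF pp] by (auto simp: L_def)
    qed
    then obtain v where v: "L P v" "q - v \<in> ext p" using low[of P q] q by blast
    have "smult (s ^ k) f - v * h \<in> ext p"
      using ideal_add[OF ext_ideal[OF pI(1)] kq ideal_mult2[OF ext_ideal[OF pI(1)] v(2), of h]]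
      by (simp add: algebra_simps)
    then have "coeff (smult (s ^ k) f - v * h) (degree v + degree h) \<in> p" by (simp add: ext_def)
    moreover have "degree f < degree v + degree h" using f(2)[OF v(1)] d by simp
    ultimately have "- (lead_coeff v * s) \<in> p" by (simp add: coeff_eq_0 coeff_mult_degree_sum s_def)
    then have "lead_coeff v * s \<in> p" using ideal_uminus[OF pI(1)] by fastforce
    then show False using v s prime_mult[OF pp] by (auto simp: L_def)
  qed
  have "g \<in> P" if g: "g \<in> P'" for g
  proof -
    obtain k q where "smult (s ^ k) g - q * h \<in> ext p" using div[OF g] by blast
    then have "smult (s ^ k) g - q * h + q * h \<in> P"
      using ext \<open>h \<in> P\<close> by (intro ideal_add[OF pI(2)] ideal_mult[OF pI(2)]) auto
    then show ?thesis using canc by simp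
  qed
  then show ?thesis using P(3) by blast
qed

text \<open>
  A chain over \<open>W\<close> contracts to a strict chain when no prime over \<open>W\<close> is extended from \<open>R\<close>.
\<close>
lemma ht_contr:
  fixes W :: "'a::comm_ring_1 poly set"
  assumes "is_ideal I" "ext I \<subseteq> W" "ht_ge W k P"
    and W: "\<And>Q. is_prime Q \<Longrightarrow> W \<subseteq> Q \<Longrightarrow> \<exists>f\<in>Q. f \<notin> ext (contr Q)"
  shows "ht_ge I k (contr P)"
  using assms(3)
proof (induction k arbitrary: P)
  case 0
  then show ?case using assms(1,2) contr_prime ext_subset_iff[of P I] prime_ideal[of P] by auto
next
  case (Suc k)
  then obtain Q where Q: "ht_ge W k Q" "Q \<subset> P" by (simp only: ht_ge.simps) blast
  have pr: "is_prime Q" "W \<subseteq> Q" "is_prime P" using ht_ge_prime[OF Q(1)] Suc.prems ht_ge_prime by auto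
  obtain f where f: "f \<in> Q" "f \<notin> ext (contr Q)" using W[OF pr(1,2)] by blast
  have "contr Q \<noteq> contr P"
    using fibre_unique[OF pr(1,3) _ refl _ f] Q(2) by blast
  moreover have "contr Q \<subseteq> contr P" using Q(2) by (auto simp: contr_def)
  ultimately have "contr Q \<subset> contr P" by blast
  then show ?case using ht_ge_Suc[OF Suc.IH[OF Q(1)] contr_prime[OF pr(3)]] by blast
qed

lemma ht_ge_anti: "ht_ge W' k P \<Longrightarrow> W \<subseteq> W' \<Longrightarrow> ht_ge W k P"
  using ht_ge_base[of W' k P W 0] by auto

lemma dim_le_anti: "dim_le W d \<Longrightarrow> W \<subseteq> W' \<Longrightarrow> dim_le W' d"
  unfolding dim_le_def using ht_ge_anti by blast

lemma principal_ideal: "x \<in> ideal_of {a} \<Longrightarrow> \<exists>c. x = c * a"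
  using ideal_of_insert[of "{0}" x a] ideal_of_mono[of "{a}" "{a, 0}"]
  by (auto simp: is_ideal_def)

lemma one_in_idealI:
  fixes J :: "'a::comm_ring_1 set"
  assumes "noeth TYPE('a)" "is_ideal J" "\<And>P. is_prime P \<Longrightarrow> \<not> J \<subseteq> P"
  shows "1 \<in> J"
  using prime_over[OF assms(1,2), of 1] assms(3) by fastforce

section \<open>Unimodular rows over a polynomial ring over a local ring\<close>

locale local_noeth =
  fixes m :: "'a::comm_ring_1 set"
  assumes noeth: "noeth TYPE('a)" and m_prime: "is_prime m"
    and unit: "\<And>x. x \<notin> m \<Longrightarrow> x dvd 1"
begin

lemma noeth_poly: "noeth TYPE('a poly)" by (rule hilbert_basis[OF noeth])

lemma m_ideal: "is_ideal m" by (rule prime_ideal[OF m_prime])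

lemma proper_ideal: "is_ideal I \<Longrightarrow> 1 \<notin> I \<Longrightarrow> I \<subseteq> m"
proof
  fix x assume I: "is_ideal I" "1 \<notin> I" "x \<in> I"
  show "x \<in> m"
  proof (rule ccontr)
    assume "x \<notin> m"
    then obtain y where "1 = x * y" using unit by (auto simp: dvd_def)
    then show False using I ideal_mult2[of I x y] by metis
  qed
qed

lemma prime_sub_m: "is_prime P \<Longrightarrow> P \<subseteq> m"
  using proper_ideal prime_ideal prime_one by blast

lemma ht_m: "ht_ge I k P \<Longrightarrow> l \<in> m \<Longrightarrow> l \<notin> P \<Longrightarrow> ht_ge I (Suc k) m"
  using ht_ge_Suc[of I k P m] m_prime prime_sub_m ht_ge_prime by blast

lemma one_plus_unit: "is_prime P \<Longrightarrow> x - 1 \<in> m \<Longrightarrow> x \<notin> P"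
proof
  assume "is_prime P" "x - 1 \<in> m" "x \<in> P"
  then have "x - (x - 1) \<in> m" using prime_sub_m ideal_diff[OF m_ideal] by blast
  then show False using prime_one[OF m_prime] by simp
qed

text \<open>
  The reason for normalising an entry to \<open>1\<close> modulo \<open>l\<close>: the constant coefficient of \<open>w\<close> is then a
  unit, so a prime through \<open>w\<close> is never extended from \<open>R\<close>, and it cannot contain \<open>l\<close>.  A chain
  through \<open>w\<close> thus contracts to one that becomes longer by appending the maximal ideal.
\<close>
lemma anchor_ht:
  assumes I: "is_ideal I" "1 \<notin> I" and l: "l \<in> m" and w: "w - 1 \<in> ext (ideal_of (insert l I))"
    and W: "is_ideal W" "w \<in> W" "ext I \<subseteq> W" and h: "ht_ge W k P"
  shows "ht_ge I k (contr P)" "l \<notin> contr P" "ht_ge I (Suc k) m"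
proof -
  have Im: "ideal_of (insert l I) \<subseteq> m"
    using proper_ideal[OF I] l by (simp add: ideal_of_subset_iff m_ideal)
  have w0: "coeff w 0 - 1 \<in> m" using w Im by (auto simp: ext_def dest!: spec[of _ 0])
  show 1: "ht_ge I k (contr P)"
  proof (rule ht_contr[OF I(1) W(3) h])
    fix Q assume Q: "is_prime Q" "W \<subseteq> Q"
    have "coeff w 0 \<notin> contr Q" using one_plus_unit[OF contr_prime[OF Q(1)] w0] .
    then show "\<exists>f\<in>Q. f \<notin> ext (contr Q)" using W Q by (intro bexI[of _ w]) (auto simp: ext_def)
  qed
  have P: "is_prime P" "W \<subseteq> P" using ht_ge_prime[OF h] by auto
  have Pi: "is_ideal P" using P prime_ideal by auto
  show 2: "l \<notin> contr P"
  proof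
    assume lP: "l \<in> contr P"
    have "I \<subseteq> contr P" using W(3) P ext_subset_iff[OF Pi I(1)] by auto
    then have "ideal_of (insert l I) \<subseteq> contr P"
      using lP by (simp add: ideal_of_subset_iff contr_ideal[OF Pi])
    then have "ext (ideal_of (insert l I)) \<subseteq> P" using ext_subset_iff[OF Pi ideal_of_ideal] by blast
    then have "w - 1 \<in> P" "w \<in> P" using w W P by auto
    then show False using prime_one[OF P(1)] ideal_diff[OF Pi, of w "w - 1"] by simp
  qed
  show "ht_ge I (Suc k) m" using ht_m[OF 1 l 2] .
qed

text \<open>
  Transitivity on unimodular vectors of length \<open>n \<ge> dim + 2\<close>, for every equivalence \<open>sim\<close> that
  contains enough operations; it is used for elementary and for symplectic operations.  By \<open>H1\<close> multiples of
  the entry \<open>1\<close> may be added to the others, and by \<open>H2\<close> it suffices to make the remaining entries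
  unimodular.  Noetherian induction on \<open>I\<close> produces an entry that is \<open>1\<close> modulo an element \<open>l\<close> outside \<open>I\<close>; modulo
  this entry the dimension drops by \<open>anchor_ht\<close>, so general position applies to the other entries.  The
  induction ends with \<open>I\<close> maximal, where \<open>(R/I)[X]\<close> has dimension one.
\<close>
lemma reduce_to_e0:
  fixes sim :: "(nat \<Rightarrow> 'a poly) \<Rightarrow> (nat \<Rightarrow> 'a poly) \<Rightarrow> bool" and n :: nat
  assumes n: "3 \<le> n"
    and trans: "\<And>a b c. sim a b \<Longrightarrow> sim b c \<Longrightarrow> sim a c"
    and gen: "\<And>a b. sim a b \<Longrightarrow> a ` {..<n} \<subseteq> ideal_of (b ` {..<n})"
    and H1: "\<And>a t. \<exists>b. sim a b \<and> (\<forall>k. 2 \<le> k \<longrightarrow> k < n \<longrightarrow> b k = a k + t k * a 1)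
              \<and> b 0 - (a 0 + t 0 * a 1) \<in> ideal_of (b ` {2..<n})"
    and H2: "\<And>a A c. is_ideal A \<Longrightarrow> (\<Sum>i\<in>{..<n} - {1}. c i * a i) - 1 \<in> A \<Longrightarrow>
              \<exists>b. sim a b \<and> b 0 - 1 \<in> A \<and> (\<forall>k. 0 < k \<longrightarrow> k < n \<longrightarrow> b k \<in> A)"
    and I: "is_ideal I" and dim: "dim_le I (n - 2)" and uni: "1 \<in> ideal_of (a ` {..<n} \<union> ext I)"
  shows "\<exists>b. sim a b \<and> b 0 - 1 \<in> ext I \<and> (\<forall>k. 0 < k \<longrightarrow> k < n \<longrightarrow> b k \<in> ext I)"
  using noeth I dim uni
proof (induction I arbitrary: a rule: noeth_induct)
  case (1 I)
  note I = 1(1)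
  have eI: "is_ideal (ext I)" by (rule ext_ideal[OF I])
  have key: "\<exists>b. sim a b \<and> b 0 - 1 \<in> ext I \<and> (\<forall>k. 0 < k \<longrightarrow> k < n \<longrightarrow> b k \<in> ext I)"
    if u: "1 \<in> ideal_of ((\<lambda>k. a k + t k * a 1) ` ({..<n} - {1}) \<union> ext I)" for a t
  proof -
    obtain b where b: "sim a b" "\<forall>k. 2 \<le> k \<longrightarrow> k < n \<longrightarrow> b k = a k + t k * a 1"
      "b 0 - (a 0 + t 0 * a 1) \<in> ideal_of (b ` {2..<n})" using H1[of a t] by blast
    define B where "B = ideal_of (b ` ({..<n} - {1}) \<union> ext I)"
    have B: "is_ideal B" by (simp add: B_def ideal_of_ideal)
    have bB: "b k \<in> B" if "k < n" "k \<noteq> 1" for k using that by (auto simp: B_def intro!: ideal_of_base)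
    have "b ` {2..<n} \<subseteq> B" using bB by auto
    then have "b 0 - (a 0 + t 0 * a 1) \<in> B" using b(3) ideal_of_least[OF B] by blast
    moreover have "b 0 \<in> B" using bB[of 0] n by auto
    ultimately have "b 0 - (b 0 - (a 0 + t 0 * a 1)) \<in> B" using ideal_diff[OF B] by blast
    then have "a 0 + t 0 * a 1 \<in> B" by simp
    moreover have "a k + t k * a 1 \<in> B" if "k < n" "k \<ge> 2" for k using b(2) bB[of k] that by auto
    ultimately have "a k + t k * a 1 \<in> B" if "k < n" "k \<noteq> 1" for k
      using that by (cases "k = 0") auto
    moreover have "ext I \<subseteq> B" by (auto simp: B_def intro: ideal_of_base)
    ultimately have "1 \<in> B" using u ideal_of_least[OF B, of "(\<lambda>k. a k + t k * a 1) ` ({..<n} - {1}) \<union> ext I"] by blast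
    then obtain c where "1 - (\<Sum>i\<in>{..<n} - {1}. c i * b i) \<in> ext I"
      using ideal_of_image[OF eI, of "{..<n} - {1}" 1 b] by (auto simp: B_def)
    then have "(\<Sum>i\<in>{..<n} - {1}. c i * b i) - 1 \<in> ext I" using ideal_uminus[OF eI] by fastforce
    from H2[OF eI this] obtain b' where "sim b b'" "b' 0 - 1 \<in> ext I" "\<forall>k. 0 < k \<longrightarrow> k < n \<longrightarrow> b' k \<in> ext I"
      by blast
    then show ?thesis using trans[OF b(1)] by blast
  qed
  have allP: "\<exists>k<n. a k \<notin> P" if "is_prime P" "ext I \<subseteq> P" "1 \<in> ideal_of (a ` {..<n} \<union> ext I)" for P a
  proof (rule ccontr)
    assume "\<not> ?thesis"
    then have "a ` {..<n} \<union> ext I \<subseteq> P" using that by auto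
    then show False using that ideal_of_least[OF prime_ideal[OF that(1)]] prime_one[OF that(1)] by blast
  qed
  consider "1 \<in> I" | "I = m" | "1 \<notin> I" "I \<noteq> m" by blast
  then show ?case
  proof cases
    case 1
    then have "ext I = UNIV" using ext_UNIV I by blast
    then show ?thesis using key[of a "\<lambda>_. 0"] by (simp add: ideal_of_base)
  next
    case 2
    \<comment> \<open>An enumeration of the indices other than \<open>1\<close>.\<close>
    define s where "s k = (if k = 0 then 0 else Suc k)" for k :: nat
    define J where "J = ideal_of {a 1}"
    have J: "is_ideal J" by (simp add: J_def ideal_of_ideal)
    obtain t where t: "\<forall>k<n-1. t k \<in> J" and tP: "\<And>P. is_prime P \<Longrightarrow> ext I \<subseteq> P \<Longrightarrow> (\<forall>k<n-1. a (s k) + t k \<in> P) \<Longrightarrow>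
        \<not> J \<subseteq> P \<Longrightarrow> ht_ge (ext I) (n - 1) P"
      using stable_range[OF noeth_poly eI J, of "n - 1" "\<lambda>k. a (s k)"] by blast
    have "\<forall>k. \<exists>c. k < n - 1 \<longrightarrow> t k = c * a 1"
      using t principal_ideal[of _ "a 1"] unfolding J_def by blast
    then obtain c where c: "\<And>k. k < n - 1 \<Longrightarrow> t k = c k * a 1" by (elim choice[THEN exE]) blast
    define t' where "t' k = c (if k = 0 then 0 else k - 1)" for k
    have idx: "\<exists>k'<n-1. k = s k' \<and> t k' = t' k * a 1" if "k < n" "k \<noteq> 1" for k
      using that n c[of 0] c[of "k - 1"]
      by (intro exI[of _ "if k = 0 then 0 else k - 1"]) (auto simp: s_def t'_def)
    have idx2: "s k < n \<and> s k \<noteq> 1 \<and> t k = t' (s k) * a 1" if "k < n - 1" for k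
      using that c[OF that] n by (auto simp: s_def t'_def)
    define V where "V = ideal_of ((\<lambda>k. a k + t' k * a 1) ` ({..<n} - {1}) \<union> ext I)"
    have "1 \<in> V"
    proof (rule one_in_idealI[OF noeth_poly])
      show "is_ideal V" by (simp add: V_def ideal_of_ideal)
      fix P :: "'a poly set" assume P: "is_prime P"
      show "\<not> V \<subseteq> P"
      proof
        assume "V \<subseteq> P"
        then have sub: "(\<lambda>k. a k + t' k * a 1) ` ({..<n} - {1}) \<union> ext I \<subseteq> P"
          by (simp add: V_def ideal_of_subset_iff prime_ideal[OF P])
        have Pi: "is_ideal P" using P prime_ideal by auto
        have "\<not> J \<subseteq> P"
        proof
          assume "J \<subseteq> P"
          then have a1: "a 1 \<in> P" by (auto simp: J_def intro: ideal_of_base)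
          have "a k \<in> P" if "k < n" for k
          proof (cases "k = 1")
            case False
            then have "a k + t' k * a 1 \<in> P" using sub that by auto
            then show ?thesis using ideal_diff[OF Pi _ ideal_mult[OF Pi a1, of "t' k"]] by fastforce
          qed (use a1 in auto)
          then show False using allP[OF P _ "1.prems"(2)] sub by auto
        qed
        moreover have "\<forall>k<n-1. a (s k) + t k \<in> P" using idx2 sub by auto
        ultimately have "ht_ge (ext I) (n - 1) P" using tP[OF P] sub by auto
        then have "ht_ge (ext I) (Suc (Suc 0)) P" by (rule ht_ge_less) (use n in simp)
        then obtain Q0 Q1 where Q: "Q0 \<subset> Q1" "Q1 \<subset> P" "ext I \<subseteq> Q0" "is_prime Q0" "is_prime Q1"
          unfolding ht_ge.simps by blast
        have cm: "contr Q = m" if "is_prime Q" "ext I \<subseteq> Q" for Q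
          using ext_subset_iff[OF prime_ideal[OF that(1)] I] that prime_sub_m[OF contr_prime[OF that(1)]] 2 by auto
        have cc: "contr Q1 = m" "contr P = m" using cm[of Q1] cm[of P] Q P sub by auto
        obtain f where "f \<in> Q1" "f \<notin> ext m" using Q 2 by blast
        then have "Q1 = P" using fibre_unique[OF Q(5) P _ cc] Q by blast
        then show False using Q by blast
      qed
    qed
    then show ?thesis using key unfolding V_def by blast
  next
    case 3
    obtain l where l: "l \<in> m" "l \<notin> I" using proper_ideal[OF I 3(1)] 3(2) by blast
    define I' where "I' = ideal_of (insert l I)"
    have I': "is_ideal I'" "I \<subset> I'" using l ideal_of_base[of _ "insert l I"] by (auto simp: I'_def ideal_of_ideal)
    have eII: "ext I \<subseteq> ext I'" using I' ext_mono by blast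
    have "1 \<in> ideal_of (a ` {..<n} \<union> ext I')"
      using "1.prems"(2) ideal_of_mono[of "a ` {..<n} \<union> ext I" "a ` {..<n} \<union> ext I'"] eII by blast
    moreover have "dim_le I' (n - 2)" using "1.prems"(1) I' dim_le_anti by blast
    ultimately obtain b where b: "sim a b" "b 0 - 1 \<in> ext I'" using "1.IH"[OF I'] by blast
    have ub: "1 \<in> ideal_of (b ` {..<n} \<union> ext I)"
    proof -
      have "a ` {..<n} \<subseteq> ideal_of (b ` {..<n} \<union> ext I)"
        using gen[OF b(1)] ideal_of_mono[of "b ` {..<n}" "b ` {..<n} \<union> ext I"] by blast
      moreover have "ext I \<subseteq> ideal_of (b ` {..<n} \<union> ext I)" by (auto intro: ideal_of_base)
      ultimately show ?thesis
        using "1.prems"(2) ideal_of_least[OF ideal_of_ideal, of "a ` {..<n} \<union> ext I" "b ` {..<n} \<union> ext I"] by blast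
    qed
    define W where "W = ideal_of (insert (b 0) (ext I))"
    have W: "is_ideal W" "b 0 \<in> W" "ext I \<subseteq> W" by (auto simp: W_def ideal_of_ideal intro: ideal_of_base)
    define J where "J = ideal_of {b 1}"
    have J: "is_ideal J" by (simp add: J_def ideal_of_ideal)
    obtain t where t: "\<forall>k<n-2. t k \<in> J" and tP: "\<And>P. is_prime P \<Longrightarrow> W \<subseteq> P \<Longrightarrow> (\<forall>k<n-2. b (k+2) + t k \<in> P) \<Longrightarrow>
        \<not> J \<subseteq> P \<Longrightarrow> ht_ge W (n - 2) P"
      using stable_range[OF noeth_poly W(1) J, of "n - 2" "\<lambda>k. b (k+2)"] by blast
    have "\<forall>k. \<exists>c. k < n - 2 \<longrightarrow> t k = c * b 1"
      using t principal_ideal[of _ "b 1"] unfolding J_def by blast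
    then obtain c where c: "\<And>k. k < n - 2 \<Longrightarrow> t k = c k * b 1" by (elim choice[THEN exE]) blast
    define t' where "t' k = (if k = 0 then 0 else c (k - 2))" for k
    define V where "V = ideal_of ((\<lambda>k. b k + t' k * b 1) ` ({..<n} - {1}) \<union> ext I)"
    have "1 \<in> V"
    proof (rule one_in_idealI[OF noeth_poly])
      show "is_ideal V" by (simp add: V_def ideal_of_ideal)
      fix P :: "'a poly set" assume P: "is_prime P"
      show "\<not> V \<subseteq> P"
      proof
        assume "V \<subseteq> P"
        then have sub: "(\<lambda>k. b k + t' k * b 1) ` ({..<n} - {1}) \<union> ext I \<subseteq> P"
          by (simp add: V_def ideal_of_subset_iff prime_ideal[OF P])
        have Pi: "is_ideal P" using P prime_ideal by auto
        have mem: "b k + t' k * b 1 \<in> P" if "k < n" "k \<noteq> 1" for k using sub that by auto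
        have "b 0 \<in> P" using mem[of 0] n by (simp add: t'_def)
        then have WP: "W \<subseteq> P" using sub by (simp add: W_def ideal_of_subset_iff Pi)
        have "\<not> J \<subseteq> P"
        proof
          assume "J \<subseteq> P"
          then have a1: "b 1 \<in> P" by (auto simp: J_def intro: ideal_of_base)
          have "b k \<in> P" if "k < n" for k
          proof (cases "k = 1")
            case False
            then have "b k + t' k * b 1 \<in> P" using mem that by auto
            then show ?thesis using ideal_diff[OF Pi _ ideal_mult[OF Pi a1, of "t' k"]] by fastforce
          qed (use a1 in auto)
          then show False using allP[OF P _ ub] sub by auto
        qed
        moreover have "\<forall>k<n-2. b (k+2) + t k \<in> P"
        proof (intro allI impI)
          fix k assume "k < n - 2"
          then show "b (k+2) + t k \<in> P" using mem[of "k+2"] c[of k] by (simp add: t'_def)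
        qed
        ultimately have "ht_ge W (n - 2) P" using tP[OF P WP] by auto
        from anchor_ht(3)[OF I 3(1) l(1) b(2)[unfolded I'_def] W this]
        show False using "1.prems"(1) by (auto simp: dim_le_def)
      qed
    qed
    then obtain b' where "sim b b'" "b' 0 - 1 \<in> ext I" "\<forall>k. 0 < k \<longrightarrow> k < n \<longrightarrow> b' k \<in> ext I"
      using key unfolding V_def by blast
    then show ?thesis using trans[OF b(1)] by blast
  qed
qed

end

section \<open>Symplectic transvections\<close>

text \<open>
  The standard symplectic form on vectors of length \<open>2 r\<close>, whose hyperbolic planes are
  spanned by the basis vectors \<open>2 k\<close> and \<open>2 k + 1\<close>.
\<close>
definition sp :: "nat \<Rightarrow> (nat \<Rightarrow> 'r::comm_ring_1) \<Rightarrow> (nat \<Rightarrow> 'r) \<Rightarrow> 'r" where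
  "sp r u v = (\<Sum>k<r. u (2*k) * v (2*k+1) - u (2*k+1) * v (2*k))"

text \<open>
  The form without its first plane.
\<close>
definition sp1 :: "nat \<Rightarrow> (nat \<Rightarrow> 'r::comm_ring_1) \<Rightarrow> (nat \<Rightarrow> 'r) \<Rightarrow> 'r" where
  "sp1 r u v = (\<Sum>k\<in>{1..<r}. u (2*k) * v (2*k+1) - u (2*k+1) * v (2*k))"

lemma sp_split: "0 < r \<Longrightarrow> sp r u v = u 0 * v 1 - u 1 * v 0 + sp1 r u v"
proof -
  assume "0 < r"
  then have "{..<r} = insert 0 {1..<r}" by auto
  then show ?thesis by (simp add: sp_def sp1_def)
qed

lemma sp1_shift: "sp1 (Suc r) u v = sp r (\<lambda>i. u (i+2)) (\<lambda>i. v (i+2))"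
proof -
  have "{1..<Suc r} = Suc ` {..<r}" by (simp add: lessThan_atLeast0)
  then show ?thesis by (simp add: sp1_def sp_def sum.reindex)
qed

lemma sum_pairs: "(\<Sum>i<2*r. f i) = (\<Sum>k<r. f (2*k) + f (2*k+1))" for f :: "nat \<Rightarrow> 'r::comm_ring_1"
  by (induction r) (simp_all add: add.assoc)

lemma sp_anti: "sp r v u = - sp r u v"
  by (simp add: sp_def sum_negf[symmetric] algebra_simps)

lemma sp_add: "sp r (\<lambda>i. u i + u' i) v = sp r u v + sp r u' v"
  by (simp add: sp_def sum.distrib[symmetric] algebra_simps)

lemma sp_scale: "sp r (\<lambda>i. c * u i) v = c * sp r u v"
  by (simp add: sp_def sum_distrib_left algebra_simps)

lemma sp_diff: "sp r (\<lambda>i. u i - u' i) v = sp r u v - sp r u' v"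
  by (simp add: sp_def sum_subtractf[symmetric] algebra_simps)

lemma sp_add2: "sp r v (\<lambda>i. u i + u' i) = sp r v u + sp r v u'"
  by (simp add: sp_def sum.distrib[symmetric] algebra_simps)

lemma sp_scale2: "sp r v (\<lambda>i. c * u i) = c * sp r v u"
  by (simp add: sp_def sum_distrib_left algebra_simps)

lemma sp_diff2: "sp r v (\<lambda>i. u i - u' i) = sp r v u - sp r v u'"
  by (simp add: sp_def sum_subtractf[symmetric] algebra_simps)

lemma sp_in_ideal: "is_ideal A \<Longrightarrow> (\<And>i. i < 2*r \<Longrightarrow> v i \<in> A) \<Longrightarrow> sp r u v \<in> A"
  unfolding sp_def by (intro ideal_sum ideal_diff ideal_mult) auto

lemma sp1_in_ideal: "is_ideal A \<Longrightarrow> (\<And>i. 2 \<le> i \<Longrightarrow> i < 2*r \<Longrightarrow> v i \<in> A) \<Longrightarrow> sp1 r u v \<in> A"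
  unfolding sp1_def by (intro ideal_sum ideal_diff ideal_mult) auto

text \<open>
  The isometry fixing the basis vector \<open>0\<close> and moving the basis vector \<open>1\<close> by \<open>t\<close>.
\<close>
definition tv0 :: "nat \<Rightarrow> (nat \<Rightarrow> 'r::comm_ring_1) \<Rightarrow> (nat \<Rightarrow> 'r) \<Rightarrow> nat \<Rightarrow> 'r" where
  "tv0 r t z = (\<lambda>i. if i = 0 then z 0 + t 0 * z 1 + sp1 r t z else if i = 1 then z 1 else z i + t i * z 1)"

text \<open>
  The same with the two vectors of the first plane interchanged.
\<close>
definition tv1 :: "nat \<Rightarrow> (nat \<Rightarrow> 'r::comm_ring_1) \<Rightarrow> (nat \<Rightarrow> 'r) \<Rightarrow> nat \<Rightarrow> 'r" where
  "tv1 r t z = (\<lambda>i. if i = 0 then z 0 else if i = 1 then z 1 - t 1 * z 0 + sp1 r t z else z i - t i * z 0)"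

lemma sp1_tv:
  "sp1 r (\<lambda>i. if i = 0 then x else if i = 1 then y else u i + t i * c) (\<lambda>i. if i = 0 then x' else if i = 1 then y' else v i + t i * d)
    = sp1 r u v + c * sp1 r t v - d * sp1 r t u"
  unfolding sp1_def sum_distrib_left sum.distrib[symmetric] sum_subtractf[symmetric]
  by (rule sum.cong) (auto simp: algebra_simps)

lemma sp1_tv': "sp1 r t (\<lambda>i. if i = 0 then x' else if i = 1 then y' else v i + t i * d) = sp1 r t v"
  unfolding sp1_def by (rule sum.cong) (auto simp: algebra_simps)

lemma sp_tv0: "0 < r \<Longrightarrow> sp r (tv0 r t u) (tv0 r t v) = sp r u v"
  unfolding sp_split[of r] unfolding tv0_def sp1_tv by (simp add: algebra_simps)

lemma sp_tv1: "0 < r \<Longrightarrow> sp r (tv1 r t u) (tv1 r t v) = sp r u v"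
proof -
  assume r: "0 < r"
  have eq: "tv1 r t z = (\<lambda>i. if i = 0 then z 0 else if i = 1 then z 1 - t 1 * z 0 + sp1 r t z
      else z i + t i * (- z 0))" for z by (auto simp: tv1_def)
  show ?thesis unfolding sp_split[OF r] unfolding eq sp1_tv by (simp add: algebra_simps)
qed

text \<open>
  Equivalence under isometries, with the inclusion of ideals that the reduction
  argument requires of its operations.
\<close>
definition sim_sp :: "nat \<Rightarrow> (nat \<Rightarrow> 'r::comm_ring_1) \<Rightarrow> (nat \<Rightarrow> 'r) \<Rightarrow> bool" where
  "sim_sp r a b \<longleftrightarrow> a ` {..<2*r} \<subseteq> ideal_of (b ` {..<2*r}) \<and>
     (\<exists>g. b = g a \<and> (\<forall>u v. sp r (g u) (g v) = sp r u v))"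

lemma sim_sp_trans: "sim_sp r a b \<Longrightarrow> sim_sp r b c \<Longrightarrow> sim_sp r a c"
proof -
  assume ab: "sim_sp r a b" and bc: "sim_sp r b c"
  have "ideal_of (b ` {..<2*r}) \<subseteq> ideal_of (c ` {..<2*r})"
    using bc by (intro ideal_of_least ideal_of_ideal) (simp add: sim_sp_def)
  then have "a ` {..<2*r} \<subseteq> ideal_of (c ` {..<2*r})" using ab by (auto simp: sim_sp_def)
  moreover obtain g g' where "b = g a" "\<forall>u v. sp r (g u) (g v) = sp r u v"
      "c = g' b" "\<forall>u v. sp r (g' u) (g' v) = sp r u v"
    using ab bc unfolding sim_sp_def by blast
  ultimately show ?thesis unfolding sim_sp_def by (intro conjI exI[of _ "g' \<circ> g"]) auto
qed

lemma sim_tv0: "0 < r \<Longrightarrow> sim_sp r a (tv0 r t a)"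
proof -
  assume r: "0 < r"
  define b where "b = tv0 r t a"
  let ?B = "ideal_of (b ` {..<2*r})"
  have B: "is_ideal ?B" by (rule ideal_of_ideal)
  have b: "b i \<in> ?B" if "i < 2*r" for i using that by (intro ideal_of_base) auto
  have 1: "a 1 \<in> ?B" using b[of 1] r by (auto simp: b_def tv0_def)
  have k: "a i \<in> ?B" if "i < 2*r" "i \<ge> 2" for i
    using ideal_diff[OF B b[OF that(1)] ideal_mult[OF B 1, of "t i"]] that by (simp add: b_def tv0_def)
  have s: "sp1 r t a \<in> ?B" using k by (intro sp1_in_ideal[OF B])
  have "b 0 - t 0 * a 1 - sp1 r t a \<in> ?B"
    by (rule ideal_diff[OF B ideal_diff[OF B b ideal_mult[OF B 1]] s]) (use r in simp)
  then have "a 0 \<in> ?B" by (simp add: b_def tv0_def)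
  then have "a i \<in> ?B" if "i < 2*r" for i
    using that 1 k[of i] by (cases "i = 0"; cases "i = 1") auto
  then show ?thesis using sp_tv0[OF r, of t] unfolding sim_sp_def b_def[symmetric]
    by (intro conjI exI[of _ "tv0 r t"]) (auto simp: b_def)
qed

lemma sim_tv1: "0 < r \<Longrightarrow> sim_sp r a (tv1 r t a)"
proof -
  assume r: "0 < r"
  define b where "b = tv1 r t a"
  let ?B = "ideal_of (b ` {..<2*r})"
  have B: "is_ideal ?B" by (rule ideal_of_ideal)
  have b: "b i \<in> ?B" if "i < 2*r" for i using that by (intro ideal_of_base) auto
  have 0: "a 0 \<in> ?B" using b[of 0] r by (auto simp: b_def tv1_def)
  have k: "a i \<in> ?B" if "i < 2*r" "i \<ge> 2" for i
    using ideal_add[OF B b[OF that(1)] ideal_mult[OF B 0, of "t i"]] that by (simp add: b_def tv1_def)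
  have s: "sp1 r t a \<in> ?B" using k by (intro sp1_in_ideal[OF B])
  have "b 1 + t 1 * a 0 - sp1 r t a \<in> ?B"
    by (rule ideal_diff[OF B ideal_add[OF B b ideal_mult[OF B 0]] s]) (use r in simp)
  then have "a 1 \<in> ?B" by (simp add: b_def tv1_def)
  then have "a i \<in> ?B" if "i < 2*r" for i
    using that 0 k[of i] by (cases "i = 0"; cases "i = 1") auto
  then show ?thesis using sp_tv1[OF r, of t] unfolding sim_sp_def b_def[symmetric]
    by (intro conjI exI[of _ "tv1 r t"]) (auto simp: b_def)
qed

text \<open>
  One transvection makes the entry \<open>1\<close> congruent to \<open>1\<close>; a second one clears the other entries with it.
\<close>
lemma sp_to_e0:
  assumes r: "0 < r" and A: "is_ideal A" and c: "(\<Sum>i\<in>{..<2*r} - {1}. c i * a i) - 1 \<in> A"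
  shows "\<exists>b. sim_sp r a b \<and> b 0 - 1 \<in> A \<and> (\<forall>k. 0 < k \<longrightarrow> k < 2*r \<longrightarrow> b k \<in> A)"
proof -
  define K where "K = {..<2*r} - {0,1::nat}"
  have K: "finite K" "0 \<notin> K" "1 \<notin> K" by (auto simp: K_def)
  have K1: "{..<2*r} - {1} = insert 0 K" unfolding K_def using r by (intro Set.set_eqI) (simp, linarith)
  have K2: "{..<2*r} = insert 0 (insert 1 K)"
  proof (rule Set.set_eqI)
    fix i show "i \<in> {..<2*r} \<longleftrightarrow> i \<in> insert 0 (insert 1 K)" unfolding K_def using r by (simp, linarith)
  qed
  have s0: "(\<Sum>i\<in>{..<2*r} - {1}. c i * a i) = c 0 * a 0 + (\<Sum>i\<in>K. c i * a i)"
    unfolding K1 by (rule sum.insert[OF K(1,2)])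
  have eq: "(\<Sum>i<2*r. f i) = f 0 + (f 1 + (\<Sum>i\<in>K. f i))" for f :: "nat \<Rightarrow> 'a"
    unfolding K2 using K by simp
  have eq2: "(\<Sum>k<r. g k) = g 0 + (\<Sum>k\<in>{1..<r}. g k)" for g :: "nat \<Rightarrow> 'a"
  proof -
    have "{..<r} = insert 0 {1..<r}" using r by auto
    then have "(\<Sum>k<r. g k) = sum g (insert 0 {1..<r})" by (rule arg_cong)
    also have "\<dots> = g 0 + (\<Sum>k\<in>{1..<r}. g k)" by (rule sum.insert) auto
    finally show ?thesis .
  qed
  have sum2: "(\<Sum>i\<in>K. f i) = (\<Sum>k\<in>{1..<r}. f (2*k) + f (2*k+1))" for f :: "nat \<Rightarrow> 'a"
  proof -
    have "f 0 + (f 1 + (\<Sum>i\<in>K. f i)) = f 0 + (f 1 + (\<Sum>k\<in>{1..<r}. f (2*k) + f (2*k+1)))"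
      unfolding eq[symmetric] sum_pairs eq2 by simp
    then show ?thesis by simp
  qed
  \<comment> \<open>The transvection adds \<open>q\<close> times the given combination, so the entry \<open>1\<close> becomes congruent to \<open>a 1 + q = 1\<close>.\<close>
  define q where "q = 1 - a 1"
  define t where "t i = (if i = 1 then - q * c 0 else if even i then q * c (i + 1) else - q * c (i - 1))" for i
  define b where "b = tv1 r t a"
  have "sp1 r t a = q * (\<Sum>k\<in>{1..<r}. c (2*k) * a (2*k) + c (2*k+1) * a (2*k+1))"
    unfolding sp1_def sum_distrib_left by (rule sum.cong) (auto simp: t_def algebra_simps)
  then have "b 1 = a 1 + q * (\<Sum>i\<in>{..<2*r} - {1}. c i * a i)"
    unfolding s0 sum2[of "\<lambda>i. c i * a i"] by (simp add: b_def tv1_def t_def algebra_simps)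
  then have "b 1 - 1 = q * ((\<Sum>i\<in>{..<2*r} - {1}. c i * a i) - 1)" by (simp add: q_def algebra_simps)
  then have b1: "b 1 - 1 \<in> A" using ideal_mult[OF A c] by simp
  define t' where "t' i = (if i = 0 then 1 - b 0 - sp1 r (\<lambda>i. - b i) b else - b i)" for i
  define d where "d = tv0 r t' b"
  have "sp1 r t' b = sp1 r (\<lambda>i. - b i) b" unfolding sp1_def by (rule sum.cong) (auto simp: t'_def)
  then have "d 0 - 1 = (1 - b 0 - sp1 r (\<lambda>i. - b i) b) * (b 1 - 1)"
    by (simp add: d_def tv0_def t'_def algebra_simps)
  then have d0: "d 0 - 1 \<in> A" using ideal_mult[OF A b1] by metis
  have d1: "d 1 = b 1" by (simp add: d_def tv0_def)
  have dk: "d k \<in> A" if "k \<ge> 2" for k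
  proof -
    have "d k = - b k * (b 1 - 1)" using that by (simp add: d_def tv0_def t'_def algebra_simps)
    then show ?thesis using ideal_mult[OF A b1] by metis
  qed
  define t2 where "t2 i = (if i = 1 then 1 else 0 :: 'a)" for i :: nat
  define e where "e = tv1 r t2 d"
  have "sp1 r t2 d = 0" unfolding sp1_def by (rule sum.neutral) (auto simp: t2_def)
  then have e: "e 0 = d 0" "e 1 = d 1 - d 0" "\<And>k. k \<ge> 2 \<Longrightarrow> e k = d k" by (auto simp: e_def tv1_def t2_def)
  have "e 1 \<in> A" using ideal_diff[OF A b1 d0] unfolding e(2) d1 by simp
  then have "e k \<in> A" if "0 < k" "k < 2*r" for k
    using that e dk by (cases "k = 1") auto
  moreover have "sim_sp r a e"
    using sim_tv1[OF r, of a t] sim_tv0[OF r, of b t'] sim_tv1[OF r, of d t2] sim_sp_trans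
    unfolding b_def[symmetric] d_def[symmetric] e_def[symmetric] by blast
  ultimately show ?thesis using d0 e by (intro exI[of _ e]) auto
qed

context local_noeth begin

text \<open>
  Symplectic transvections move every unimodular vector of length \<open>2 r \<ge> dim + 2\<close> to the first basis vector.
\<close>
lemma sp_transitive:
  fixes a :: "nat \<Rightarrow> 'a poly"
  assumes r: "2 \<le> r" and I: "is_ideal I" "dim_le I (2*r-2)" and u: "1 \<in> ideal_of (a ` {..<2*r} \<union> ext I)"
  shows "\<exists>g. (\<forall>u v. sp r (g u) (g v) = sp r u v) \<and> g a 0 - 1 \<in> ext I \<and> (\<forall>k. 0 < k \<longrightarrow> k < 2*r \<longrightarrow> g a k \<in> ext I)"
proof -
  have r0: "0 < r" using r by simp
  have H1: "\<exists>b. sim_sp r a b \<and> (\<forall>k. 2 \<le> k \<longrightarrow> k < 2*r \<longrightarrow> b k = a k + t k * a 1)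
              \<and> b 0 - (a 0 + t 0 * a 1) \<in> ideal_of (b ` {2..<2*r})" for a t :: "nat \<Rightarrow> 'a poly"
  proof (intro exI conjI)
    show "sim_sp r a (tv0 r t a)" by (rule sim_tv0[OF r0])
    show "\<forall>k. 2 \<le> k \<longrightarrow> k < 2*r \<longrightarrow> tv0 r t a k = a k + t k * a 1" by (auto simp: tv0_def)
    have "sp1 r t a = sp1 r t (tv0 r t a)" unfolding tv0_def sp1_tv' ..
    also have "\<dots> \<in> ideal_of (tv0 r t a ` {2..<2*r})"
      by (rule sp1_in_ideal[OF ideal_of_ideal]) (auto intro: ideal_of_base)
    finally show "tv0 r t a 0 - (a 0 + t 0 * a 1) \<in> ideal_of (tv0 r t a ` {2..<2*r})" by (simp add: tv0_def)
  qed
  have "\<exists>b. sim_sp r a b \<and> b 0 - 1 \<in> ext I \<and> (\<forall>k. 0 < k \<longrightarrow> k < 2*r \<longrightarrow> b k \<in> ext I)"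
  proof (rule reduce_to_e0[where n = "2*r" and sim = "sim_sp r" and I = I])
    show "is_ideal I" "dim_le I (2*r-2)" "1 \<in> ideal_of (a ` {..<2*r} \<union> ext I)" using I u by auto
    show "\<exists>b. sim_sp r a b \<and> (\<forall>k. 2 \<le> k \<longrightarrow> k < 2*r \<longrightarrow> b k = a k + t k * a 1)
              \<and> b 0 - (a 0 + t 0 * a 1) \<in> ideal_of (b ` {2..<2*r})" for a t :: "nat \<Rightarrow> 'a poly"
      by (rule H1)
    show "3 \<le> 2*r" using r by simp
    show "sim_sp r a c" if "sim_sp r a b" "sim_sp r b c" for a b c :: "nat \<Rightarrow> 'a poly"
      using sim_sp_trans that .
    show "a ` {..<2*r} \<subseteq> ideal_of (b ` {..<2*r})" if "sim_sp r a b" for a b :: "nat \<Rightarrow> 'a poly"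
      using that by (simp add: sim_sp_def)
  qed (rule sp_to_e0[OF r0])
  then obtain b where "sim_sp r a b" and b: "b 0 - 1 \<in> ext I \<and> (\<forall>k. 0 < k \<longrightarrow> k < 2*r \<longrightarrow> b k \<in> ext I)" by blast
  then obtain g where "b = g a" "\<forall>u v. sp r (g u) (g v) = sp r u v" unfolding sim_sp_def by blast
  then show ?thesis using b by (intro exI[of _ g]) simp
qed

end

section \<open>Cancellation of hyperbolic planes\<close>

text \<open>
  The Gram matrix of the standard basis.
\<close>
definition Jm :: "nat \<Rightarrow> nat \<Rightarrow> 'r::comm_ring_1" where
  "Jm i j = (if even i \<and> j = i + 1 then 1 else if odd i \<and> i = j + 1 then -1 else 0)"

text \<open>
  The orthogonal sum of \<open>\<phi>\<close> on the first \<open>2 r\<close> indices with hyperbolic planes.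
\<close>
definition dsum :: "nat \<Rightarrow> (nat \<Rightarrow> nat \<Rightarrow> 'r::comm_ring_1) \<Rightarrow> nat \<Rightarrow> nat \<Rightarrow> 'r" where
  "dsum r \<phi> i j = (if i < 2*r \<and> j < 2*r then \<phi> i j else if 2*r \<le> i \<and> 2*r \<le> j then Jm i j else 0)"

context local_noeth begin

text \<open>
  If \<open>\<phi>\<close> plus hyperbolic planes is the Gram matrix of \<open>2 R\<close> vectors, so is \<open>\<phi>\<close> of \<open>2 r\<close> vectors in a space of rank \<open>2 r\<close>.
  The first vector of the last plane is unimodular, so an isometry moves it to the basis vector \<open>0\<close>.
  Vectors orthogonal to it then have entry \<open>1\<close> equal to zero, and dropping the first plane does not
  change their products.
\<close>
lemma cancel_planes:
  fixes S :: "nat \<Rightarrow> nat \<Rightarrow> 'a poly"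
  assumes r: "2 \<le> r" "r \<le> R" and I: "is_ideal I" "dim_le I 2"
    and S: "\<And>i j. i < 2*R \<Longrightarrow> j < 2*R \<Longrightarrow> sp R (S i) (S j) - dsum r \<phi> i j \<in> ext I"
  shows "\<exists>S. \<forall>i<2*r. \<forall>j<2*r. sp r (S i) (S j) - \<phi> i j \<in> ext I"
  using r S
proof (induction "R - r" arbitrary: R S)
  case 0
  have "R = r" using 0(1,3) by simp
  then show ?case using 0(4) by (intro exI[of _ S]) (simp add: dsum_def)
next
  case (Suc n)
  define R' where "R' = R - 1"
  have R': "R = Suc R'" "n = R' - r" "r \<le> R'" using Suc.hyps(2) by (auto simp: R'_def)
  have A: "is_ideal (ext I)" using I ext_ideal by blast
  define p q where "p = S (2*R')" and "q = S (2*R'+1)"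
  have pq: "sp R p q - 1 \<in> ext I"
    using Suc.prems(3)[of "2*R'" "2*R'+1"] R' by (simp add: p_def q_def dsum_def Jm_def)
  have dim: "dim_le I (2*R - 2)"
    unfolding dim_le_def
  proof (rule allI, rule notI)
    fix P assume "ht_ge I (Suc (2*R - 2)) P"
    then have "ht_ge I (Suc 2) P" by (rule ht_ge_less) (use r(1) Suc.prems(2) in simp)
    then show False using I(2) unfolding dim_le_def by blast
  qed
  have "sp R q p \<in> ideal_of (p ` {..<2*R} \<union> ext I)"
    by (rule sp_in_ideal[OF ideal_of_ideal]) (auto intro: ideal_of_base)
  moreover have "1 + sp R q p \<in> ideal_of (p ` {..<2*R} \<union> ext I)"
    using ideal_uminus[OF A pq] sp_anti[of R q p] by (intro ideal_of_base) (simp add: add.commute)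
  ultimately have u: "1 \<in> ideal_of (p ` {..<2*R} \<union> ext I)"
    using ideal_diff[OF ideal_of_ideal, of "1 + sp R q p" _ "sp R q p"] by simp
  obtain g where g: "\<And>u v. sp R (g u) (g v) = sp R u v" and g0: "g p 0 - 1 \<in> ext I"
     "\<And>k. 0 < k \<Longrightarrow> k < 2*R \<Longrightarrow> g p k \<in> ext I"
    using sp_transitive[OF _ I(1) dim u] r(1) Suc.prems(2) by auto
  define T where "T i = g (S i)" for i
  have R0: "0 < R" using R' by simp
  have T1: "T i 1 \<in> ext I" if i: "i < 2*R'" for i
  proof -
    have "sp R (T i) (g p) - 0 \<in> ext I"
    proof -
      have "dsum r \<phi> i (2*R') = 0" using i R'(3) by (auto simp: dsum_def Jm_def) presburger
      moreover have "sp R (T i) (g p) = sp R (S i) (S (2*R'))" by (simp only: T_def g p_def)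
      ultimately show ?thesis using Suc.prems(3)[of i "2*R'"] i R'(1) by simp
    qed
    moreover have "sp R (T i) (g p) = T i 0 * g p 1 - T i 1 * (g p 0 - 1) - T i 1 + sp1 R (T i) (g p)"
      unfolding sp_split[OF R0] by (simp add: algebra_simps)
    moreover have "T i 0 * g p 1 \<in> ext I" "T i 1 * (g p 0 - 1) \<in> ext I" "sp1 R (T i) (g p) \<in> ext I"
      using g0 R0 by (auto intro: ideal_mult[OF A] sp1_in_ideal[OF A])
    ultimately have "T i 0 * g p 1 - T i 1 * (g p 0 - 1) + sp1 R (T i) (g p) - sp R (T i) (g p) \<in> ext I"
      using \<open>sp R (T i) (g p) - 0 \<in> ext I\<close> unfolding diff_0_right
      by - (assumption | rule ideal_add[OF A] ideal_diff[OF A])+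
    then show ?thesis using \<open>sp R (T i) (g p) = _\<close> by simp
  qed
  define S' where "S' i = (\<lambda>k. T i (k + 2))" for i
  have "sp R' (S' i) (S' j) - dsum r \<phi> i j \<in> ext I" if ij: "i < 2*R'" "j < 2*R'" for i j
  proof -
    have "sp R (T i) (T j) = T i 0 * T j 1 - T i 1 * T j 0 + sp R' (S' i) (S' j)"
      using sp_split[OF R0, of "T i" "T j"] sp1_shift[of R' "T i" "T j"] R'(1) by (simp add: S'_def)
    moreover have "sp R (T i) (T j) - dsum r \<phi> i j \<in> ext I"
    proof -
      have "sp R (T i) (T j) = sp R (S i) (S j)" by (simp only: T_def g)
      then show ?thesis using Suc.prems(3)[of i j] ij R'(1) by simp
    qed
    moreover have "T i 0 * T j 1 \<in> ext I" "T i 1 * T j 0 \<in> ext I"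
      using T1 ij by (auto intro: ideal_mult[OF A] ideal_mult2[OF A])
    ultimately have "sp R (T i) (T j) - dsum r \<phi> i j - T i 0 * T j 1 + T i 1 * T j 0 \<in> ext I"
      by - (assumption | rule ideal_add[OF A] ideal_diff[OF A])+
    then show ?thesis using \<open>sp R (T i) (T j) = _\<close> by (simp add: algebra_simps)
  qed
  from Suc.hyps(1)[OF R'(2) r(1) R'(3) this] show ?case .
qed

text \<open>
  The hypotheses say that the Vaserstein matrix of \<open>x\<close> and \<open>u\<close> is the Gram matrix of \<open>S\<close>.  After
  \<open>S 0\<close> has been moved to the basis vector \<open>0\<close>, the entries \<open>1\<close> of the other three vectors form the row \<open>x\<close>, and
  expanding \<open>\<Sum>x\<^sub>i u\<^sub>i\<close> in their products shows that \<open>x\<close> together with the rows of entries \<open>2\<close> and \<open>3\<close> has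
  determinant \<open>1\<close>; the determinant is expanded along the latter row.
\<close>
lemma gram_completes:
  fixes x u :: "nat \<Rightarrow> 'a poly" and S :: "nat \<Rightarrow> nat \<Rightarrow> 'a poly"
  assumes I: "is_ideal I" "dim_le I 2" and xu: "x 0 * u 0 + x 1 * u 1 + x 2 * u 2 - 1 \<in> ext I"
    and S01: "sp 2 (S 0) (S 1) - x 0 \<in> ext I" and S02: "sp 2 (S 0) (S 2) - x 1 \<in> ext I"
    and S03: "sp 2 (S 0) (S 3) - x 2 \<in> ext I"
    and S12: "sp 2 (S 1) (S 2) - u 2 \<in> ext I" and S13: "sp 2 (S 1) (S 3) + u 1 \<in> ext I"
    and S23: "sp 2 (S 2) (S 3) - u 0 \<in> ext I"
  shows "\<exists>(w :: nat \<Rightarrow> 'a poly) (c :: nat \<Rightarrow> 'a poly). c 0 * (x 1 * w 2 - x 2 * w 1) + c 1 * (x 2 * w 0 - x 0 * w 2) + c 2 * (x 0 * w 1 - x 1 * w 0) - 1 \<in> ext I"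
proof -
  have A: "is_ideal (ext I)" using I ext_ideal by blast
  define B where "B = ideal_of (S 0 ` {..<2*2} \<union> ext I)"
  have B: "is_ideal B" by (simp add: B_def ideal_of_ideal)
  have AB: "a \<in> B" if "a \<in> ext I" for a using that by (auto simp: B_def intro: ideal_of_base)
  have "sp 2 (S j) (S 0) \<in> B" for j
    unfolding B_def by (rule sp_in_ideal[OF ideal_of_ideal]) (auto intro: ideal_of_base)
  then have sB: "sp 2 (S 0) (S j) \<in> B" for j using ideal_uminus[OF B] sp_anti[of 2 "S 0" "S j"] by metis
  have "x k \<in> B" if "sp 2 (S 0) (S j) - x k \<in> ext I" for j k
    using ideal_diff[OF B sB[of j] AB[OF that]] by simp
  then have "x 0 \<in> B" "x 1 \<in> B" "x 2 \<in> B" using S01 S02 S03 by blast+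
  then have "x 0 * u 0 + x 1 * u 1 + x 2 * u 2 \<in> B" by (intro ideal_add[OF B] ideal_mult2[OF B])
  then have one: "1 \<in> B" using ideal_diff[OF B _ AB[OF xu]] by fastforce
  obtain g where g: "\<And>u v. sp 2 (g u) (g v) = sp 2 u v" and g0: "g (S 0) 0 - 1 \<in> ext I"
     "\<And>k. 0 < k \<Longrightarrow> k < 4 \<Longrightarrow> g (S 0) k \<in> ext I"
    using sp_transitive[of 2 I "S 0"] I one by (auto simp: B_def)
  define T where "T i = g (S i)" for i
  have sp2: "sp 2 a b = a 0 * b 1 - a 1 * b 0 + a 2 * b 3 - a 3 * b 2" for a b :: "nat \<Rightarrow> 'a poly"
    by (simp add: sp_def numeral_2_eq_2 numeral_3_eq_3)
  have Tx: "T j 1 - x k \<in> ext I" if "sp 2 (S 0) (S j) - x k \<in> ext I" for j k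
  proof -
    have eq: "T j 1 - x k = (sp 2 (T 0) (T j) - x k) - (T 0 0 - 1) * T j 1 + T 0 1 * T j 0 - T 0 2 * T j 3 + T 0 3 * T j 2"
      by (simp add: sp2 algebra_simps)
    have "(T 0 0 - 1) * T j 1 \<in> ext I" "T 0 1 * T j 0 \<in> ext I" "T 0 2 * T j 3 \<in> ext I" "T 0 3 * T j 2 \<in> ext I"
      using g0 by (auto simp: T_def intro!: ideal_mult2[OF A])
    moreover have "sp 2 (T 0) (T j) - x k \<in> ext I" using that by (simp add: T_def g)
    ultimately show ?thesis unfolding eq by - (assumption | rule ideal_add[OF A] ideal_diff[OF A])+
  qed
  \<comment> \<open>The columns of the \<open>4 \<times> 3\<close> matrix of the vectors \<open>T 1, T 2, T 3\<close>.\<close>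
  define \<alpha> where "\<alpha> j = T j 0" for j :: nat
  define y where "y j = T j 1" for j :: nat
  define \<beta> where "\<beta> j = T j 2" for j :: nat
  define \<gamma> where "\<gamma> j = T j 3" for j :: nat
  have y: "y 1 - x 0 \<in> ext I" "y 2 - x 1 \<in> ext I" "y 3 - x 2 \<in> ext I"
    using Tx S01 S02 S03 by (auto simp: y_def)
  have f12: "\<alpha> 1 * y 2 - y 1 * \<alpha> 2 + \<beta> 1 * \<gamma> 2 - \<gamma> 1 * \<beta> 2 - u 2 \<in> ext I"
    and f13: "\<alpha> 1 * y 3 - y 1 * \<alpha> 3 + \<beta> 1 * \<gamma> 3 - \<gamma> 1 * \<beta> 3 + u 1 \<in> ext I"
    and f23: "\<alpha> 2 * y 3 - y 2 * \<alpha> 3 + \<beta> 2 * \<gamma> 3 - \<gamma> 2 * \<beta> 3 - u 0 \<in> ext I"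
    using S12 S13 S23 g[of "S 1" "S 2"] g[of "S 1" "S 3"] g[of "S 2" "S 3"]
    by (simp_all add: sp2 T_def \<alpha>_def y_def \<beta>_def \<gamma>_def)
  have "(\<gamma> 1 * (x 1 * \<beta> 3 - x 2 * \<beta> 2) + \<gamma> 2 * (x 2 * \<beta> 1 - x 0 * \<beta> 3) + \<gamma> 3 * (x 0 * \<beta> 2 - x 1 * \<beta> 1) - 1)
    = (x 0 * u 0 + x 1 * u 1 + x 2 * u 2 - 1)
     + x 0 * (\<alpha> 2 * y 3 - y 2 * \<alpha> 3 + \<beta> 2 * \<gamma> 3 - \<gamma> 2 * \<beta> 3 - u 0)
     - x 1 * (\<alpha> 1 * y 3 - y 1 * \<alpha> 3 + \<beta> 1 * \<gamma> 3 - \<gamma> 1 * \<beta> 3 + u 1)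
     + x 2 * (\<alpha> 1 * y 2 - y 1 * \<alpha> 2 + \<beta> 1 * \<gamma> 2 - \<gamma> 1 * \<beta> 2 - u 2)
     + (x 1 * \<alpha> 1 - x 0 * \<alpha> 2) * (y 3 - x 2) + (x 0 * \<alpha> 3 - x 2 * \<alpha> 1) * (y 2 - x 1)
     + (x 2 * \<alpha> 2 - x 1 * \<alpha> 3) * (y 1 - x 0)"
    by (simp add: algebra_simps)
  also have "\<dots> \<in> ext I"
    by (intro ideal_add[OF A] ideal_diff[OF A, of _ "x 1 * _"] ideal_mult[OF A] xu f23 f13 f12 y)
  finally show ?thesis
    by (intro exI[of _ "\<lambda>k. \<beta> (k+1)"] exI[of _ "\<lambda>k. \<gamma> (k+1)"]) (simp add: numeral_2_eq_2 numeral_3_eq_3)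
qed

end

section \<open>Alternating matrices linear in the variable\<close>

text \<open>
  The coefficients of \<open>sqrt (1 + Y)\<close> as a power series in \<open>Y\<close>, where \<open>h\<close> is one half.
\<close>
fun sqc :: "'a::comm_ring_1 \<Rightarrow> nat \<Rightarrow> 'a" where
  "sqc h n = (if n = 0 then 1 else if n = 1 then h else - h * (\<Sum>k\<in>{1..<n}. sqc h k * sqc h (n - k)))"

declare sqc.simps [simp del]

text \<open>
  The square of the power series is \<open>1 + Y\<close>.
\<close>
lemma sqc_conv:
  assumes h: "h + h = 1"
  shows "(\<Sum>k\<le>m. sqc h k * sqc h (m - k)) = (if m \<le> 1 then 1 else 0)"
proof -
  have 0: "sqc h 0 = 1" and 1: "sqc h 1 = h" by (simp_all add: sqc.simps)
  consider "m = 0" | "m = 1" | "m \<ge> 2" by linarith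
  then show ?thesis
  proof cases
    case 3
    have "{..m} = insert 0 (insert m {1..<m})" using 3 by auto
    then have "(\<Sum>k\<le>m. sqc h k * sqc h (m - k)) = sum (\<lambda>k. sqc h k * sqc h (m - k)) (insert 0 (insert m {1..<m}))"
      by (rule arg_cong)
    also have "\<dots> = sqc h m + (sqc h m + (\<Sum>k\<in>{1..<m}. sqc h k * sqc h (m - k)))"
      using 3 by (simp add: 0)
    also have "sqc h m = - h * (\<Sum>k\<in>{1..<m}. sqc h k * sqc h (m - k))" using 3 by (subst sqc.simps) simp
    also have "- h * s + (- h * s + s) = (1 - (h + h)) * s" for s :: 'a by (simp add: algebra_simps)
    finally show ?thesis using 3 h by simp
  qed (use 0 1 h in \<open>simp_all add: atMost_Suc\<close>)
qed

definition unitv :: "nat \<Rightarrow> nat \<Rightarrow> 'a::comm_ring_1" where "unitv j i = (if i = j then 1 else 0)"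

lemma sp_unitv:
  assumes "i < 2*r"
  shows "sp r (unitv i) v = (if even i then v (i+1) else - v (i-1))"
proof (cases "even i")
  case True
  then obtain a where a: "i = 2*a" by blast
  have "sp r (unitv i) v = (\<Sum>k<r. if k = a then v (2*a+1) else 0)"
    unfolding sp_def
  proof (rule sum.cong)
    fix k
    have "2*k \<noteq> 2*a+1" "2*k+1 \<noteq> 2*a" "2*k = 2*a \<longleftrightarrow> k = a" "2*k+1 = 2*a+1 \<longleftrightarrow> k = a" by presburger+
    then show "unitv i (2*k) * v (2*k+1) - unitv i (2*k+1) * v (2*k) = (if k = a then v (2*a+1) else 0)"
      unfolding unitv_def a by (cases "k = a") simp_all
  qed simp
  then show ?thesis using assms a by simp
next
  case False
  then obtain a where a: "i = 2*a+1" using oddE by blast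
  have "sp r (unitv i) v = (\<Sum>k<r. if k = a then - v (2*a) else 0)"
    unfolding sp_def
  proof (rule sum.cong)
    fix k
    have "2*k \<noteq> 2*a+1" "2*k+1 \<noteq> 2*a" "2*k = 2*a \<longleftrightarrow> k = a" "2*k+1 = 2*a+1 \<longleftrightarrow> k = a" by presburger+
    then show "unitv i (2*k) * v (2*k+1) - unitv i (2*k+1) * v (2*k) = (if k = a then - v (2*a) else 0)"
      unfolding unitv_def a by (cases "k = a") simp_all
  qed simp
  then show ?thesis using assms a by simp
qed

lemma sp_unitv2: "i < 2*r \<Longrightarrow> sp r (unitv i) (unitv j) = Jm i j"
  by (auto simp: sp_unitv unitv_def Jm_def elim!: oddE)

lemma Jm_sum:
  assumes "i < 2*r"
  shows "(\<Sum>t<2*r. Jm i t * v t) = (if even i then v (i+1) else - v (i-1))"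
proof (cases "even i")
  case True
  then have lt: "i + 1 < 2*r" using assms by presburger
  have "(\<Sum>t<2*r. Jm i t * v t) = (\<Sum>t<2*r. if t = i + 1 then v (i+1) else 0)"
    by (rule sum.cong) (use True in \<open>auto simp: Jm_def\<close>)
  then show ?thesis using True lt by simp
next
  case False
  then have lt: "i - 1 < 2*r" "i \<ge> 1" using assms by (auto elim: oddE)
  have "(\<Sum>t<2*r. Jm i t * v t) = (\<Sum>t<2*r. if t = i - 1 then - v (i-1) else 0)"
    by (rule sum.cong) (use False lt in \<open>auto simp: Jm_def\<close>)
  then show ?thesis using False lt by simp
qed

lemma sp_sum: "sp r (\<lambda>i. \<Sum>k\<in>K. f k * g k i) v = (\<Sum>k\<in>K. f k * sp r (g k) v)"
proof -
  have "sp r (\<lambda>i. \<Sum>k\<in>K. f k * g k i) v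
      = (\<Sum>m<r. \<Sum>k\<in>K. f k * (g k (2*m) * v (2*m+1) - g k (2*m+1) * v (2*m)))"
    unfolding sp_def
    by (rule sum.cong) (simp_all add: sum_distrib_right sum_distrib_left sum_subtractf algebra_simps)
  also have "\<dots> = (\<Sum>k\<in>K. f k * sp r (g k) v)"
    unfolding sp_def sum_distrib_left by (rule sum.swap)
  finally show ?thesis .
qed

lemma sp_sum2: "sp r v (\<lambda>i. \<Sum>k\<in>K. f k * g k i) = (\<Sum>k\<in>K. f k * sp r v (g k))"
  unfolding sp_anti[of r v] sp_sum by (simp add: sum_negf)

lemma sp_const: "sp r (\<lambda>i. [:u i:]) (\<lambda>i. [:v i:]) = [:sp r u v:]"
  unfolding sp_def by (induction r) (simp_all add: mult.commute)

text \<open>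
  Write \<open>\<phi> = J (1 + X N)\<close>, where \<open>J\<close> is the hyperbolic matrix and \<open>N\<close> is self-adjoint for the
  symplectic form.  Invertibility of \<open>\<phi>\<close> over \<open>R[X]\<close> makes \<open>N\<close> nilpotent, because the coefficients of
  the inverse are \<open>\<plusminus> N\<^sup>k\<close> up to \<open>J\<close>.  Hence \<open>sqrt (1 + X N)\<close> is a polynomial, and since it is
  self-adjoint, the images of the basis vectors under it have Gram matrix \<open>\<phi>\<close>.
\<close>
lemma linear_gram:
  fixes \<phi> :: "nat \<Rightarrow> nat \<Rightarrow> 'a::comm_ring_1 poly"
  assumes h: "h + h = (1::'a)" and I: "is_ideal I"
    and c0: "\<And>i j. i < 2*r \<Longrightarrow> j < 2*r \<Longrightarrow> coeff (\<phi> i j) 0 = Jm i j"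
    and deg: "\<And>i j. i < 2*r \<Longrightarrow> j < 2*r \<Longrightarrow> degree (\<phi> i j) \<le> 1"
    and alt: "\<And>i j. i < 2*r \<Longrightarrow> j < 2*r \<Longrightarrow> \<phi> j i = - \<phi> i j"
    and surj: "\<And>y. \<exists>z. \<forall>i<2*r. (\<Sum>t<2*r. \<phi> i t * z t) - y i \<in> ext I"
  shows "\<exists>S. \<forall>i<2*r. \<forall>j<2*r. sp r (S i) (S j) - \<phi> i j \<in> ext I"
proof -
  define \<Psi> where "\<Psi> i j = coeff (\<phi> i j) 1" for i j
  define Pv where "Pv v i = (\<Sum>j<2*r. \<Psi> i j * v j)" for v :: "nat \<Rightarrow> 'a" and i
  \<comment> \<open>\<open>N\<close> is \<open>J\<^sup>-\<^sup>1\<close> times the matrix \<open>\<Psi>\<close> of linear coefficients.\<close>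
  define N where "N v i = (if even i then - Pv v (i+1) else Pv v (i-1))" for v :: "nat \<Rightarrow> 'a" and i
  have spN: "sp r u (N v) = (\<Sum>i<2*r. u i * Pv v i)" for u v
    unfolding sp_def sum_pairs by (rule sum.cong) (simp_all add: N_def)
  have alt\<Psi>: "\<Psi> j i = - \<Psi> i j" if "i < 2*r" "j < 2*r" for i j
    using alt[OF that] by (simp add: \<Psi>_def)
  have adj: "sp r (N u) v = sp r u (N v)" for u v
  proof -
    have "sp r (N u) v = - (\<Sum>i<2*r. v i * Pv u i)" unfolding spN[symmetric] by (rule sp_anti)
    also have "\<dots> = (\<Sum>i<2*r. \<Sum>j<2*r. u j * (\<Psi> j i * v i))"
      unfolding Pv_def sum_distrib_left sum_negf[symmetric]
    proof (intro sum.cong refl)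
      fix i j assume "i \<in> {..<2*r}" "j \<in> {..<2*r}"
      then show "- (v i * (\<Psi> i j * u j)) = u j * (\<Psi> j i * v i)"
        using alt\<Psi>[of i j] by (simp add: algebra_simps)
    qed
    also have "\<dots> = (\<Sum>j<2*r. \<Sum>i<2*r. u j * (\<Psi> j i * v i))" by (rule sum.swap)
    also have "\<dots> = sp r u (N v)" unfolding spN Pv_def sum_distrib_left ..
    finally show ?thesis .
  qed
  have pow: "sp r ((N ^^ k) u) ((N ^^ l) v) = sp r u ((N ^^ (k + l)) v)" for k l u v
  proof (induction k arbitrary: l)
    case (Suc k)
    have "sp r ((N ^^ Suc k) u) ((N ^^ l) v) = sp r ((N ^^ k) u) ((N ^^ Suc l) v)" by (simp add: adj)
    then show ?case using Suc[of "Suc l"] by simp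
  qed simp
  \<comment> \<open>The entries of \<open>J N\<^sup>m\<close>.\<close>
  define M where "M m i j = sp r (unitv i) ((N ^^ m) (unitv j))" for m i j
  have funpow_1: "N ^^ 1 = N" by simp
  have M0: "M 0 i j = Jm i j" if "i < 2*r" for i j using that by (simp add: M_def sp_unitv2)
  have M1: "M 1 i j = \<Psi> i j" if "i < 2*r" "j < 2*r" for i j
  proof -
    have "M 1 i j = (\<Sum>i'<2*r. if i' = i then Pv (unitv j) i else 0)"
      unfolding M_def funpow_1 spN by (rule sum.cong) (auto simp: unitv_def)
    also have "\<dots> = Pv (unitv j) i" using that by simp
    also have "\<dots> = (\<Sum>j'<2*r. if j' = j then \<Psi> i j else 0)"
      unfolding Pv_def by (rule sum.cong) (auto simp: unitv_def)
    finally show ?thesis using that by simp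
  qed
  have nil1: "\<exists>K. \<forall>k\<ge>K. \<forall>i<2*r. (N ^^ k) (unitv j) i \<in> I" if j: "j < 2*r" for j
  proof -
    obtain z where z: "\<And>i. i < 2*r \<Longrightarrow> (\<Sum>t<2*r. \<phi> i t * z t) - [:Jm i j:] \<in> ext I"
      using surj[of "\<lambda>i. [:Jm i j:]"] by blast
    have zc: "(\<Sum>t<2*r. Jm i t * coeff (z t) k + (if k = 0 then 0 else \<Psi> i t * coeff (z t) (k - 1)))
        - (if k = 0 then Jm i j else 0) \<in> I" if i: "i < 2*r" for i k
    proof -
      have "coeff (\<phi> i t * z t) k = Jm i t * coeff (z t) k + (if k = 0 then 0 else \<Psi> i t * coeff (z t) (k - 1))"
        if "t < 2*r" for t
      proof -
        have "\<phi> i t = [:Jm i t:] + monom (\<Psi> i t) 1"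
          using c0[OF i that] deg[OF i that]
          by (intro poly_eqI) (auto simp: \<Psi>_def coeff_pCons coeff_eq_0 split: nat.splits)
        then show ?thesis by (cases k) (simp_all add: distrib_right coeff_monom_mult)
      qed
      then have "coeff ((\<Sum>t<2*r. \<phi> i t * z t) - [:Jm i j:]) k =
          (\<Sum>t<2*r. Jm i t * coeff (z t) k + (if k = 0 then 0 else \<Psi> i t * coeff (z t) (k - 1))) - (if k = 0 then Jm i j else 0)"
        by (simp add: coeff_sum coeff_pCons split: nat.split)
      moreover have "coeff ((\<Sum>t<2*r. \<phi> i t * z t) - [:Jm i j:]) k \<in> I" using z[OF i] by (simp add: ext_def)
      ultimately show ?thesis by simp
    qed
    define Jv where "Jv v i = (if even i then v (i+1) else - v (i-1))" for v :: "nat \<Rightarrow> 'a" and i :: nat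
    have zJ: "Jv (\<lambda>t. coeff (z t) k) i + (if k = 0 then 0 else Pv (\<lambda>t. coeff (z t) (k - 1)) i)
        - (if k = 0 then Jm i j else 0) \<in> I" if i: "i < 2*r" for i k
      using zc[OF i, of k] unfolding sum.distrib Jm_sum[OF i] Jv_def Pv_def by (cases "k = 0") simp_all
    have Jinj: "a i - b i \<in> I" if ab: "\<And>i. i < 2*r \<Longrightarrow> Jv a i - Jv b i \<in> I" and i: "i < 2*r" for a b i
    proof (cases "even i")
      case True
      then have "i + 1 < 2*r" using i by presburger
      from ab[OF this] have "- a i + b i \<in> I" using True by (simp add: Jv_def)
      then show ?thesis using ideal_uminus[OF I] by fastforce
    next
      case False
      then have lt: "i - 1 < 2*r" "i \<ge> 1" using i by (auto elim: oddE)
      from ab[OF lt(1)] show ?thesis using False lt(2) by (simp add: Jv_def)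
    qed
    have JN: "Jv (N v) i = Pv v i" for v i
      by (cases "even i") (auto simp: Jv_def N_def elim!: oddE)
    have Jc: "Jv (\<lambda>t. c * v t) i = c * Jv v i" for c v i by (simp add: Jv_def)
    have main: "\<forall>i<2*r. coeff (z i) k - (-1) ^ k * (N ^^ k) (unitv j) i \<in> I" for k
    proof (induction k)
      case 0
      have "Jm i j = Jv (unitv j) i" for i
        by (cases "even i") (auto simp: Jv_def Jm_def unitv_def elim!: oddE)
      then show ?case using zJ[of _ 0] Jinj[of "\<lambda>t. coeff (z t) 0" "unitv j"] by simp
    next
      case (Suc k)
      have P: "Pv (\<lambda>t. coeff (z t) k) i - (-1) ^ k * Pv ((N ^^ k) (unitv j)) i \<in> I" for i
      proof -
        have "Pv (\<lambda>t. coeff (z t) k) i - (-1) ^ k * Pv ((N ^^ k) (unitv j)) i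
          = (\<Sum>t<2*r. \<Psi> i t * (coeff (z t) k - (-1) ^ k * (N ^^ k) (unitv j) t))"
          unfolding Pv_def sum_distrib_left sum_subtractf[symmetric] by (rule sum.cong) (simp_all add: algebra_simps)
        also have "\<dots> \<in> I" using Suc by (intro ideal_sum[OF I] ideal_mult[OF I]) simp
        finally show ?thesis .
      qed
      have "Jv (\<lambda>t. coeff (z t) (Suc k)) i - Jv (\<lambda>t. (-1) ^ Suc k * (N ^^ Suc k) (unitv j) t) i \<in> I" if i: "i < 2*r" for i
      proof -
        have "Jv (\<lambda>t. coeff (z t) (Suc k)) i - Jv (\<lambda>t. (-1) ^ Suc k * (N ^^ Suc k) (unitv j) t) i
          = (Jv (\<lambda>t. coeff (z t) (Suc k)) i + Pv (\<lambda>t. coeff (z t) k) i)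
            - (Pv (\<lambda>t. coeff (z t) k) i - (-1) ^ k * Pv ((N ^^ k) (unitv j)) i)"
          unfolding Jc by (simp add: JN)
        also have "\<dots> \<in> I" by (rule ideal_diff[OF I _ P]) (use zJ[OF i, of "Suc k"] in simp)
        finally show ?thesis .
      qed
      from Jinj[OF this] show ?case by blast
    qed
    define K where "K = Suc (\<Sum>t<2*r. degree (z t))"
    have "(N ^^ k) (unitv j) i \<in> I" if "k \<ge> K" "i < 2*r" for k i
    proof -
      have "degree (z i) \<le> (\<Sum>t<2*r. degree (z t))" using that by (intro member_le_sum) auto
      then have "coeff (z i) k = 0" using that by (intro coeff_eq_0) (simp add: K_def)
      then have "- ((-1) ^ k * (N ^^ k) (unitv j) i) \<in> I" using main[of k] that by auto
      then have "(-1) ^ k * - ((-1) ^ k * (N ^^ k) (unitv j) i) \<in> I" by (rule ideal_mult[OF I])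
      moreover have "(-1) ^ k * - ((-1) ^ k * x) = - x" for x :: 'a
        by (simp add: mult.assoc[symmetric] power_mult_distrib[symmetric])
      ultimately show ?thesis using ideal_uminus[OF I] by fastforce
    qed
    then show ?thesis by blast
  qed
  then obtain KK where KK: "\<And>j k i. j < 2*r \<Longrightarrow> k \<ge> KK j \<Longrightarrow> i < 2*r \<Longrightarrow> (N ^^ k) (unitv j) i \<in> I"
    by metis
  define K where "K = 2 + (\<Sum>j<2*r. KK j)"
  have MI: "M m i j \<in> I" if "m \<ge> K" "i < 2*r" "j < 2*r" for m i j
  proof -
    have "KK j \<le> (\<Sum>j<2*r. KK j)" using that by (intro member_le_sum) auto
    then have nj: "\<And>i. i < 2*r \<Longrightarrow> (N ^^ m) (unitv j) i \<in> I" using KK[OF that(3), of m] that(1) by (simp add: K_def)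
    have "i + 1 < 2*r" if "even i" using that \<open>i < 2*r\<close> by presburger
    then show ?thesis unfolding M_def sp_unitv[OF that(2)] using nj[of "i+1"] nj[of "i-1"] that(2)
      by (auto intro: ideal_uminus[OF I])
  qed
  define c where "c = sqc h"
  define S where "S j = (\<lambda>i. \<Sum>k<K. monom (c k) k * [:(N ^^ k) (unitv j) i:])" for j
  have "sp r (S i) (S j) - \<phi> i j \<in> ext I" if ij: "i < 2*r" "j < 2*r" for i j
  proof -
    have "sp r (S i) (S j) = (\<Sum>k<K. monom (c k) k * (\<Sum>l<K. monom (c l) l * [:M (k + l) i j:]))"
      unfolding S_def sp_sum sp_sum2 sp_const pow M_def by (rule refl)
    also have "\<dots> = (\<Sum>k<K. \<Sum>l<K. monom (c k * c l * M (k + l) i j) (k + l))"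
    proof -
      have "monom a k * (monom b l * [:e:]) = monom (a * b * e) (k + l)" for a b e :: 'a and k l
        by (simp add: mult_monom monom_0[symmetric] mult.assoc)
      then show ?thesis unfolding sum_distrib_left by simp
    qed
    finally have G: "sp r (S i) (S j) = (\<Sum>k<K. \<Sum>l<K. monom (c k * c l * M (k + l) i j) (k + l))" .
    have "coeff (sp r (S i) (S j)) m - coeff (\<phi> i j) m \<in> I" for m
    proof -
      have cG: "coeff (sp r (S i) (S j)) m = (\<Sum>k<K. \<Sum>l<K. if k + l = m then c k * c l * M m i j else 0)"
        unfolding G coeff_sum coeff_monom by (intro sum.cong refl) auto
      show ?thesis
      proof (cases "m < K")
        case True
        have "(\<Sum>l<K. if k + l = m then c k * c l * M m i j else 0) = (if k \<le> m then c k * c (m - k) * M m i j else 0)" for k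
        proof (cases "k \<le> m")
          case kt: True
          have "(\<Sum>l<K. if k + l = m then c k * c l * M m i j else 0) = (\<Sum>l<K. if l = m - k then c k * c (m - k) * M m i j else 0)"
            using kt by (intro sum.cong) auto
          then show ?thesis using kt True by simp
        qed (auto intro!: sum.neutral)
        then have "coeff (sp r (S i) (S j)) m = (\<Sum>k<K. if k \<le> m then c k * c (m - k) * M m i j else 0)"
          unfolding cG by simp
        also have "\<dots> = (\<Sum>k\<in>{k\<in>{..<K}. k \<le> m}. c k * c (m - k) * M m i j)"
          by (subst sum.inter_filter) auto
        also have "{k\<in>{..<K}. k \<le> m} = {..m}" using True by auto
        finally have "coeff (sp r (S i) (S j)) m = (if m \<le> 1 then 1 else 0) * M m i j"
          unfolding c_def sum_distrib_right[symmetric] sqc_conv[OF h] .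
        moreover have "coeff (\<phi> i j) m = (if m \<le> 1 then 1 else 0) * M m i j"
        proof -
          consider "m = 0" | "m = 1" | "m \<ge> 2" by linarith
          then show ?thesis
          proof cases
            case 3
            then show ?thesis using deg[OF ij] by (simp add: coeff_eq_0)
          qed (use c0[OF ij] M0[OF ij(1)] M1[OF ij] in \<open>simp_all add: \<Psi>_def\<close>)
        qed
        ultimately show ?thesis by (simp add: ideal_zero[OF I])
      next
        case False
        then have "coeff (\<phi> i j) m = 0" using deg[OF ij] by (intro coeff_eq_0) (simp add: K_def)
        moreover have "coeff (sp r (S i) (S j)) m \<in> I"
          unfolding cG using MI[of m i j] False ij by (intro ideal_sum[OF I]) (auto simp: ideal_zero[OF I] intro: ideal_mult[OF I])
        ultimately show ?thesis by simp
      qed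
    qed
    then show ?thesis by (simp add: ext_def)
  qed
  then show ?thesis by blast
qed

section \<open>Linearization of alternating matrices\<close>

text \<open>
  The measure of nonlinearity: each monomial of degree \<open>k \<ge> 2\<close> counts \<open>k - 1\<close>, so that trading a
  monomial of degree \<open>k\<close> for one of degree \<open>k - 1\<close> and one of degree \<open>1\<close> decreases the total.
\<close>
definition weight :: "'a::comm_ring_1 poly \<Rightarrow> nat" where
  "weight p = (\<Sum>k\<in>{2..degree p}. if coeff p k = 0 then 0 else k - 1)"

definition total_weight :: "nat \<Rightarrow> (nat \<Rightarrow> nat \<Rightarrow> 'a::comm_ring_1 poly) \<Rightarrow> nat" where
  "total_weight n \<phi> = (\<Sum>j<n. \<Sum>i<j. weight (\<phi> i j))"

lemma weight_bound: "degree p \<le> d \<Longrightarrow> weight p = (\<Sum>k\<in>{2..d}. if coeff p k = 0 then 0 else k - 1)"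
  unfolding weight_def by (rule sum.mono_neutral_left) (auto intro: coeff_eq_0)

lemma weight_small: "degree p \<le> 1 \<Longrightarrow> weight p = 0"
  by (simp add: weight_def)

lemma weight_0D: "weight p = 0 \<Longrightarrow> degree p \<le> 1"
proof (rule ccontr)
  assume w: "weight p = 0" "\<not> degree p \<le> 1"
  then have "degree p \<in> {2..degree p}" by simp
  moreover have "lead_coeff p \<noteq> 0" using w by auto
  moreover have "\<forall>k\<in>{2..degree p}. (if coeff p k = 0 then 0 else k - 1) = 0"
    using w(1) unfolding weight_def by simp
  ultimately have "(if lead_coeff p = 0 then 0 else degree p - 1) = 0" by blast
  then show False using w(2) \<open>lead_coeff p \<noteq> 0\<close> by simp
qed

lemma weight_single: "weight (monom c k) \<le> k - 1"
proof -
  have "weight (monom c k) = (\<Sum>i\<in>{2..k}. if coeff (monom c k) i = 0 then 0 else i - 1)"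
    by (rule weight_bound[OF degree_monom_le])
  also have "\<dots> \<le> (\<Sum>i\<in>{2..k}. if i = k then k - 1 else 0)" by (rule sum_mono) auto
  also have "\<dots> \<le> k - 1" by simp
  finally show ?thesis .
qed

lemma weight_remove:
  assumes "2 \<le> k" "coeff p k \<noteq> 0"
  shows "weight (p - monom (coeff p k) k) + (k - 1) = weight p"
proof -
  have k: "k \<le> degree p" using assms le_degree by blast
  have "degree (p - monom (coeff p k) k) \<le> degree p"
    by (intro degree_diff_le order.trans[OF degree_monom_le]) (use k in auto)
  then have "weight (p - monom (coeff p k) k)
      = (\<Sum>i\<in>{2..degree p}. if coeff (p - monom (coeff p k) k) i = 0 then 0 else i - 1)" by (rule weight_bound)
  also have "\<dots> = (\<Sum>i\<in>{2..degree p} - {k}. if coeff p i = 0 then 0 else i - 1)"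
    using k assms by (subst sum.remove[of _ k]) (auto intro!: sum.cong)
  finally show ?thesis using k assms unfolding weight_def by (subst (2) sum.remove[of _ k]) auto
qed

text \<open>
  Higman's linearization for alternating matrices.  A monomial \<open>c X\<^sup>k\<close> with \<open>k \<ge> 2\<close> in position \<open>(a, b)\<close> is
  the product of \<open>X\<close> and \<open>c X\<^sup>k\<^sup>-\<^sup>1\<close>.  In the sum \<open>\<psi>\<close> with one more hyperbolic plane these factors are placed
  next to the plane, and \<open>\<psi>\<close> is congruent to \<open>\<phi>\<close> plus a plane by a unipotent change of basis; Gram vectors of
  \<open>\<psi>\<close> are transformed into Gram vectors of \<open>\<phi>\<close> accordingly.
\<close>
lemma linearize:
  fixes \<phi> :: "nat \<Rightarrow> nat \<Rightarrow> 'a::comm_ring_1 poly"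
  assumes h: "h + h = (1::'a)" and I: "is_ideal I"
    and c0: "\<And>i j. i < 2*r \<Longrightarrow> j < 2*r \<Longrightarrow> coeff (\<phi> i j) 0 = Jm i j"
    and alt: "\<And>i j. i < 2*r \<Longrightarrow> j < 2*r \<Longrightarrow> \<phi> j i = - \<phi> i j"
    and surj: "\<And>y. \<exists>z. \<forall>i<2*r. (\<Sum>t<2*r. \<phi> i t * z t) - y i \<in> ext I"
  shows "\<exists>R\<ge>r. \<exists>S. \<forall>i<2*R. \<forall>j<2*R. sp R (S i) (S j) - dsum r \<phi> i j \<in> ext I"
  using c0 alt surj
proof (induction "total_weight (2*r) \<phi>" arbitrary: r \<phi> rule: less_induct)
  case less
  note c0 = less.prems(1) and alt = less.prems(2) and surj = less.prems(3)
  have A: "is_ideal (ext I)" by (rule ext_ideal[OF I])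
  have diag: "\<phi> i i = 0" if "i < 2*r" for i
  proof -
    have "\<phi> i i + \<phi> i i = 0" using alt[OF that that] by (metis add.right_inverse)
    then have "smult h (\<phi> i i + \<phi> i i) = 0" by simp
    then have "smult (h + h) (\<phi> i i) = 0" unfolding smult_add_left smult_add_right .
    then show ?thesis using h by simp
  qed
  show ?case
  proof (cases "total_weight (2*r) \<phi> = 0")
    case True
    have up: "degree (\<phi> i j) \<le> 1" if "i < j" "j < 2*r" for i j
    proof -
      have "(\<Sum>i<j. weight (\<phi> i j)) = 0" using True that unfolding total_weight_def by (subst (asm) sum_eq_0_iff) auto
      then have "weight (\<phi> i j) = 0" using that by (subst (asm) sum_eq_0_iff) auto
      then show ?thesis by (rule weight_0D)
    qed
    have "degree (\<phi> i j) \<le> 1" if "i < 2*r" "j < 2*r" for i j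
    proof -
      consider "i < j" | "j < i" | "i = j" by linarith
      then show ?thesis
      proof cases
        case 2
        then show ?thesis using up[of j i] that alt[OF that] degree_minus[of "\<phi> i j"] by simp
      qed (use up that diag in auto)
    qed
    from linear_gram[OF h I c0 this alt surj]
    obtain S where "\<forall>i<2*r. \<forall>j<2*r. sp r (S i) (S j) - \<phi> i j \<in> ext I" by blast
    then show ?thesis by (intro exI[of _ r] conjI exI[of _ S]) (auto simp: dsum_def)
  next
    case False
    then obtain b where b: "b < 2*r" "(\<Sum>i<b. weight (\<phi> i b)) \<noteq> 0"
      unfolding total_weight_def by (rule sum.not_neutral_contains_not_neutral) simp
    obtain a where a: "a < b" "weight (\<phi> a b) \<noteq> 0"
      using b(2) by (rule sum.not_neutral_contains_not_neutral) simp
    obtain k where k: "2 \<le> k" "coeff (\<phi> a b) k \<noteq> 0"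
      using a(2) unfolding weight_def by (rule sum.not_neutral_contains_not_neutral) (simp split: if_splits)
    define c where "c = coeff (\<phi> a b) k"
    define p q where "p = 2*r" and "q = 2*r+1"
    define \<alpha> where "\<alpha> i = (if i = a then - monom 1 1 else 0 :: 'a poly)" for i
    define \<beta> where "\<beta> j = (if j = b then monom c (k - 1) else 0 :: 'a poly)" for j
    define \<psi> where "\<psi> i j = (if i < p \<and> j < p then \<phi> i j + \<alpha> i * \<beta> j - \<beta> i * \<alpha> j
       else if i = p \<and> j < p then \<beta> j else if i = q \<and> j < p then - \<alpha> j
       else if i < p \<and> j = p then - \<beta> i else if i < p \<and> j = q then \<alpha> i
       else if i = p \<and> j = q then 1 else if i = q \<and> j = p then -1 else 0)" for i j
    have ab: "a < p" "b < p" "a \<noteq> b" using a b by (auto simp: p_def)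
    have q: "q = Suc p" "p < q" "2 * Suc r = Suc q" by (auto simp: p_def q_def)
    have lt_q: "i < 2 * Suc r \<longleftrightarrow> i < p \<or> i = p \<or> i = q" for i by (auto simp: p_def q_def)
    have \<psi>00: "\<psi> i j = \<phi> i j + \<alpha> i * \<beta> j - \<beta> i * \<alpha> j" if "i < p" "j < p" for i j using that by (simp add: \<psi>_def)
    have \<psi>p: "\<psi> p j = \<beta> j" "\<psi> q j = - \<alpha> j" "\<psi> j p = - \<beta> j" "\<psi> j q = \<alpha> j" if "j < p" for j
      using that q by (auto simp: \<psi>_def)
    have \<psi>q: "\<psi> p q = 1" "\<psi> q p = -1" "\<psi> p p = 0" "\<psi> q q = 0" using q by (auto simp: \<psi>_def)
    have ab': "\<alpha> a * \<beta> b = - monom c k" using k(1) by (simp add: \<alpha>_def \<beta>_def mult_monom)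
    have up: "\<alpha> i * \<beta> j - \<beta> i * \<alpha> j = (if i = a \<and> j = b then - monom c k else 0)" if "i < j" for i j
      using that a(1) ab' by (auto simp: \<alpha>_def \<beta>_def)
    have wt: "total_weight (2 * Suc r) \<psi> < total_weight (2 * r) \<phi>"
    proof -
      define s where "s = (\<Sum>j<p. \<Sum>i<j. weight (\<psi> i j))"
      have "total_weight (2 * Suc r) \<psi> = s + (\<Sum>i<p. weight (\<psi> i p)) + (\<Sum>i<q. weight (\<psi> i q))"
        unfolding total_weight_def q(3) s_def by (simp add: q(1))
      also have "(\<Sum>i<q. weight (\<psi> i q)) = 0"
        by (rule sum.neutral) (auto simp: q(1) less_Suc_eq \<psi>q[unfolded q(1)] \<psi>p[unfolded q(1)] \<alpha>_def weight_small degree_monom_le)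
      also have "(\<Sum>i<p. weight (\<psi> i p)) \<le> (\<Sum>i<p. if i = b then k - 2 else 0)"
      proof (rule sum_mono)
        fix i assume "i \<in> {..<p}"
        moreover have "weight (- monom c (k - 1)) \<le> k - 2"
          using weight_single[of "-c" "k-1"] by (simp add: minus_monom)
        ultimately show "weight (\<psi> i p) \<le> (if i = b then k - 2 else 0)"
          by (auto simp: \<psi>p \<beta>_def weight_small)
      qed
      also have "\<dots> = k - 2" using ab by simp
      finally have 1: "total_weight (2 * Suc r) \<psi> \<le> s + (k - 2)" by simp
      have "s + (k - 1) = (\<Sum>j<p. (\<Sum>i<j. weight (\<psi> i j)) + (if j = b then k - 1 else 0))"
        unfolding sum.distrib s_def using ab by simp
      also have "\<dots> = (\<Sum>j<p. \<Sum>i<j. weight (\<phi> i j))"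
      proof (rule sum.cong[OF refl])
        fix j assume j: "j \<in> {..<p}"
        have w: "weight (\<psi> i j) = weight (\<phi> i j)" if "i < j" "\<not> (i = a \<and> j = b)" for i
          using that j up[OF that(1)] by (subst \<psi>00) (auto simp: add_diff_eq[symmetric])
        show "(\<Sum>i<j. weight (\<psi> i j)) + (if j = b then k - 1 else 0) = (\<Sum>i<j. weight (\<phi> i j))"
        proof (cases "j = b")
          case True
          have "\<psi> a b = \<phi> a b - monom c k" using ab up[OF a(1)] by (subst \<psi>00) (auto simp: add_diff_eq[symmetric])
          then have "weight (\<psi> a b) + (k - 1) = weight (\<phi> a b)" using weight_remove[OF k] by (simp add: c_def)
          moreover have "(\<Sum>i\<in>{..<b} - {a}. weight (\<psi> i b)) = (\<Sum>i\<in>{..<b} - {a}. weight (\<phi> i b))"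
            using w True by (intro sum.cong) auto
          ultimately show ?thesis using a(1) True by (simp add: sum.remove[of "{..<b}" a])
        next
          case False
          then show ?thesis using w by (auto intro!: sum.cong)
        qed
      qed
      also have "\<dots> = total_weight (2*r) \<phi>" by (simp add: total_weight_def p_def)
      finally show ?thesis using 1 k(1) by linarith
    qed
    have c0': "coeff (\<psi> i j) 0 = Jm i j" if "i < 2 * Suc r" "j < 2 * Suc r" for i j
    proof -
      have ca: "coeff (\<alpha> i) 0 = 0" "coeff (\<beta> i) 0 = 0" for i using k(1) by (auto simp: \<alpha>_def \<beta>_def)
      have Jp: "Jm p j = (0::'a)" "Jm q j = (0::'a)" "Jm j p = (0::'a)" "Jm j q = (0::'a)" if "j < p" for j
        using that by (auto simp: Jm_def p_def q_def) presburger+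
      have Jq: "Jm p q = (1::'a)" "Jm q p = (-1::'a)" "Jm p p = (0::'a)" "Jm q q = (0::'a)"
        by (auto simp: Jm_def p_def q_def)
      show ?thesis
        using that unfolding lt_q
        by (elim disjE) (simp_all add: \<psi>00 \<psi>p \<psi>q Jp Jq ca coeff_mult_0 c0[folded p_def])
    qed
    have alt': "\<psi> j i = - \<psi> i j" if "i < 2 * Suc r" "j < 2 * Suc r" for i j
      using that unfolding lt_q
      by (elim disjE) (simp_all add: \<psi>00 \<psi>p \<psi>q alt[of i j, folded p_def] mult.commute)
    have sumq: "(\<Sum>t<2 * Suc r. f t) = (\<Sum>t<p. f t) + f p + f q" for f :: "nat \<Rightarrow> 'a poly"
      unfolding q(3) by (simp add: q(1))
    have surj': "\<exists>z. \<forall>i<2 * Suc r. (\<Sum>t<2 * Suc r. \<psi> i t * z t) - y i \<in> ext I" for y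
    proof -
      obtain z where z: "\<And>i. i < p \<Longrightarrow> (\<Sum>t<p. \<phi> i t * z t) - (y i - \<alpha> i * y p - \<beta> i * y q) \<in> ext I"
        using surj[of "\<lambda>i. y i - \<alpha> i * y p - \<beta> i * y q"] unfolding p_def by blast
      define A' where "A' = (\<Sum>t<p. \<alpha> t * z t)"
      define B' where "B' = (\<Sum>t<p. \<beta> t * z t)"
      define z' where "z' t = (if t < p then z t else if t = p then - y q - A' else y p - B')" for t
      have z': "z' p = - y q - A'" "z' q = y p - B'" "\<And>t. t < p \<Longrightarrow> z' t = z t" using q by (auto simp: z'_def)
      have "(\<Sum>t<2 * Suc r. \<psi> i t * z' t) - y i \<in> ext I" if "i < 2 * Suc r" for i
      proof -
        have "i < p \<or> i = p \<or> i = q" using that unfolding lt_q .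
        then consider "i < p" | "i = p" | "i = q" by (elim disjE)
        then show ?thesis
        proof cases
          case 1
          have "(\<Sum>t<p. \<psi> i t * z' t) = (\<Sum>t<p. \<phi> i t * z t) + \<alpha> i * B' - \<beta> i * A'"
            unfolding A'_def B'_def sum_distrib_left sum.distrib[symmetric] sum_subtractf[symmetric]
            by (rule sum.cong) (simp_all add: \<psi>00 1 z' algebra_simps)
          then have "(\<Sum>t<2 * Suc r. \<psi> i t * z' t) - y i = (\<Sum>t<p. \<phi> i t * z t) - (y i - \<alpha> i * y p - \<beta> i * y q)"
            unfolding sumq \<psi>p(3)[OF 1] \<psi>p(4)[OF 1] z'(1,2) by (simp add: algebra_simps)
          then show ?thesis using z[OF 1] by (simp only:)
        next
          case 2
          have "(\<Sum>t<p. \<psi> p t * z' t) = B'" unfolding B'_def by (rule sum.cong) (simp_all add: \<psi>p z')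
          then have "(\<Sum>t<2 * Suc r. \<psi> i t * z' t) - y i = 0" unfolding sumq 2 \<psi>q z' by simp
          then show ?thesis using ideal_zero[OF A] by (simp only:)
        next
          case 3
          have "(\<Sum>t<p. \<psi> q t * z' t) = - A'" unfolding A'_def sum_negf[symmetric] by (rule sum.cong) (simp_all add: \<psi>p z')
          then have "(\<Sum>t<2 * Suc r. \<psi> i t * z' t) - y i = 0" unfolding sumq 3 \<psi>q z' by simp
          then show ?thesis using ideal_zero[OF A] by (simp only:)
        qed
      qed
      then show ?thesis by blast
    qed
    obtain R S where R: "Suc r \<le> R" and S: "\<And>i j. i < 2*R \<Longrightarrow> j < 2*R \<Longrightarrow> sp R (S i) (S j) - dsum (Suc r) \<psi> i j \<in> ext I"
      using less.hyps[OF wt c0' alt' surj'] by blast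
    define D where "D = dsum (Suc r) \<psi>"
    have S': "sp R (S i) (S j) - D i j \<in> ext I" if "i < 2*R" "j < 2*R" for i j
      using S[OF that] by (simp add: D_def)
    define e where "e i = (if i < p then \<alpha> i else 0)" for i
    define f where "f i = (if i < p then \<beta> i else 0)" for i
    \<comment> \<open>The unipotent change of basis that splits off the plane spanned by \<open>p\<close> and \<open>q\<close>.\<close>
    define T where "T i = (\<lambda>t. S i t - (e i * S p t + f i * S q t))" for i
    have pR: "p < 2*R" "q < 2*R" using R by (auto simp: p_def q_def)
    have "sp R (T i) (T j) - dsum r \<phi> i j \<in> ext I" if ij: "i < 2*R" "j < 2*R" for i j
    proof -
      define G where "G x y = sp R (S x) (S y) - D x y" for x y
      have G: "G x y \<in> ext I" if "x < 2*R" "y < 2*R" for x y using S'[OF that] by (simp add: G_def)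
      have sp: "sp R (S x) (S y) = G x y + D x y" for x y by (simp add: G_def)
      have "sp R (T i) (T j) = sp R (S i) (S j) - e j * sp R (S i) (S p) - f j * sp R (S i) (S q)
          - e i * sp R (S p) (S j) - f i * sp R (S q) (S j)
          + e i * e j * sp R (S p) (S p) + e i * f j * sp R (S p) (S q)
          + f i * e j * sp R (S q) (S p) + f i * f j * sp R (S q) (S q)"
        unfolding T_def sp_diff sp_diff2 sp_add sp_add2 sp_scale sp_scale2 by (simp add: algebra_simps)
      also have "\<dots> = (G i j - e j * G i p - f j * G i q - e i * G p j - f i * G q j
          + e i * e j * G p p + e i * f j * G p q + f i * e j * G q p + f i * f j * G q q)
          + (D i j - e j * D i p - f j * D i q - e i * D p j - f i * D q j
          + e i * e j * D p p + e i * f j * D p q + f i * e j * D q p + f i * f j * D q q)"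
        unfolding sp by (simp add: algebra_simps)
      also have "(D i j - e j * D i p - f j * D i q - e i * D p j - f i * D q j
          + e i * e j * D p p + e i * f j * D p q + f i * e j * D q p + f i * f j * D q q) = dsum r \<phi> i j"
      proof -
        have Dl: "D x y = \<psi> x y" if "x < 2 * Suc r" "y < 2 * Suc r" for x y using that by (simp add: D_def dsum_def)
        have ltp: "p < 2 * Suc r" and ltq: "q < 2 * Suc r" by (rule lt_q[THEN iffD2], simp)+
        have ltx: "x < 2 * Suc r" if "x < p" for x using that unfolding lt_q by simp
        have Dq: "D p q = 1" "D q p = -1" "D p p = 0" "D q q = 0"
          using Dl[OF ltp ltq] Dl[OF ltq ltp] Dl[OF ltp ltp] Dl[OF ltq ltq] unfolding \<psi>q by this+
        have Dp: "D p x = \<beta> x" "D q x = - \<alpha> x" "D x p = - \<beta> x" "D x q = \<alpha> x" if "x < p" for x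
          using Dl[OF ltp ltx[OF that]] Dl[OF ltq ltx[OF that]] Dl[OF ltx[OF that] ltp] Dl[OF ltx[OF that] ltq]
          unfolding \<psi>p[OF that] by this+
        have Db: "D p x = 0" "D q x = 0" "D x p = 0" "D x q = 0" if "x > q" for x
          using that by (auto simp: D_def dsum_def p_def q_def)
        have cs: "x < p \<or> x = p \<or> x = q \<or> x > q" for x using q(1) by linarith
        have e0: "e p = 0" "e q = 0" "f p = 0" "f q = 0" "x > q \<Longrightarrow> e x = 0" "x > q \<Longrightarrow> f x = 0" for x
          using q(1) by (auto simp: e_def f_def)
        have pq0: "p \<noteq> q" "q \<noteq> p" using q(2) by auto
        have e1: "x < p \<Longrightarrow> e x = \<alpha> x" "x < p \<Longrightarrow> f x = \<beta> x" for x by (auto simp: e_def f_def)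
        show ?thesis
        proof (cases "i < p \<and> j < p")
          case True
          then have "D i j = \<phi> i j + \<alpha> i * \<beta> j - \<beta> i * \<alpha> j" "dsum r \<phi> i j = \<phi> i j"
            using Dl[OF ltx ltx, of i j] \<psi>00[of i j] by (simp_all add: dsum_def p_def)
          then show ?thesis using True by (simp add: Dq Dp e1 algebra_simps)
        next
          case False
          have dd: "dsum r \<phi> i j = (if i < p \<or> j < p then 0 else Jm i j)"
            using False by (auto simp: dsum_def p_def)
          have Dbig: "D i j = (if i < p \<or> j < p then 0 else Jm i j)" if "i > q \<or> j > q"
            using that by (auto simp: D_def dsum_def p_def q_def Jm_def) presburger+
          have Jq: "Jm p q = (1::'a poly)" "Jm q p = (-1::'a poly)" "Jm p p = (0::'a poly)" "Jm q q = (0::'a poly)"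
            by (auto simp: Jm_def p_def q_def)
          consider "i > q \<or> j > q" | "i = p \<or> i = q" "j = p \<or> j = q" | "i = p \<or> i = q" "j < p" | "i < p" "j = p \<or> j = q"
            using cs[of i] cs[of j] False by blast
          then show ?thesis
          proof cases
            case 1
            then show ?thesis
            proof
              assume i: "i > q"
              then show ?thesis unfolding dd Dbig[OF 1] e0(5)[OF i] e0(6)[OF i] Db(3)[OF i] Db(4)[OF i] by simp
            next
              assume j: "j > q"
              then show ?thesis unfolding dd Dbig[OF 1] e0(5)[OF j] e0(6)[OF j] Db(1)[OF j] Db(2)[OF j] by simp
            qed
          next
            case 2
            then show ?thesis unfolding dd by (elim disjE) (simp_all add: Dq Jq e0(1-4) q(2) less_not_sym[OF q(2)] pq0)
          next
            case 3
            then show ?thesis unfolding dd by (elim disjE) (simp_all add: Dq Dp e0 e1)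
          next
            case 4
            then show ?thesis unfolding dd by (elim disjE) (simp_all add: Dq Dp e0 e1)
          qed
        qed
      qed
      finally have "sp R (T i) (T j) - dsum r \<phi> i j = G i j - e j * G i p - f j * G i q - e i * G p j - f i * G q j
          + e i * e j * G p p + e i * f j * G p q + f i * e j * G q p + f i * f j * G q q" by simp
      also have "\<dots> \<in> ext I"
        using G[OF ij] G[OF ij(1) pR(1)] G[OF ij(1) pR(2)] G[OF pR(1) ij(2)] G[OF pR(2) ij(2)] G[OF pR(1) pR(1)] G[OF pR]
          G[OF pR(2) pR(1)] G[OF pR(2) pR(2)]
        by - (assumption | rule ideal_add[OF A] ideal_diff[OF A] ideal_mult[OF A])+
      finally show ?thesis .
    qed
    then show ?thesis using R by (intro exI[of _ R] conjI exI[of _ T]) auto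
  qed
qed

section \<open>Completable rows and elementary operations\<close>

definition dot :: "nat \<Rightarrow> (nat \<Rightarrow> 'r::comm_ring_1) \<Rightarrow> (nat \<Rightarrow> 'r) \<Rightarrow> 'r" where
  "dot n u p = (\<Sum>i<n. u i * p i)"

text \<open>
  Modulo \<open>A\<close>, the rows \<open>v\<close> and \<open>w\<close> have the right inverse with columns \<open>p\<close> and \<open>q\<close>.
\<close>
definition completable :: "nat \<Rightarrow> 'r::comm_ring_1 set \<Rightarrow> (nat \<Rightarrow> 'r) \<Rightarrow> bool" where
  "completable n A v \<longleftrightarrow> (\<exists>w p q. dot n v p - 1 \<in> A \<and> dot n v q \<in> A \<and> dot n w p \<in> A \<and> dot n w q - 1 \<in> A)"

text \<open>
  What is kept of an elementary equivalence: completions can be pulled back and unimodularity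
  modulo \<open>A\<close> is preserved.
\<close>
definition reduces :: "nat \<Rightarrow> 'r::comm_ring_1 set \<Rightarrow> (nat \<Rightarrow> 'r) \<Rightarrow> (nat \<Rightarrow> 'r) \<Rightarrow> bool" where
  "reduces n A v v' \<longleftrightarrow> (completable n A v' \<longrightarrow> completable n A v) \<and> v ` {..<n} \<subseteq> ideal_of (v' ` {..<n} \<union> A)"

definition unimod :: "nat \<Rightarrow> 'r::comm_ring_1 set \<Rightarrow> (nat \<Rightarrow> 'r) \<Rightarrow> bool" where
  "unimod n A v \<longleftrightarrow> 1 \<in> ideal_of (v ` {..<n} \<union> A)"

lemma dot_upd: "j < n \<Longrightarrow> dot n (u(j := x)) p = dot n u p + (x - u j) * p j"
proof -
  assume j: "j < n"
  have "dot n (u(j := x)) p = (\<Sum>i<n. u i * p i + (if i = j then (x - u j) * p j else 0))"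
    unfolding dot_def by (rule sum.cong) (auto simp: algebra_simps)
  then show ?thesis using j by (simp add: sum.distrib dot_def)
qed

lemma dot_commute: "dot n u p = dot n p u"
  by (simp add: dot_def mult.commute)

lemma dot_upd2: "j < n \<Longrightarrow> dot n u (p(j := x)) = dot n u p + u j * (x - p j)"
  unfolding dot_commute[of n u] by (simp add: dot_upd mult.commute)

lemma dot_step: "i < n \<Longrightarrow> j < n \<Longrightarrow> i \<noteq> j \<Longrightarrow>
    dot n (u(j := u j + c * u i)) p = dot n u (p(i := p i + c * p j))"
  by (simp add: dot_upd dot_upd2 algebra_simps)

lemma reduces_refl: "reduces n A v v"
  by (auto simp: reduces_def intro: ideal_of_base)

lemma reduces_ideal:
  assumes "reduces n A v v'" shows "ideal_of (v ` {..<n} \<union> A) \<subseteq> ideal_of (v' ` {..<n} \<union> A)"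
  by (rule ideal_of_least[OF ideal_of_ideal]) (use assms in \<open>auto simp: reduces_def intro: ideal_of_base\<close>)

lemma reduces_trans [trans]: "reduces n A v u \<Longrightarrow> reduces n A u w \<Longrightarrow> reduces n A v w"
  using reduces_ideal[of n A u w] unfolding reduces_def by blast

lemma reduces_unimod: "reduces n A v v' \<Longrightarrow> unimod n A v \<Longrightarrow> unimod n A v'"
  using reduces_ideal unfolding unimod_def by blast

lemma reduces_compl: "reduces n A v v' \<Longrightarrow> completable n A v' \<Longrightarrow> completable n A v" by (simp add: reduces_def)

lemma reduces_step:
  assumes ij: "i < n" "j < n" "i \<noteq> j"
  shows "reduces n A v (v(j := v j + c * v i))"
  unfolding reduces_def
proof (intro conjI impI)
  let ?v = "v(j := v j + c * v i)"
  assume "completable n A ?v"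
  then obtain w p q where h: "dot n ?v p - 1 \<in> A" "dot n ?v q \<in> A" "dot n w p \<in> A" "dot n w q - 1 \<in> A"
    unfolding completable_def by (elim exE conjE)
  define w' where "w' = w(j := w j - c * w i)"
  have w: "w = w'(j := w' j + c * w' i)" using ij by (auto simp: w'_def)
  show "completable n A v" unfolding completable_def
    by (rule exI[of _ w'], rule exI[of _ "p(i := p i + c * p j)"], rule exI[of _ "q(i := q i + c * q j)"])
       (use h dot_step[OF ij, of w' c] in \<open>simp add: dot_step[OF ij] w[symmetric]\<close>)
next
  let ?v = "v(j := v j + c * v i)"
  let ?J = "ideal_of (?v ` {..<n} \<union> A)"
  have J: "is_ideal ?J" by (rule ideal_of_ideal)
  have b: "?v k \<in> ?J" if "k < n" for k using that by (intro ideal_of_base) auto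
  have i: "v i \<in> ?J" using b[of i] ij by simp
  have "v k \<in> ?J" if k: "k < n" for k
  proof (cases "k = j")
    case True
    have "?v j - c * v i \<in> ?J" by (rule ideal_diff[OF J b[OF ij(2)] ideal_mult[OF J i]])
    then show ?thesis using True by simp
  qed (use b[OF k] in simp)
  then show "v ` {..<n} \<subseteq> ?J" by auto
qed

lemma reduces_mod:
  assumes A: "is_ideal A" and e: "\<And>i. i < n \<Longrightarrow> v' i - v i \<in> A"
  shows "reduces n A v v'"
  unfolding reduces_def
proof (intro conjI impI)
  have d: "dot n v' p - dot n v p \<in> A" for p
    unfolding dot_def sum_subtractf[symmetric] left_diff_distrib[symmetric]
    by (intro ideal_sum[OF A] ideal_mult2[OF A] e) simp
  assume "completable n A v'"
  then obtain w p q where h: "dot n v' p - 1 \<in> A" "dot n v' q \<in> A" "dot n w p \<in> A" "dot n w q - 1 \<in> A"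
    unfolding completable_def by (elim exE conjE)
  have "dot n v p - 1 \<in> A" using ideal_diff[OF A h(1) d[of p]] by (simp add: algebra_simps)
  moreover have "dot n v q \<in> A" using ideal_diff[OF A h(2) d[of q]] by simp
  ultimately show "completable n A v" using h(3,4) unfolding completable_def by blast
next
  let ?J = "ideal_of (v' ` {..<n} \<union> A)"
  have "v i \<in> ?J" if "i < n" for i
  proof -
    have "v' i \<in> ?J" "v' i - v i \<in> ?J" using that e by (auto intro: ideal_of_base)
    then have "v' i - (v' i - v i) \<in> ?J" by (rule ideal_diff[OF ideal_of_ideal])
    then show ?thesis by simp
  qed
  then show "v ` {..<n} \<subseteq> ?J" by auto
qed

lemma reduces_add_combination:
  assumes j: "j < n" and K: "K \<subseteq> {..<n} - {j}"
  shows "reduces n A v (v(j := v j + (\<Sum>i\<in>K. c i * v i)))"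
proof -
  have "finite K" using K finite_subset by blast
  then show ?thesis using K
  proof (induction K)
    case empty
    show ?case by (simp add: reduces_refl)
  next
    case (insert i K)
    let ?u = "v(j := v j + (\<Sum>i\<in>K. c i * v i))"
    have "reduces n A v ?u" using insert.IH insert.prems by blast
    moreover have "reduces n A ?u (?u(j := ?u j + c i * ?u i))" by (rule reduces_step) (use insert j in auto)
    moreover have "?u(j := ?u j + c i * ?u i) = v(j := v j + (\<Sum>i\<in>insert i K. c i * v i))"
      using insert by (auto simp: algebra_simps)
    ultimately show ?case using reduces_trans by metis
  qed
qed

lemma reduces_add_ideal:
  assumes A: "is_ideal A" and j: "j < n" and x: "x \<in> ideal_of (v ` ({..<n} - {j}) \<union> A)"
  shows "reduces n A v (v(j := v j + x))"
proof -
  obtain c where c: "x - (\<Sum>i\<in>{..<n} - {j}. c i * v i) \<in> A"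
    using ideal_of_image[OF A, of "{..<n} - {j}" x v] x by auto
  have "reduces n A v (v(j := v j + (\<Sum>i\<in>{..<n} - {j}. c i * v i)))"
    by (rule reduces_add_combination[OF j]) simp
  moreover have "reduces n A (v(j := v j + (\<Sum>i\<in>{..<n} - {j}. c i * v i))) (v(j := v j + x))"
    by (rule reduces_mod[OF A]) (use c ideal_zero[OF A] in auto)
  ultimately show ?thesis by (rule reduces_trans)
qed

lemma reduces_add_multiples:
  assumes i: "i < n" "i \<notin> K" and K: "finite K" "K \<subseteq> {..<n}"
  shows "reduces n A v (\<lambda>k. if k \<in> K then v k + t k * v i else v k)"
  using K(1) K(2) i(2)
proof (induction K)
  case empty
  show ?case by (simp add: reduces_refl)
next
  case (insert j K)
  let ?u = "\<lambda>k. if k \<in> K then v k + t k * v i else v k"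
  have 1: "reduces n A v ?u" using insert by simp
  have 2: "reduces n A ?u (?u(j := ?u j + t j * ?u i))" by (rule reduces_step) (use insert i in auto)
  have 3: "?u(j := ?u j + t j * ?u i) = (\<lambda>k. if k \<in> insert j K then v k + t k * v i else v k)"
  proof (rule ext)
    fix x
    have "i \<noteq> j" "i \<notin> K" "j \<notin> K" using insert.prems(2) insert.hyps(2) by blast+
    then show "(?u(j := ?u j + t j * ?u i)) x = (if x \<in> insert j K then v x + t x * v i else v x)"
      by (cases "x = j") simp_all
  qed
  show ?case using reduces_trans[OF 1 2] unfolding 3 .
qed

lemma reduces_swap:
  assumes ij: "i < n" "j < n" "i \<noteq> j"
  shows "reduces n A v (v(i := v j, j := - v i))"
proof -
  let ?a = "v(i := v i + 1 * v j)"
  let ?b = "?a(j := ?a j + (-1) * ?a i)"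
  let ?c = "?b(i := ?b i + 1 * ?b j)"
  have "reduces n A v ?a" "reduces n A ?a ?b" "reduces n A ?b ?c" using ij by (intro reduces_step; simp)+
  moreover have "?c = v(i := v j, j := - v i)" using ij by auto
  ultimately show ?thesis using reduces_trans by metis
qed

lemma completable_e0:
  assumes A: "is_ideal A" and n: "2 \<le> n" and b: "b 0 - 1 \<in> A" "\<And>k. 0 < k \<Longrightarrow> k < n \<Longrightarrow> b k \<in> A"
  shows "completable n A b"
proof -
  have d: "dot n u (\<lambda>i. if i = k then 1 else 0) = u k" if "k < n" for u :: "nat \<Rightarrow> 'a" and k
    using that unfolding dot_def by (simp add: if_distrib cong: if_cong)
  show ?thesis unfolding completable_def
    by (rule exI[of _ "\<lambda>i. if i = 1 then 1 else 0"], rule exI[of _ "\<lambda>i. if i = 0 then 1 else 0"],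
        rule exI[of _ "\<lambda>i. if i = 1 then 1 else 0"])
       (use n b d[of 0] d[of 1] ideal_zero[OF A] in simp)
qed

text \<open>
  Given a combination of minors equal to \<open>1\<close>, applying the alternating matrix of its coefficients
  to \<open>w\<close> and \<open>v\<close> yields the two columns of a right inverse, because \<open>w\<close> and \<open>v\<close> are isotropic for it.
\<close>
lemma completable_minors:
  assumes A: "is_ideal A"
  shows "completable n A v \<longleftrightarrow> (\<exists>w c. (\<Sum>i<n. \<Sum>j<n. c i j * (v i * w j - v j * w i)) - 1 \<in> A)"
proof
  assume "completable n A v"
  then obtain w p q where h: "dot n v p - 1 \<in> A" "dot n v q \<in> A" "dot n w p \<in> A" "dot n w q - 1 \<in> A"
    unfolding completable_def by (elim exE conjE)
  have "(\<Sum>i<n. \<Sum>j<n. (p i * q j) * (v i * w j - v j * w i))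
      = (\<Sum>i<n. \<Sum>j<n. (v i * p i) * (w j * q j)) - (\<Sum>i<n. \<Sum>j<n. (w i * p i) * (v j * q j))"
    unfolding sum_subtractf[symmetric] by (intro sum.cong refl) (simp add: algebra_simps)
  also have "\<dots> = dot n v p * dot n w q - dot n w p * dot n v q"
    unfolding dot_def sum_product ..
  finally have "(\<Sum>i<n. \<Sum>j<n. (p i * q j) * (v i * w j - v j * w i)) - 1
     = (dot n v p - 1) * dot n w q + (dot n w q - 1) - dot n v q * dot n w p" by (simp add: algebra_simps)
  also have "\<dots> \<in> A" by (rule ideal_diff[OF A ideal_add[OF A ideal_mult2[OF A h(1)] h(4)] ideal_mult2[OF A h(2)]])
  finally show "\<exists>w c. (\<Sum>i<n. \<Sum>j<n. c i j * (v i * w j - v j * w i)) - 1 \<in> A"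
    by (intro exI[of _ w] exI[of _ "\<lambda>i j. p i * q j"])
next
  assume "\<exists>w c. (\<Sum>i<n. \<Sum>j<n. c i j * (v i * w j - v j * w i)) - 1 \<in> A"
  then obtain w c where h: "(\<Sum>i<n. \<Sum>j<n. c i j * (v i * w j - v j * w i)) - 1 \<in> A" by (elim exE)
  define p where "p i = (\<Sum>j<n. (c i j - c j i) * w j)" for i
  define q where "q i = (\<Sum>j<n. (c j i - c i j) * v j)" for i
  have sw: "(\<Sum>i<n. \<Sum>j<n. f j i) = (\<Sum>i<n. \<Sum>j<n. f i j)" for f :: "nat \<Rightarrow> nat \<Rightarrow> 'a" by (rule sum.swap)
  have vp: "dot n u p = (\<Sum>i<n. \<Sum>j<n. c i j * (u i * w j - u j * w i))" for u
  proof -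
    have "dot n u p = (\<Sum>i<n. \<Sum>j<n. c i j * (u i * w j)) - (\<Sum>i<n. \<Sum>j<n. c j i * (u i * w j))"
      unfolding dot_def p_def sum_distrib_left sum_subtractf[symmetric] by (intro sum.cong refl) (simp add: algebra_simps)
    also have "(\<Sum>i<n. \<Sum>j<n. c j i * (u i * w j)) = (\<Sum>i<n. \<Sum>j<n. c i j * (u j * w i))" by (rule sw)
    finally show ?thesis by (simp add: sum_subtractf[symmetric] algebra_simps)
  qed
  have wq: "dot n u q = (\<Sum>i<n. \<Sum>j<n. c i j * (v i * u j - v j * u i))" for u
  proof -
    have "dot n u q = (\<Sum>i<n. \<Sum>j<n. c j i * (v j * u i)) - (\<Sum>i<n. \<Sum>j<n. c i j * (v j * u i))"
      unfolding dot_def q_def sum_distrib_left sum_subtractf[symmetric] by (intro sum.cong refl) (simp add: algebra_simps)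
    also have "(\<Sum>i<n. \<Sum>j<n. c j i * (v j * u i)) = (\<Sum>i<n. \<Sum>j<n. c i j * (v i * u j))" by (rule sw)
    finally show ?thesis by (simp add: sum_subtractf[symmetric] algebra_simps)
  qed
  have "dot n w p = 0" "dot n v q = 0" unfolding vp wq by (simp_all add: mult.commute)
  then show "completable n A v" unfolding completable_def
    by (intro exI[of _ w] exI[of _ p] exI[of _ q]) (use h vp[of v] wq[of w] ideal_zero[OF A] in simp)
qed

text \<open>
  The form \<open>J\<close> pairs the row with the row of coefficients of a unimodularity relation.
\<close>
lemma completable_even:
  assumes A: "is_ideal A" and n: "even n" and u: "unimod n A v"
  shows "completable n A v"
proof -
  obtain r where r: "n = 2 * r" using n by blast
  obtain c where c: "1 - (\<Sum>i<n. c i * v i) \<in> A"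
    using ideal_of_image[OF A, of "{..<n}" 1 v] u unfolding unimod_def by auto
  define w where "w i = (if even i then - c (i+1) else c (i-1))" for i
  define a where "a i j = (if even i \<and> j = i + 1 then 1 else 0 :: 'a)" for i j :: nat
  have "(\<Sum>i<n. \<Sum>j<n. a i j * (v i * w j - v j * w i)) = (\<Sum>i<n. if even i then c i * v i + c (i+1) * v (i+1) else 0)"
  proof (rule sum.cong[OF refl])
    fix i assume i: "i \<in> {..<n}"
    have "(\<Sum>j<n. a i j * (v i * w j - v j * w i)) = (\<Sum>j<n. if j = i+1 then (if even i then c i * v i + c (i+1) * v (i+1) else 0) else 0)"
      by (rule sum.cong) (auto simp: a_def w_def algebra_simps)
    also have "\<dots> = (if even i then c i * v i + c (i+1) * v (i+1) else 0)"
    proof (cases "even i")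
      case True
      then have "i + 1 < n" using i n by (metis Suc_eq_plus1 Suc_lessI even_Suc lessThan_iff)
      then show ?thesis by simp
    qed simp
    finally show "(\<Sum>j<n. a i j * (v i * w j - v j * w i)) = (if even i then c i * v i + c (i+1) * v (i+1) else 0)" .
  qed
  also have "\<dots> = (\<Sum>i<n. c i * v i)" unfolding r sum_pairs by simp
  finally have "(\<Sum>i<n. \<Sum>j<n. a i j * (v i * w j - v j * w i)) - 1 \<in> A"
    using ideal_uminus[OF A c] by simp
  then show ?thesis unfolding completable_minors[OF A] by blast
qed

lemma reduces_pair_mod:
  assumes A: "is_ideal A" and jk: "j < n" "k < n" "j \<noteq> k"
    and y: "y' - y \<in> ideal_of (v ` ({..<n} - {j,k}) \<union> A)" and z: "z' - z \<in> ideal_of (v ` ({..<n} - {j,k}) \<union> A)"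
  shows "reduces n A (v(j := y, k := z)) (v(j := y', k := z'))"
proof -
  have sub: "ideal_of (v ` ({..<n} - {j,k}) \<union> A) \<subseteq> ideal_of ((v(j := a, k := b)) ` ({..<n} - {l}) \<union> A)"
    if "l = j \<or> l = k" for a b l
  proof (rule ideal_of_mono)
    have "v i \<in> (v(j := a, k := b)) ` ({..<n} - {l})" if "i \<in> {..<n} - {j,k}" for i
      using that \<open>l = j \<or> l = k\<close> by (intro image_eqI[of _ _ i]) auto
    then show "v ` ({..<n} - {j,k}) \<union> A \<subseteq> (v(j := a, k := b)) ` ({..<n} - {l}) \<union> A" by auto
  qed
  let ?u = "v(j := y, k := z)" and ?w = "v(j := y', k := z)"
  have "reduces n A ?u (?u(j := ?u j + (y' - y)))"
    by (rule reduces_add_ideal[OF A jk(1)]) (use sub[of j] y in auto)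
  moreover have "?u(j := ?u j + (y' - y)) = ?w" using jk by auto
  moreover have "reduces n A ?w (?w(k := ?w k + (z' - z)))"
    by (rule reduces_add_ideal[OF A jk(2)]) (use sub[of k] z in auto)
  moreover have "?w(k := ?w k + (z' - z)) = v(j := y', k := z')" using jk by auto
  ultimately show ?thesis using reduces_trans by metis
qed

text \<open>
  The rank one transvection \<open>y \<mapsto> y + a (y \<bullet> P) q\<close> of a pair of entries, with \<open>q \<bullet> P = 0\<close>, is the
  commutator of adding \<open>y \<bullet> P\<close> to a third entry \<open>i\<close> and adding multiples of that entry back.
\<close>
lemma reduces_transvection:
  assumes i: "i < n" "j < n" "k < n" "i \<noteq> j" "i \<noteq> k" "j \<noteq> k" and pq: "P1 * q1 + P2 * q2 = (0::'r::comm_ring_1)"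
  shows "reduces n A (v(j := y, k := z)) (v(j := y + a * (y * P1 + z * P2) * q1, k := z + a * (y * P1 + z * P2) * q2))"
proof -
  define s where "s = y * P1 + z * P2"
  define x where "x = v i"
  define st where "st U Y Z = v(i := U, j := Y, k := Z)" for U Y Z
  have st_upd: "(st U Y Z)(i := U') = st U' Y Z" "(st U Y Z)(j := Y') = st U Y' Z" "(st U Y Z)(k := Z') = st U Y Z'"
    "st U Y Z i = U" "st U Y Z j = Y" "st U Y Z k = Z" for U Y Z U' Y' Z'
    using i by (auto simp: st_def)
  have R: "reduces n A (st U Y Z) (st (U + c * Y) Y Z)" "reduces n A (st U Y Z) (st (U + c * Z) Y Z)"
    "reduces n A (st U Y Z) (st U (Y + c * U) Z)" "reduces n A (st U Y Z) (st U Y (Z + c * U))" for U Y Z c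
    using reduces_step[of j n i A "st U Y Z" c] reduces_step[of k n i A "st U Y Z" c] reduces_step[of i n j A "st U Y Z" c]
      reduces_step[of i n k A "st U Y Z" c] i by (simp_all add: st_upd)
  have addx: "reduces n A (st U Y Z) (st (U + c * (Y * P1 + Z * P2)) Y Z)" for U Y Z c
  proof -
    have "reduces n A (st U Y Z) (st (U + (c * P1) * Y + (c * P2) * Z) Y Z)" using R(1,2) reduces_trans by blast
    then show ?thesis by (simp add: algebra_simps)
  qed
  have addu: "reduces n A (st U Y Z) (st U (Y + c * U * q1) (Z + c * U * q2))" for U Y Z c
  proof -
    have "reduces n A (st U Y Z) (st U (Y + (c * q1) * U) (Z + (c * q2) * U))" using R(3,4) reduces_trans by blast
    then show ?thesis by (simp add: algebra_simps)
  qed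
  \<comment> \<open>The entry \<open>i\<close> after receiving \<open>s\<close>, and the pair after multiples of it have been added.\<close>
  define U1 Y1 Z1 where "U1 = x + 1 * s" and "Y1 = y + a * U1 * q1" and "Z1 = z + a * U1 * q2"
  have "Y1 * P1 + Z1 * P2 = s + a * U1 * (P1 * q1 + P2 * q2)" by (simp add: Y1_def Z1_def s_def algebra_simps)
  then have s1: "Y1 * P1 + Z1 * P2 = s" using pq by simp
  have "reduces n A (st x y z) (st U1 y z)" unfolding U1_def s_def by (rule addx)
  also have "reduces n A (st U1 y z) (st U1 Y1 Z1)" unfolding Y1_def Z1_def by (rule addu)
  also have "reduces n A (st U1 Y1 Z1) (st (U1 + (-1) * (Y1 * P1 + Z1 * P2)) Y1 Z1)" by (rule addx)
  also have "U1 + (-1) * (Y1 * P1 + Z1 * P2) = x" unfolding s1 by (simp add: U1_def)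
  also have "reduces n A (st x Y1 Z1) (st x (Y1 + (-a) * x * q1) (Z1 + (-a) * x * q2))" by (rule addu)
  also have "Y1 + (-a) * x * q1 = y + a * s * q1" by (simp add: Y1_def U1_def algebra_simps)
  also have "Z1 + (-a) * x * q2 = z + a * s * q2" by (simp add: Z1_def U1_def algebra_simps)
  finally have "reduces n A (st x y z) (st x (y + a * s * q1) (z + a * s * q2))" .
  moreover have "st x Y Z = v(j := Y, k := Z)" for Y Z unfolding st_def x_def fun_upd_triv ..
  ultimately show ?thesis by (simp only: s_def)
qed

text \<open>
  If \<open>t\<close> is a unit modulo the entry \<open>i\<close>, then two further entries may be multiplied by \<open>t\<close> at the same
  time.  Let \<open>f = (y, z)\<close> be these entries and \<open>g = (y', z')\<close> their coefficients in a unimodularity relation,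
  so that \<open>f \<bullet> g = 1\<close> modulo the remaining entries.  With \<open>n = (-z', y')\<close>, three
  transvections give \<open>f \<mapsto> f + n \<mapsto> t f + n \<mapsto> t f\<close>.
\<close>
lemma reduces_pair_scale:
  fixes v :: "nat \<Rightarrow> 'r::comm_ring_1"
  assumes A: "is_ideal A" and i: "i < n" "j < n" "k < n" "i \<noteq> j" "i \<noteq> k" "j \<noteq> k"
    and t: "t * t' - 1 \<in> ideal_of (insert (v i) A)" and u: "unimod n A v"
  shows "reduces n A v (v(j := t * v j, k := t * v k))"
proof -
  define H where "H = ideal_of (v ` ({..<n} - {j,k}) \<union> A)"
  have H: "is_ideal H" by (simp add: H_def ideal_of_ideal)
  define y z where "y = v j" and "z = v k"
  obtain c where c: "1 - (\<Sum>l<n. c l * v l) \<in> A"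
    using ideal_of_image[OF A, of "{..<n}" 1 v] u unfolding unimod_def by auto
  define y' z' where "y' = c j" and "z' = c k"
  have "{..<n} = insert j (insert k ({..<n} - {j,k}))" using i by auto
  then have "(\<Sum>l<n. c l * v l) = (\<Sum>l\<in>insert j (insert k ({..<n} - {j,k})). c l * v l)" by (rule arg_cong)
  also have "\<dots> = c j * v j + (c k * v k + (\<Sum>l\<in>{..<n} - {j,k}. c l * v l))" using i(6) by simp
  finally have e: "1 - (y * y' + z * z') = (1 - (\<Sum>l<n. c l * v l)) + (\<Sum>l\<in>{..<n} - {j,k}. c l * v l)"
    by (simp add: y_def z_def y'_def z'_def algebra_simps)
  define g where "g = y * y' + z * z'"
  have g: "1 - g \<in> H" unfolding g_def e
    by (intro ideal_add[OF H] ideal_sum[OF H] ideal_mult[OF H]) (use c in \<open>auto simp: H_def intro: ideal_of_base\<close>)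
  have "insert (v i) A \<subseteq> v ` ({..<n} - {j,k}) \<union> A" using i by auto
  then have tH: "t * t' - 1 \<in> H" using t ideal_of_mono unfolding H_def by blast
  have md: "reduces n A (v(j := a, k := b)) (v(j := a', k := b'))" if "a' - a \<in> H" "b' - b \<in> H" for a b a' b'
    using reduces_pair_mod[OF A i(2,3,6)] that unfolding H_def by blast
  have tv: "reduces n A (v(j := a, k := b)) (v(j := a + s * (a * P1 + b * P2) * q1, k := b + s * (a * P1 + b * P2) * q2))"
    if "P1 * q1 + P2 * q2 = 0" for a b s P1 P2 q1 q2
    using reduces_transvection[OF i that] .
  have "reduces n A (v(j := y, k := z)) (v(j := y + 1 * (y * y' + z * z') * (- z'), k := z + 1 * (y * y' + z * z') * y'))"
    by (rule tv) (simp add: mult.commute)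
  also have "reduces n A \<dots> (v(j := y - z', k := z + y'))"
  proof (rule md)
    have "y - z' - (y + 1 * (y * y' + z * z') * (- z')) = - z' * (1 - g)" by (simp add: g_def algebra_simps)
    then show "y - z' - (y + 1 * (y * y' + z * z') * (- z')) \<in> H" using ideal_mult[OF H g] by metis
    have "z + y' - (z + 1 * (y * y' + z * z') * y') = y' * (1 - g)" by (simp add: g_def algebra_simps)
    then show "z + y' - (z + 1 * (y * y' + z * z') * y') \<in> H" using ideal_mult[OF H g] by metis
  qed
  also have "reduces n A (v(j := y - z', k := z + y'))
     (v(j := y - z' + (t - 1) * ((y - z') * (- z) + (z + y') * y) * y, k := z + y' + (t - 1) * ((y - z') * (- z) + (z + y') * y) * z))"
    by (rule tv) (simp add: mult.commute)
  also have "reduces n A \<dots> (v(j := t * y - z', k := t * z + y'))"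
  proof (rule md)
    have s: "(y - z') * (- z) + (z + y') * y = g" by (simp add: g_def algebra_simps)
    have "t * y - z' - (y - z' + (t - 1) * g * y) = (t - 1) * y * (1 - g)" by (simp add: algebra_simps)
    then show "t * y - z' - (y - z' + (t - 1) * ((y - z') * (- z) + (z + y') * y) * y) \<in> H"
      unfolding s using ideal_mult[OF H g] by metis
    have "t * z + y' - (z + y' + (t - 1) * g * z) = (t - 1) * z * (1 - g)" by (simp add: algebra_simps)
    then show "t * z + y' - (z + y' + (t - 1) * ((y - z') * (- z) + (z + y') * y) * z) \<in> H"
      unfolding s using ideal_mult[OF H g] by metis
  qed
  also have "reduces n A (v(j := t * y - z', k := t * z + y'))
     (v(j := t * y - z' + (- t') * ((t * y - z') * y' + (t * z + y') * z') * (- z'),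
        k := t * z + y' + (- t') * ((t * y - z') * y' + (t * z + y') * z') * y'))"
    by (rule tv) (simp add: mult.commute)
  also have "reduces n A \<dots> (v(j := t * y, k := t * z))"
  proof (rule md)
    have s: "(t * y - z') * y' + (t * z + y') * z' = t * g" by (simp add: g_def algebra_simps)
    have m: "1 - t * t' * g \<in> H"
      using ideal_diff[OF H g ideal_mult2[OF H tH, of g]] by (simp add: algebra_simps)
    have "t * y - (t * y - z' + (- t') * (t * g) * (- z')) = z' * (1 - t * t' * g)" by (simp add: algebra_simps)
    then show "t * y - (t * y - z' + (- t') * ((t * y - z') * y' + (t * z + y') * z') * (- z')) \<in> H"
      unfolding s using ideal_mult[OF H m] by metis
    have "t * z - (t * z + y' + (- t') * (t * g) * y') = - y' * (1 - t * t' * g)" by (simp add: algebra_simps)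
    then show "t * z - (t * z + y' + (- t') * ((t * y - z') * y' + (t * z + y') * z') * y') \<in> H"
      unfolding s using ideal_mult[OF H m] by metis
  qed
  finally show ?thesis by (simp add: y_def z_def)
qed

text \<open>
  Equivalence by operations that do not depend on the ideal; the anchor entry is produced modulo a larger ideal than
  the one for which the completion is sought.
\<close>
definition simE :: "nat \<Rightarrow> (nat \<Rightarrow> 'r::comm_ring_1) \<Rightarrow> (nat \<Rightarrow> 'r) \<Rightarrow> bool" where
  "simE n a b \<longleftrightarrow> (\<forall>A. is_ideal A \<longrightarrow> reduces n A a b)"

lemma simE_trans: "simE n a b \<Longrightarrow> simE n b c \<Longrightarrow> simE n a c"
proof -
  assume h: "simE n a b" "simE n b c"
  have "reduces n A a c" if A: "is_ideal A" for A
    by (rule reduces_trans[OF h(1)[unfolded simE_def, rule_format, OF A] h(2)[unfolded simE_def, rule_format, OF A]])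
  then show ?thesis by (simp add: simE_def)
qed

lemma simE_gen:
  assumes "simE n a b" shows "a ` {..<n} \<subseteq> ideal_of (b ` {..<n})"
proof -
  have z: "is_ideal {0}" by (simp add: is_ideal_def)
  then have "a ` {..<n} \<subseteq> ideal_of (b ` {..<n} \<union> {0})" using assms unfolding simE_def reduces_def by blast
  also have "\<dots> \<subseteq> ideal_of (b ` {..<n})"
    by (rule ideal_of_least[OF ideal_of_ideal]) (auto intro: ideal_of_base ideal_of.zero)
  finally show ?thesis .
qed

lemma simE_to_e0:
  fixes a :: "nat \<Rightarrow> 'r::comm_ring_1"
  assumes n: "2 \<le> n" and A: "is_ideal A" and c: "(\<Sum>i\<in>{..<n} - {1}. c i * a i) - 1 \<in> A"
  shows "\<exists>b. simE n a b \<and> b 0 - 1 \<in> A \<and> (\<forall>k. 0 < k \<longrightarrow> k < n \<longrightarrow> b k \<in> A)"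
proof -
  define b where "b = a(1 := a 1 + (\<Sum>i\<in>{..<n} - {1}. ((1 - a 1) * c i) * a i))"
  define d where "d = (\<lambda>k. if k \<in> {..<n} - {1} then b k + ((if k = 0 then 1 else 0) - b k) * b 1 else b k)"
  define e where "e = d(1 := d 1 + (-1) * d 0)"
  have "simE n a b" unfolding simE_def b_def using n by (auto intro: reduces_add_combination)
  moreover have "simE n b d" unfolding simE_def d_def
    by (intro allI impI reduces_add_multiples) (use n in auto)
  moreover have "simE n d e" unfolding simE_def e_def by (intro allI impI reduces_step) (use n in auto)
  ultimately have "simE n a e" using simE_trans by metis
  have "b 1 - 1 = (1 - a 1) * ((\<Sum>i\<in>{..<n} - {1}. c i * a i) - 1)"
    by (simp add: b_def algebra_simps sum_distrib_left)
  then have b1: "b 1 - 1 \<in> A" using ideal_mult[OF A c] by simp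
  have "d 0 - 1 = (1 - b 0) * (b 1 - 1)" using n by (simp add: d_def algebra_simps)
  then have d0: "d 0 - 1 \<in> A" using ideal_mult[OF A b1] by metis
  have ek: "e k \<in> A" if "0 < k" "k < n" for k
  proof (cases "k = 1")
    case True
    have "e 1 = (b 1 - 1) - (d 0 - 1)" by (simp add: e_def d_def)
    then show ?thesis using ideal_diff[OF A b1 d0] True by simp
  next
    case False
    then have "e k = (- b k) * (b 1 - 1)" using that by (simp add: e_def d_def algebra_simps)
    then show ?thesis using ideal_mult[OF A b1] by metis
  qed
  moreover have "e 0 - 1 \<in> A" using d0 by (simp add: e_def)
  ultimately show ?thesis using \<open>simE n a e\<close> by (intro exI[of _ e] conjI allI impI)
qed

lemma (in local_noeth) elementary_to_e0:
  fixes a :: "nat \<Rightarrow> 'a poly"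
  assumes n: "3 \<le> n" and I: "is_ideal I" "dim_le I (n - 2)" and u: "unimod n (ext I) a"
  shows "\<exists>b. simE n a b \<and> b 0 - 1 \<in> ext I \<and> (\<forall>k. 0 < k \<longrightarrow> k < n \<longrightarrow> b k \<in> ext I)"
proof -
  have n2: "2 \<le> n" using n by simp
  have H1: "\<exists>b. simE n a b \<and> (\<forall>k. 2 \<le> k \<longrightarrow> k < n \<longrightarrow> b k = a k + t k * a 1)
              \<and> b 0 - (a 0 + t 0 * a 1) \<in> ideal_of (b ` {2..<n})" for a t :: "nat \<Rightarrow> 'a poly"
  proof (rule exI[of _ "\<lambda>k. if k \<in> {..<n} - {1} then a k + t k * a 1 else a k"], intro conjI)
    show "simE n a (\<lambda>k. if k \<in> {..<n} - {1} then a k + t k * a 1 else a k)"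
      unfolding simE_def by (intro allI impI reduces_add_multiples) (use n in auto)
    show "\<forall>k\<ge>2. k < n \<longrightarrow> (if k \<in> {..<n} - {1} then a k + t k * a 1 else a k) = a k + t k * a 1" by simp
  qed (use n in \<open>simp add: ideal_of.zero\<close>)
  show "\<exists>b. simE n a b \<and> b 0 - 1 \<in> ext I \<and> (\<forall>k. 0 < k \<longrightarrow> k < n \<longrightarrow> b k \<in> ext I)"
  proof (rule reduce_to_e0[where n = n and sim = "simE n" and I = I])
    show "is_ideal I" "dim_le I (n-2)" "1 \<in> ideal_of (a ` {..<n} \<union> ext I)" "3 \<le> n"
      using I u n by (auto simp: unimod_def)
    show "\<exists>b. simE n a b \<and> (\<forall>k. 2 \<le> k \<longrightarrow> k < n \<longrightarrow> b k = a k + t k * a 1)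
              \<and> b 0 - (a 0 + t 0 * a 1) \<in> ideal_of (b ` {2..<n})" for a t :: "nat \<Rightarrow> 'a poly" by (rule H1)
    show "simE n a c" if "simE n a b" "simE n b c" for a b c :: "nat \<Rightarrow> 'a poly"
      using that by (rule simE_trans)
    show "a ` {..<n} \<subseteq> ideal_of (b ` {..<n})" if "simE n a b" for a b :: "nat \<Rightarrow> 'a poly"
      by (rule simE_gen[OF that])
  qed (rule simE_to_e0[OF n2])
qed

section \<open>Rows of length three\<close>

text \<open>
  Vaserstein's alternating matrix; its Pfaffian is \<open>\<Sum>x\<^sub>i u\<^sub>i\<close>.
\<close>
definition vas :: "(nat \<Rightarrow> 'r::comm_ring_1) \<Rightarrow> (nat \<Rightarrow> 'r) \<Rightarrow> nat \<Rightarrow> nat \<Rightarrow> 'r" where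
  "vas x u i j =
     (if i = 0 then if j = 1 then x 0 else if j = 2 then x 1 else if j = 3 then x 2 else 0
      else if i = 1 then if j = 0 then - x 0 else if j = 2 then u 2 else if j = 3 then - u 1 else 0
      else if i = 2 then if j = 0 then - x 1 else if j = 1 then - u 2 else if j = 3 then u 0 else 0
      else if j = 0 then - x 2 else if j = 1 then u 1 else if j = 2 then - u 0 else 0)"

lemma sum4: "(\<Sum>t<4. f t) = f 0 + f 1 + f 2 + f (3::nat)" for f :: "nat \<Rightarrow> 'r::comm_ring_1"
  by (simp add: eval_nat_numeral)

lemma sum3: "(\<Sum>t<3. f t) = f 0 + f 1 + f (2::nat)" for f :: "nat \<Rightarrow> 'r::comm_ring_1"
  by (simp add: eval_nat_numeral)

lemma dot3: "dot 3 x u = x 0 * u 0 + x 1 * u 1 + x 2 * u 2"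
  by (simp add: dot_def eval_nat_numeral)

lemma less4: "i < 4 \<longleftrightarrow> i = 0 \<or> i = 1 \<or> i = 2 \<or> i = (3::nat)" by auto

lemma vas_alt: "i < 4 \<Longrightarrow> j < 4 \<Longrightarrow> vas x u j i = - vas x u i j"
  unfolding less4 by (elim disjE) (simp_all add: vas_def)

text \<open>
  Exchanging the roles of \<open>x\<close> and \<open>u\<close> gives the inverse up to sign and the factor \<open>\<Sum>x\<^sub>i u\<^sub>i\<close>.
\<close>
lemma vas_inverse:
  assumes "i < 4"
  shows "(\<Sum>t<4. vas x u i t * (- (\<Sum>s<4. vas u x t s * y s))) = dot 3 x u * y i"
  using assms unfolding less4 by (elim disjE) (simp_all add: sum4 vas_def dot3 algebra_simps)

lemma (in local_noeth) completable_normalized_three: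
  fixes x u :: "nat \<Rightarrow> 'a poly"
  assumes h: "h + h = (1::'a)" and I: "is_ideal I" "dim_le I 2"
    and xu: "dot 3 x u - 1 \<in> ext I"
    and cx: "\<And>i. i < 3 \<Longrightarrow> coeff (x i) 0 = (if i = 0 then 1 else 0)"
    and cu: "\<And>i. i < 3 \<Longrightarrow> coeff (u i) 0 = (if i = 0 then 1 else 0)"
  shows "completable 3 (ext I) x"
proof -
  have A: "is_ideal (ext I)" by (rule ext_ideal[OF I(1)])
  have c0: "coeff (vas x u i j) 0 = Jm i j" if "i < 2*2" "j < 2*2" for i j
  proof -
    have "i < 4" "j < 4" using that by auto
    then show ?thesis unfolding less4 by (elim disjE) (simp_all add: vas_def cx cu Jm_def)
  qed
  have al: "vas x u j i = - vas x u i j" if "i < 2*2" "j < 2*2" for i j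
    using vas_alt[of i j x u] that by simp
  have surj: "\<exists>z. \<forall>i<2*2. (\<Sum>t<2*2. vas x u i t * z t) - y i \<in> ext I" for y
  proof (rule exI[of _ "\<lambda>t. - (\<Sum>s<4. vas u x t s * y s)"], intro allI impI)
    fix i :: nat assume i: "i < 2*2"
    have n22: "2*2 = (4::nat)" by simp
    have i4: "i < 4" using i by simp
    have "(\<Sum>t<2*2. vas x u i t * (- (\<Sum>s<4. vas u x t s * y s))) - y i = (dot 3 x u - 1) * y i"
      unfolding n22 vas_inverse[OF i4] by (simp add: algebra_simps)
    then show "(\<Sum>t<2*2. vas x u i t * (- (\<Sum>s<4. vas u x t s * y s))) - y i \<in> ext I"
      using ideal_mult2[OF A xu, of "y i"] by (simp only:)
  qed
  obtain R S where R: "2 \<le> R" and S: "\<And>i j. i < 2*R \<Longrightarrow> j < 2*R \<Longrightarrow> sp R (S i) (S j) - dsum 2 (vas x u) i j \<in> ext I"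
    using linearize[OF h I(1) c0 al surj] by blast
  obtain T where T: "\<And>i j. i < 2*2 \<Longrightarrow> j < 2*2 \<Longrightarrow> sp 2 (T i) (T j) - vas x u i j \<in> ext I"
  proof -
    have "\<exists>T. \<forall>i<2*2. \<forall>j<2*2. sp 2 (T i) (T j) - vas x u i j \<in> ext I"
      by (rule cancel_planes[where R = R and S = S]) (use R I S in simp_all)
    then show ?thesis using that by blast
  qed
  have v: "vas x u 0 1 = x 0" "vas x u 0 2 = x 1" "vas x u 0 3 = x 2" "vas x u 1 2 = u 2" "vas x u 1 3 = - u 1" "vas x u 2 3 = u 0"
    by (simp_all add: vas_def)
  have g: "sp 2 (T 0) (T 1) - x 0 \<in> ext I" "sp 2 (T 0) (T 2) - x 1 \<in> ext I" "sp 2 (T 0) (T 3) - x 2 \<in> ext I"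
    "sp 2 (T 1) (T 2) - u 2 \<in> ext I" "sp 2 (T 1) (T 3) + u 1 \<in> ext I" "sp 2 (T 2) (T 3) - u 0 \<in> ext I"
    using T[of 0 1] T[of 0 2] T[of 0 3] T[of 1 2] T[of 1 3] T[of 2 3] unfolding v by simp_all
  have "\<exists>(w :: nat \<Rightarrow> 'a poly) (c :: nat \<Rightarrow> 'a poly). c 0 * (x 1 * w 2 - x 2 * w 1) + c 1 * (x 2 * w 0 - x 0 * w 2) + c 2 * (x 0 * w 1 - x 1 * w 0) - 1 \<in> ext I"
    by (rule gram_completes[OF I xu[unfolded dot3] g])
  then obtain w c :: "nat \<Rightarrow> 'a poly" where wc: "c 0 * (x 1 * w 2 - x 2 * w 1) + c 1 * (x 2 * w 0 - x 0 * w 2) + c 2 * (x 0 * w 1 - x 1 * w 0) - 1 \<in> ext I"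
    by (elim exE)
  define a where "a i j = (if i = 1 \<and> j = 2 then c 0 else if i = 2 \<and> j = 0 then c 1 else if i = 0 \<and> j = 1 then c 2 else 0)" for i j :: nat
  have "(\<Sum>i<3. \<Sum>j<3. a i j * (x i * w j - x j * w i)) =
    c 0 * (x 1 * w 2 - x 2 * w 1) + c 1 * (x 2 * w 0 - x 0 * w 2) + c 2 * (x 0 * w 1 - x 1 * w 0)"
    unfolding sum3 by (simp add: a_def)
  then have "(\<Sum>i<3. \<Sum>j<3. a i j * (x i * w j - x j * w i)) - 1 \<in> ext I" using wc by (simp only:)
  then show ?thesis unfolding completable_minors[OF A] by (intro exI)
qed

text \<open>
  The constant coefficients are moved to the first basis vector by elementary operations over the
  local ring \<open>R\<close>: modulo the ideal \<open>Z\<close> of polynomials with constant coefficient in \<open>I\<close>, an entry other than \<open>1\<close> is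
  a unit.
\<close>
lemma (in local_noeth) normalize_three:
  fixes x :: "nat \<Rightarrow> 'a poly"
  assumes I: "is_ideal I" "I \<subseteq> m" and x: "unimod 3 (ext I) x"
  shows "\<exists>y. reduces 3 (ext I) x y \<and> (\<forall>i<3. coeff (y i) 0 = (if i = 0 then 1 else 0))"
proof -
  have A: "is_ideal (ext I)" by (rule ext_ideal[OF I(1)])
  define Z where "Z = {p::'a poly. coeff p 0 \<in> I}"
  have Z: "is_ideal Z"
    unfolding is_ideal_def Z_def using ideal_zero[OF I(1)] by (auto simp: coeff_mult_0 ideal_add[OF I(1)] ideal_mult[OF I(1)])
  have unitZ: "\<exists>d. d * p - 1 \<in> Z" if "coeff p 0 \<notin> m" for p :: "'a poly"
  proof -
    from unit[OF that] obtain e where "1 = coeff p 0 * e" by (auto simp: dvd_def)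
    then have "[:e:] * p - 1 \<in> Z" unfolding Z_def using ideal_zero[OF I(1)] by (simp add: mult.commute)
    then show ?thesis by blast
  qed
  have some: "coeff (x 0) 0 \<notin> m \<or> coeff (x 1) 0 \<notin> m \<or> coeff (x 2) 0 \<notin> m"
  proof (rule ccontr)
    assume n: "\<not> ?thesis"
    let ?M = "{p::'a poly. coeff p 0 \<in> m}"
    have M: "is_ideal ?M"
      unfolding is_ideal_def using ideal_zero[OF m_ideal] by (auto simp: coeff_mult_0 ideal_add[OF m_ideal] ideal_mult[OF m_ideal])
    have lt: "{..<3::nat} = {0,1,2}" by auto
    have "x ` {..<3} \<union> ext I \<subseteq> ?M" using n I(2) by (auto simp: lt ext_def)
    then have "1 \<in> ?M" using x ideal_of_least[OF M] unfolding unimod_def by blast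
    then show False using prime_one[OF m_prime] by simp
  qed
  obtain a where a: "reduces 3 (ext I) x a" and a02: "coeff (a 0) 0 \<notin> m \<or> coeff (a 2) 0 \<notin> m"
  proof (cases "coeff (x 0) 0 \<notin> m \<or> coeff (x 2) 0 \<notin> m")
    case True
    then show ?thesis using that reduces_refl by blast
  next
    case False
    then have x1: "coeff (x 0) 0 \<in> m" "coeff (x 1) 0 \<notin> m" using some by auto
    let ?a = "x(0 := x 0 + 1 * x 1)"
    have "coeff (?a 0) 0 \<notin> m"
    proof
      assume "coeff (?a 0) 0 \<in> m"
      then have "coeff (x 0) 0 + coeff (x 1) 0 \<in> m" by simp
      then have "coeff (x 0) 0 + coeff (x 1) 0 - coeff (x 0) 0 \<in> m" by (rule ideal_diff[OF m_ideal _ x1(1)])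
      then show False using x1 by simp
    qed
    moreover have "reduces 3 (ext I) x ?a" by (rule reduces_step) simp_all
    ultimately show ?thesis using that by blast
  qed
  have s1: "(\<Sum>i\<in>{..<3} - {1::nat}. f i) = f 0 + f 2" for f :: "nat \<Rightarrow> 'a poly"
  proof -
    have "{..<3} - {1::nat} = {0,2}" by auto
    then show ?thesis by simp
  qed
  obtain c where c: "(\<Sum>i\<in>{..<3} - {1}. c i * a i) - 1 \<in> Z"
  proof (cases "coeff (a 0) 0 \<notin> m")
    case True
    then obtain d where "d * a 0 - 1 \<in> Z" using unitZ by blast
    then show ?thesis using that[of "\<lambda>i. if i = 0 then d else 0"] unfolding s1 by simp
  next
    case False
    then obtain d where "d * a 2 - 1 \<in> Z" using a02 unitZ by blast
    then show ?thesis using that[of "\<lambda>i. if i = 2 then d else 0"] unfolding s1 by simp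
  qed
  obtain b where b: "simE 3 a b" "b 0 - 1 \<in> Z" "\<And>k. 0 < k \<Longrightarrow> k < 3 \<Longrightarrow> b k \<in> Z"
    using simE_to_e0[OF _ Z c] by auto
  define y where "y i = b i - [:coeff (b i) 0 - (if i = 0 then 1 else 0):]" for i
  have "reduces 3 (ext I) a b" using b(1)[unfolded simE_def, rule_format, OF A] .
  moreover have "reduces 3 (ext I) b y"
  proof (rule reduces_mod[OF A])
    fix i :: nat assume "i < 3"
    then have "coeff (b i) 0 - (if i = 0 then 1 else 0) \<in> I" using b(2) b(3)[of i] by (auto simp: Z_def)
    then have "[:coeff (b i) 0 - (if i = 0 then 1 else 0):] \<in> ext I" by (simp only: ext_const[OF I(1)])
    then have "- [:coeff (b i) 0 - (if i = 0 then 1 else 0):] \<in> ext I" by (rule ideal_uminus[OF A])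
    moreover have "e - c - e = - c" for e c :: "'a poly" by simp
    ultimately show "y i - b i \<in> ext I" unfolding y_def by (simp only:)
  qed
  ultimately have "reduces 3 (ext I) x y" using reduces_trans a by blast
  moreover have "coeff (y i) 0 = (if i = 0 then 1 else 0)" for i by (simp add: y_def)
  ultimately show ?thesis by blast
qed

lemma (in local_noeth) completable_three:
  fixes x :: "nat \<Rightarrow> 'a poly"
  assumes h: "h + h = (1::'a)" and I: "is_ideal I" "dim_le I 2" and x: "unimod 3 (ext I) x"
  shows "completable 3 (ext I) x"
proof (cases "1 \<in> I")
  case True
  then have "ext I = UNIV" by (rule ext_UNIV[OF I(1)])
  then show ?thesis by (simp add: completable_def)
next
  case False
  have A: "is_ideal (ext I)" by (rule ext_ideal[OF I(1)])
  obtain y where y: "reduces 3 (ext I) x y" and c: "\<And>i. i < 3 \<Longrightarrow> coeff (y i) 0 = (if i = 0 then 1 else 0)"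
    using normalize_three[OF I(1) proper_ideal[OF I(1) False] x] by blast
  have "unimod 3 (ext I) y" by (rule reduces_unimod[OF y x])
  then obtain u where u: "1 - (\<Sum>i<3. u i * y i) \<in> ext I"
    using ideal_of_image[OF A, of "{..<3}" 1 y] unfolding unimod_def by auto
  \<comment> \<open>Subtracting relations among the entries of \<open>y\<close> removes the constant coefficients of \<open>u 1\<close> and \<open>u 2\<close>.\<close>
  define p q r where "p = [:coeff (u 1) 0:]" and "q = [:coeff (u 2) 0:]" and "r = [:coeff (u 0) 0 - 1:]"
  define u' where "u' i = (if i = 0 then u 0 + p * y 1 + q * y 2 - r else if i = 1 then u 1 - p * y 0 else u 2 - q * y 0)" for i :: nat
  have u3: "(\<Sum>i<3. u i * y i) = u 0 * y 0 + u 1 * y 1 + u 2 * y 2" by (rule sum3)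
  have cy: "coeff (y 0) 0 = 1" "coeff (y 1) 0 = 0" "coeff (y 2) 0 = 0" using c by simp_all
  have "coeff (1 - (\<Sum>i<3. u i * y i)) 0 \<in> I" using u unfolding ext_def by blast
  then have "1 - coeff (u 0) 0 \<in> I" unfolding u3 by (simp add: coeff_mult_0 cy cy[unfolded One_nat_def])
  then have "coeff (u 0) 0 - 1 \<in> I" using ideal_uminus[OF I(1)] by fastforce
  then have r: "r \<in> ext I" unfolding r_def by (simp only: ext_const[OF I(1)])
  have "dot 3 y u' - 1 = - (1 - (\<Sum>i<3. u i * y i)) - r * y 0"
    unfolding u3 dot3 u'_def by (simp add: algebra_simps)
  also have "\<dots> \<in> ext I" by (rule ideal_diff[OF A ideal_uminus[OF A u] ideal_mult2[OF A r]])
  finally have yu: "dot 3 y u' - 1 \<in> ext I" .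
  have cu: "coeff (u' i) 0 = (if i = 0 then 1 else 0)" if "i < 3" for i
    using that by (auto simp: u'_def p_def q_def r_def coeff_mult_0 cy cy[unfolded One_nat_def])
  have "completable 3 (ext I) y"
    by (rule completable_normalized_three[OF h I yu c cu])
  then show ?thesis by (rule reduces_compl[OF y])
qed

section \<open>Polynomials with leading coefficient a power of a fixed element\<close>

text \<open>
  Localised at \<open>p\<close>, the quotient by \<open>Q\<close> is a finite module, since \<open>f\<close> has a unit coefficient in degree \<open>d\<close>, and
  it vanishes modulo \<open>p\<close>; so it vanishes by Nakayama's lemma.  Concretely the degree of \<open>f\<close> can be lowered: the
  remainder of \<open>X\<^sup>d\<^sup>-\<^sup>1 q\<close> modulo \<open>f\<close> is again in \<open>Q\<close> and has its coefficient of degree \<open>d - 1\<close> outside \<open>p\<close>,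
  because \<open>q \<equiv> 1\<close> and the quotient has coefficients in \<open>p\<close>.
\<close>
lemma nakayama_constant:
  fixes Q :: "'a::comm_ring_1 poly set"
  assumes p: "is_prime p" and Q: "is_ideal Q" and q: "q \<in> Q" "1 - q \<in> ext p"
    and f: "f \<in> Q" "degree f \<le> d" "coeff f d \<notin> p"
  shows "\<exists>r. r \<notin> p \<and> [:r:] \<in> Q"
  using f
proof (induction d arbitrary: f)
  case 0
  then obtain r where "f = [:r:]" by (metis degree_eq_zeroE le_zero_eq)
  then show ?case using 0 by auto
next
  case (Suc d)
  have pI: "is_ideal p" by (rule prime_ideal[OF p])
  have E: "is_ideal (ext p)" by (rule ext_ideal[OF pI])
  define s where "s = coeff f (Suc d)"
  have q1: "coeff q i \<in> p" if "0 < i" for i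
  proof -
    have "coeff (1 - q) i \<in> p" using q(2) unfolding ext_def by blast
    then have "- coeff q i \<in> p" using that by simp
    then show ?thesis using ideal_uminus[OF pI] by fastforce
  qed
  have q0: "coeff q 0 \<notin> p"
  proof
    assume "coeff q 0 \<in> p"
    moreover have "coeff (1 - q) 0 \<in> p" using q(2) unfolding ext_def by blast
    ultimately have "coeff (1 - q) 0 + coeff q 0 \<in> p" by (rule ideal_add[OF pI, rotated])
    then show False using prime_one[OF p] by simp
  qed
  have gp: "coeff (monom 1 d * q) i \<in> p" if "Suc d \<le> i" for i
    using q1[of "i - d"] that by (simp add: coeff_monom_mult)
  obtain k h where kh: "h \<in> ext p" "degree (smult (s ^ k) (monom 1 d * q) - h * f) < Suc d"
    using pseudo_division[OF pI Suc.prems(2) s_def[symmetric] zero_less_Suc gp] by blast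
  define r where "r = smult (s ^ k) (monom 1 d * q) - h * f"
  have r: "r \<in> Q"
  proof -
    have "[:s ^ k:] * (monom 1 d * q) - h * f \<in> Q"
      by (rule ideal_diff[OF Q ideal_mult[OF Q ideal_mult[OF Q q(1)]] ideal_mult[OF Q Suc.prems(1)]])
    then show ?thesis by (simp add: r_def)
  qed
  have "coeff r d \<notin> p"
  proof
    assume h: "coeff r d \<in> p"
    have "h * f \<in> ext p" by (rule ideal_mult2[OF E kh(1)])
    then have "coeff (h * f) d \<in> p" unfolding ext_def by blast
    then have "coeff r d + coeff (h * f) d \<in> p" by (rule ideal_add[OF pI h])
    moreover have "coeff r d + coeff (h * f) d = s ^ k * coeff q 0" by (simp add: r_def coeff_monom_mult)
    ultimately have "s ^ k * coeff q 0 \<in> p" by simp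
    then show False using q0 prime_mult[OF p] prime_power[OF p] Suc.prems(3) s_def by blast
  qed
  then show ?case using Suc.IH[OF r] kh(2) unfolding r_def[symmetric] by simp
qed

lemma ideal_unit_power:
  assumes B: "is_ideal B" and ab: "a * b - 1 \<in> B"
  shows "a ^ e * b ^ e - 1 \<in> B"
proof (induction e)
  case (Suc e)
  have "a ^ Suc e * b ^ Suc e - 1 = (a * b) * (a ^ e * b ^ e - 1) + (a * b - 1)" by (simp add: algebra_simps)
  then show ?case using ideal_add[OF B ideal_mult[OF B Suc] ab] by (simp only:)
qed (simp add: ideal_zero[OF B])

text \<open>
  A completion modulo two entries extends to the whole row: if the minors of
  the first \<open>k\<close> columns combine to \<open>1 + d\<^sub>k v\<^sub>k + d\<^sub>k\<^sub>+\<^sub>1 v\<^sub>k\<^sub>+\<^sub>1\<close>, then the new entries of \<open>w\<close> are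
  chosen so that the last minor cancels the error.
\<close>
lemma completable_absorb:
  assumes A: "is_ideal A" and B: "completable k (ideal_of ({v k, v (Suc k)} \<union> A)) v"
  shows "completable (Suc (Suc k)) A v"
proof -
  obtain w c where wc: "(\<Sum>i<k. \<Sum>j<k. c i j * (v i * w j - v j * w i)) - 1 \<in> ideal_of ({v k, v (Suc k)} \<union> A)"
    using B completable_minors[OF ideal_of_ideal] by blast
  have im: "{v k, v (Suc k)} = v ` {k, Suc k}" by auto
  obtain d where "(\<Sum>i<k. \<Sum>j<k. c i j * (v i * w j - v j * w i)) - 1 - (\<Sum>i\<in>{k, Suc k}. d i * v i) \<in> A"
    using ideal_of_image[OF A, of "{k, Suc k}" _ v] wc unfolding im by blast
  then have d: "(\<Sum>i<k. \<Sum>j<k. c i j * (v i * w j - v j * w i)) - 1 - (d k * v k + d (Suc k) * v (Suc k)) \<in> A" by simp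
  \<comment> \<open>Then \<open>v\<^sub>k w\<^sub>k\<^sub>+\<^sub>1 - v\<^sub>k\<^sub>+\<^sub>1 w\<^sub>k\<close> is the negative of the error term.\<close>
  define w' where "w' i = (if i = k then d (Suc k) else if i = Suc k then - d k else w i)" for i
  define c' where "c' i j = (if i < k \<and> j < k then c i j else if i = k \<and> j = Suc k then 1 else 0)" for i j
  have "(\<Sum>i<k. \<Sum>j<Suc (Suc k). c' i j * (v i * w' j - v j * w' i)) = (\<Sum>i<k. \<Sum>j<k. c i j * (v i * w j - v j * w i))"
  proof (rule sum.cong[OF refl])
    fix i assume i: "i \<in> {..<k}"
    have "(\<Sum>j<k. c' i j * (v i * w' j - v j * w' i)) = (\<Sum>j<k. c i j * (v i * w j - v j * w i))"
      by (rule sum.cong) (use i in \<open>auto simp: c'_def w'_def\<close>)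
    then show "(\<Sum>j<Suc (Suc k). c' i j * (v i * w' j - v j * w' i)) = (\<Sum>j<k. c i j * (v i * w j - v j * w i))"
      using i by (simp add: c'_def)
  qed
  moreover have "(\<Sum>j<Suc (Suc k). c' k j * (v k * w' j - v j * w' k)) = - (d k * v k + d (Suc k) * v (Suc k))"
    by (simp add: c'_def w'_def algebra_simps)
  moreover have "(\<Sum>j<Suc (Suc k). c' (Suc k) j * (v (Suc k) * w' j - v j * w' (Suc k))) = 0"
    by (simp add: c'_def)
  moreover have "(\<Sum>i<Suc (Suc k). f i) - 1 \<in> A"
    if "(\<Sum>i<k. f i) = U" "f k = - Y" "f (Suc k) = 0" "U - 1 - Y \<in> A" for f :: "nat \<Rightarrow> 'a" and U Y
  proof -
    have "(\<Sum>i<Suc (Suc k). f i) - 1 = U - 1 - Y" using that(1-3) by simp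
    then show ?thesis using that(4) by (simp only:)
  qed
  ultimately have "(\<Sum>i<Suc (Suc k). \<Sum>j<Suc (Suc k). c' i j * (v i * w' j - v j * w' i)) - 1 \<in> A"
    using d by blast
  then show ?thesis unfolding completable_minors[OF A] by (intro exI)
qed

text \<open>
  The leading coefficients of the elements of \<open>Q\<close>, with zero coefficients above the degree allowed so
  that sums remain in the set.
\<close>
definition leads :: "'a::comm_ring_1 poly set \<Rightarrow> 'a set" where
  "leads Q = {coeff G D | G D. G \<in> Q \<and> degree G \<le> D}"

lemma leads_ideal:
  fixes Q :: "'a::comm_ring_1 poly set"
  assumes Q: "is_ideal Q" shows "is_ideal (leads Q)"
proof -
  have "0 \<in> leads Q" unfolding leads_def using ideal_zero[OF Q] by (intro CollectI exI[of _ 0]) simp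
  moreover have "a + b \<in> leads Q" if ab: "a \<in> leads Q" "b \<in> leads Q" for a b
  proof -
    obtain G D G' D' where g: "a = coeff G D" "G \<in> Q" "degree G \<le> D" "b = coeff G' D'" "G' \<in> Q" "degree G' \<le> D'"
      using ab unfolding leads_def by auto
    define H where "H = monom 1 D' * G + monom 1 D * G'"
    have "H \<in> Q" unfolding H_def by (rule ideal_add[OF Q ideal_mult[OF Q g(2)] ideal_mult[OF Q g(5)]])
    moreover have "coeff H (D + D') = a + b" unfolding H_def g by (simp add: coeff_monom_mult)
    moreover have "degree H \<le> D + D'" unfolding H_def
    proof (rule degree_add_le)
      show "degree (monom 1 D' * G) \<le> D + D'"
        using degree_mult_le[of "monom 1 D'" G] degree_monom_le[of "1::'a" D'] g(3) by linarith
      show "degree (monom 1 D * G') \<le> D + D'"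
        using degree_mult_le[of "monom 1 D" G'] degree_monom_le[of "1::'a" D] g(6) by linarith
    qed
    ultimately show ?thesis unfolding leads_def by (intro CollectI exI[of _ H] exI[of _ "D + D'"]) simp
  qed
  moreover have "c * a \<in> leads Q" if a: "a \<in> leads Q" for a c
  proof -
    obtain G D where g: "a = coeff G D" "G \<in> Q" "degree G \<le> D" using a unfolding leads_def by auto
    have "[:c:] * G \<in> Q" by (rule ideal_mult[OF Q g(2)])
    moreover have "degree ([:c:] * G) \<le> D" using g(3) degree_smult_le[of c G] by simp
    ultimately show ?thesis unfolding leads_def g(1) by (intro CollectI exI[of _ "[:c:] * G"] exI[of _ D]) simp
  qed
  ultimately show ?thesis by (simp add: is_ideal_def)
qed

lemma ext_insert: "is_ideal I \<Longrightarrow> ext (ideal_of (insert l I)) \<subseteq> ideal_of (insert [:l:] (ext I))"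
proof -
  assume I: "is_ideal I"
  let ?P = "ideal_of (insert [:l:] (ext I))"
  have "r \<in> contr ?P" if "r \<in> I" for r
    using that ext_const[OF I] by (auto simp: contr_def intro: ideal_of_base)
  then have "insert l I \<subseteq> contr ?P" by (auto simp: contr_def intro: ideal_of_base)
  then have "ideal_of (insert l I) \<subseteq> contr ?P" by (rule ideal_of_least[OF contr_ideal[OF ideal_of_ideal]])
  then show ?thesis by (simp add: ext_subset_iff ideal_of_ideal)
qed

section \<open>Rows with a fixed anchor entry\<close>

text \<open>
  The situation of the induction step.  The entry \<open>w\<close> is \<open>1\<close> modulo \<open>l\<close> and \<open>I\<close>, and \<open>l\<close> avoids the minimal
  primes over \<open>I\<close>, in the form that each prime containing \<open>I\<close> and \<open>l\<close> has height at least one.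
\<close>
locale anchored = local_noeth m for m :: "'a::comm_ring_1 set" +
  fixes I :: "'a set" and l :: 'a and w :: "'a poly" and n :: nat
  assumes I: "is_ideal I" "1 \<notin> I" and l: "l \<in> m" and n: "5 \<le> n" and dim: "dim_le I (n - 1)"
    and w: "w - 1 \<in> ext (ideal_of (insert l I))"
    and hl: "\<And>P. is_prime P \<Longrightarrow> I \<subseteq> P \<Longrightarrow> l \<in> P \<Longrightarrow> ht_ge I 1 P"
begin

abbreviation "AA \<equiv> ext I"

definition lmonic :: "nat \<Rightarrow> 'a poly \<Rightarrow> bool" where
  "lmonic d F \<longleftrightarrow> degree F \<le> d \<and> (\<exists>e. coeff F d = l ^ e)"

definition anchored_row :: "(nat \<Rightarrow> 'a poly) \<Rightarrow> bool" where
  "anchored_row v \<longleftrightarrow> unimod n AA v \<and> v 0 = w"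

lemma A: "is_ideal AA" by (rule ext_ideal[OF I(1)])

text \<open>
  A prime of height \<open>n - 1\<close> avoiding \<open>l\<close> would be properly contained in the maximal ideal.
\<close>
lemma high: "ht_ge I (n - 1) P \<Longrightarrow> l \<in> P"
proof (rule ccontr)
  assume "ht_ge I (n - 1) P" "l \<notin> P"
  then have "ht_ge I (Suc (n - 1)) m" using ht_m l by blast
  then show False using dim unfolding dim_le_def by blast
qed

text \<open>
  Powers of \<open>l\<close> are units modulo \<open>w\<close>, since \<open>1 = w - c l\<close> modulo \<open>I\<close>.
\<close>
lemma l_inv: "\<exists>t. [:l ^ e:] * t - 1 \<in> ideal_of (insert w AA)"
proof -
  let ?B = "ideal_of (insert w AA)"
  have B: "is_ideal ?B" by (rule ideal_of_ideal)
  have "w - 1 \<in> ideal_of (insert [:l:] AA)" using w ext_insert[OF I(1)] by blast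
  then obtain c where c: "w - 1 - c * [:l:] \<in> AA" using ideal_of_insert[OF A] by blast
  have "w - (w - 1 - c * [:l:]) \<in> ?B" by (rule ideal_diff[OF B]) (use c in \<open>auto intro: ideal_of_base\<close>)
  then have "- (w - (w - 1 - c * [:l:])) \<in> ?B" by (rule ideal_uminus[OF B])
  moreover have "- (w - (w - 1 - c * [:l:])) = [:l:] * (- c) - 1" by simp
  ultimately have "[:l:] * (- c) - 1 \<in> ?B" by (simp only:)
  from ideal_unit_power[OF B this, of e] show ?thesis unfolding poly_const_pow by blast
qed

lemma l_cancel:
  assumes B: "is_ideal B" "w \<in> B" "AA \<subseteq> B" and x: "[:l ^ e:] * x \<in> B"
  shows "x \<in> B"
proof -
  obtain t where t: "[:l ^ e:] * t - 1 \<in> ideal_of (insert w AA)" using l_inv by blast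
  have "ideal_of (insert w AA) \<subseteq> B" by (rule ideal_of_least[OF B(1)]) (use B in auto)
  then have "[:l ^ e:] * t - 1 \<in> B" using t by blast
  then have "t * ([:l ^ e:] * x) - x * ([:l ^ e:] * t - 1) \<in> B"
    by (rule ideal_diff[OF B(1) ideal_mult[OF B(1) x] ideal_mult[OF B(1)]])
  moreover have "t * ([:l ^ e:] * x) - x * ([:l ^ e:] * t - 1) = x" by (simp add: algebra_simps)
  ultimately show ?thesis by (simp only:)
qed

lemma row_red: "anchored_row v \<Longrightarrow> reduces n AA v v' \<Longrightarrow> v' 0 = w \<Longrightarrow> anchored_row v'"
  using reduces_unimod unfolding anchored_row_def by blast

lemma row_not_in_prime:
  assumes "anchored_row v" "is_prime P" "AA \<subseteq> P" shows "\<exists>i<n. v i \<notin> P"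
proof (rule ccontr)
  assume "\<not> ?thesis"
  then have "v ` {..<n} \<union> AA \<subseteq> P" using assms by auto
  then have "1 \<in> P" using assms(1) ideal_of_least[OF prime_ideal[OF assms(2)]] unfolding anchored_row_def unimod_def by blast
  then show False using prime_one[OF assms(2)] by simp
qed

lemma scale:
  assumes v: "anchored_row v" and jk: "0 < j" "j < n" "0 < k" "k < n" "j \<noteq> k"
  shows "reduces n AA v (v(j := [:l ^ e:] * v j, k := [:l ^ e:] * v k))"
proof -
  obtain t where "[:l ^ e:] * t - 1 \<in> ideal_of (insert w AA)" using l_inv by blast
  then show ?thesis using reduces_pair_scale[OF A, of 0 n j k "[:l ^ e:]" t v] v jk n by (simp add: anchored_row_def)
qed

lemma lmonic_scale: "lmonic d F \<Longrightarrow> lmonic d ([:l ^ e:] * F)"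
  unfolding lmonic_def using degree_smult_le[of "l ^ e" F] by (auto simp: power_add[symmetric] intro: order.trans)

lemma lmonic_swap: "anchored_row v \<Longrightarrow> 1 < j \<Longrightarrow> j < n \<Longrightarrow> lmonic d (v j) \<Longrightarrow> \<exists>v'. reduces n AA v v' \<and> anchored_row v' \<and> lmonic d (v' 1)"
proof -
  assume h: "anchored_row v" "1 < j" "j < n" "lmonic d (v j)"
  have r: "reduces n AA v (v(1 := v j, j := - v 1))" by (rule reduces_swap) (use h in auto)
  have "anchored_row (v(1 := v j, j := - v 1))" by (rule row_red[OF h(1) r]) (use h in \<open>simp add: anchored_row_def\<close>)
  then show ?thesis using r h by (intro exI[of _ "v(1 := v j, j := - v 1)"]) simp
qed

text \<open>
  By general position, the entries \<open>1, \<dots>, n - 2\<close> are modified by multiples of the last one such that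
  the ideal \<open>Q\<close> of all entries but the last contains a polynomial \<open>G\<close> with leading coefficient a power of \<open>l\<close>.
  Otherwise the leading coefficients of \<open>Q\<close> lie in a prime \<open>p\<close> avoiding \<open>l\<close>, and there is a prime \<open>Z\<close> over
  \<open>Q\<close> whose elements all have leading coefficient in \<open>p\<close>.  As \<open>w\<close> lies in \<open>Z\<close>, the contraction of \<open>Z\<close> is
  strictly smaller than \<open>p\<close>; it has height \<open>n - 2\<close>, so \<open>p\<close> has height \<open>n - 1\<close>, contradicting \<open>high\<close>.
  A high multiple of \<open>G\<close> is added to the last entry.
\<close>
lemma exists_lmonic:
  assumes v: "anchored_row v"
  shows "\<exists>v' d. reduces n AA v v' \<and> anchored_row v' \<and> 0 < d \<and> lmonic d (v' 1)"
proof -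
  define N where "N = n - 1"
  have N: "n = Suc N" "4 \<le> N" using n by (auto simp: N_def)
  define W where "W = ideal_of (insert w AA)"
  have W: "is_ideal W" "w \<in> W" "AA \<subseteq> W" by (auto simp: W_def ideal_of_ideal intro: ideal_of_base)
  define J where "J = ideal_of {v N}"
  have J: "is_ideal J" by (simp add: J_def ideal_of_ideal)
  obtain t where t: "\<forall>k<N-1. t k \<in> J" and tP: "\<And>P. is_prime P \<Longrightarrow> W \<subseteq> P \<Longrightarrow> (\<forall>k<N-1. v (Suc k) + t k \<in> P) \<Longrightarrow>
      \<not> J \<subseteq> P \<Longrightarrow> ht_ge W (N - 1) P"
    using stable_range[OF noeth_poly W(1) J, of "N - 1" "\<lambda>k. v (Suc k)"] by blast
  have "\<forall>k. \<exists>c. k < N - 1 \<longrightarrow> t k = c * v N" using t principal_ideal[of _ "v N"] unfolding J_def by blast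
  then obtain c where c: "\<And>k. k < N - 1 \<Longrightarrow> t k = c k * v N" by (elim choice[THEN exE]) blast
  define y where "y = (\<lambda>k. if k \<in> {1..<N} then v k + c (k - 1) * v N else v k)"
  have ry: "reduces n AA v y" unfolding y_def by (rule reduces_add_multiples) (use N in auto)
  have y0: "y 0 = w" using v by (simp add: y_def anchored_row_def)
  have y: "anchored_row y" by (rule row_red[OF v ry y0])
  have yN: "y N = v N" by (simp add: y_def)
  define Q where "Q = ideal_of (y ` {..<N} \<union> AA)"
  have Q: "is_ideal Q" by (simp add: Q_def ideal_of_ideal)
  have yQ: "y k \<in> Q" if "k < N" for k using that by (auto simp: Q_def intro: ideal_of_base)
  have AQ: "AA \<subseteq> Q" by (auto simp: Q_def intro: ideal_of_base)
  have "\<exists>e. l ^ e \<in> leads Q"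
  proof (rule ccontr)
    assume "\<not> ?thesis"
    then have "\<And>k. l ^ k \<notin> leads Q" by blast
    then obtain p where p: "is_prime p" "leads Q \<subseteq> p" "l \<notin> p" using prime_over[OF noeth leads_ideal[OF Q]] by blast
    define S where "S = {f :: 'a poly. lead_coeff f \<notin> p}"
    have S1: "1 \<in> S" using prime_one[OF p(1)] by (simp add: S_def)
    have SM: "a * b \<in> S" if "a \<in> S" "b \<in> S" for a b
    proof -
      have nz: "lead_coeff a * lead_coeff b \<notin> p" using that prime_mult[OF p(1)] by (simp add: S_def)
      then have "coeff (a * b) (degree a + degree b) \<noteq> 0"
        using ideal_zero[OF prime_ideal[OF p(1)]] by (auto simp: coeff_mult_degree_sum)
      then have "degree (a * b) = degree a + degree b" using le_degree degree_mult_le le_antisym by metis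
      then have "lead_coeff (a * b) = lead_coeff a * lead_coeff b" by (simp add: coeff_mult_degree_sum)
      then show ?thesis using nz by (simp add: S_def)
    qed
    have D: "Q \<inter> S = {}"
    proof -
      have "lead_coeff f \<in> p" if "f \<in> Q" for f
      proof -
        have "lead_coeff f \<in> leads Q" using that unfolding leads_def by blast
        then show ?thesis using p(2) by blast
      qed
      then show ?thesis by (auto simp: S_def)
    qed
    obtain Z where Z: "is_prime Z" "Q \<subseteq> Z" "Z \<inter> S = {}" using prime_disjoint[OF noeth_poly Q S1 SM D] by blast
    have ZI: "is_ideal Z" by (rule prime_ideal[OF Z(1)])
    have WZ: "W \<subseteq> Z" unfolding W_def using Z(2) AQ yQ[of 0] y0 N by (intro ideal_of_least[OF ZI]) auto
    have cs: "contr Z \<subseteq> p"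
    proof
      fix r assume r: "r \<in> contr Z"
      then have "[:r:] \<notin> S" using Z(3) by (auto simp: contr_def)
      then show "r \<in> p" by (simp add: S_def)
    qed
    have "contr Z \<noteq> p"
    proof
      assume e: "contr Z = p"
      have eZ: "ext p \<subseteq> Z" using ext_subset_iff[OF ZI prime_ideal[OF p(1)]] e by simp
      have Im: "ideal_of (insert l I) \<subseteq> m" using proper_ideal[OF I] l by (simp add: ideal_of_subset_iff m_ideal)
      have "coeff (w - 1) 0 \<in> m" using w Im unfolding ext_def by blast
      then have "coeff w 0 \<notin> p" using one_plus_unit[OF p(1)] by simp
      then have "w \<notin> ext p" unfolding ext_def by blast
      then obtain f where f: "w - f \<in> ext p" "lead_coeff f \<notin> p" using drop_lead[OF prime_ideal[OF p(1)]] by blast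
      have "w - (w - f) \<in> Z" by (rule ideal_diff[OF ZI]) (use WZ W eZ f in auto)
      then have "f \<in> Z" by simp
      then show False using Z(3) f(2) by (auto simp: S_def)
    qed
    then have lt: "contr Z \<subset> p" using cs by blast
    have nJ: "\<not> J \<subseteq> Z"
    proof
      assume "J \<subseteq> Z"
      then have "y N \<in> Z" unfolding yN J_def by (auto intro: ideal_of_base)
      moreover have "y k \<in> Z" if "k < N" for k using yQ[OF that] Z(2) by blast
      ultimately have "y k \<in> Z" if "k < n" for k using that N(1) less_Suc_eq by auto
      then show False using row_not_in_prime[OF y Z(1)] AQ Z(2) by blast
    qed
    have "v (Suc k) + t k \<in> Z" if k: "k < N - 1" for k
    proof -
      have "y (Suc k) = v (Suc k) + t k" using k c[OF k] by (simp add: y_def)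
      moreover have "y (Suc k) \<in> Z" using yQ[of "Suc k"] Z(2) k by auto
      ultimately show ?thesis by simp
    qed
    then have "ht_ge W (N - 1) Z" using tP[OF Z(1) WZ _ nJ] by blast
    then have "ht_ge I (N - 1) (contr Z)" by (rule anchor_ht(1)[OF I l w W])
    then have "ht_ge I (Suc (N - 1)) p" by (rule ht_ge_Suc[OF _ p(1) lt])
    then have "ht_ge I (n - 1) p" using N by simp
    then show False using high p(3) by blast
  qed
  then obtain e where e: "l ^ e \<in> leads Q" by blast
  then obtain G D where G: "G \<in> Q" "degree G \<le> D" "l ^ e = coeff G D" unfolding leads_def by blast
  \<comment> \<open>The shift makes \<open>G\<close> dominate the entry to which it is added.\<close>
  define j where "j = Suc (degree (v N))"
  define u where "u = y(N := y N + monom 1 j * G)"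
  have "monom 1 j * G \<in> ideal_of (y ` ({..<n} - {N}) \<union> AA)"
  proof -
    have "{..<n} - {N} = {..<N}" using N by auto
    then show ?thesis using ideal_mult[OF Q G(1)] unfolding Q_def by simp
  qed
  then have ru: "reduces n AA y u" unfolding u_def by (rule reduces_add_ideal[OF A, rotated]) (use N in simp)
  have u: "anchored_row u" by (rule row_red[OF y ru]) (use N y0 in \<open>simp add: u_def\<close>)
  have "coeff (u N) (D + j) = l ^ e" unfolding G(3) by (simp add: u_def yN coeff_monom_mult j_def coeff_eq_0)
  moreover have "degree (u N) \<le> D + j"
    unfolding u_def fun_upd_same yN
  proof (rule degree_add_le)
    show "degree (monom 1 j * G) \<le> D + j"
      using degree_mult_le[of "monom 1 j" G] degree_monom_le[of "1::'a" j] G(2) by linarith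
  qed (simp add: j_def)
  ultimately have "lmonic (D + j) (u N)" unfolding lmonic_def by blast
  then obtain u' where "reduces n AA u u'" "anchored_row u'" "lmonic (D + j) (u' 1)"
    using lmonic_swap[OF u, of N] N by auto
  then show ?thesis using reduces_trans[OF ry reduces_trans[OF ru]] by (intro exI[of _ u'] exI[of _ "D + j"]) (simp add: j_def)
qed

text \<open>
  Pseudo-division by the pivot \<open>v 1\<close>.  The factor it requires is a power of \<open>l\<close>, introduced by scaling
  the entry together with the pivot; the pivot before scaling remains in the ideal, as \<open>l\<close> is a unit modulo \<open>w\<close>.
\<close>
lemma reduce_others:
  assumes v: "anchored_row v" and d: "0 < d" "lmonic d (v 1)"
  shows "\<exists>v'. reduces n AA v v' \<and> anchored_row v' \<and> lmonic d (v' 1) \<and> (\<forall>i. 1 < i \<longrightarrow> i < n \<longrightarrow> degree (v' i) < d)"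
proof -
  have "\<exists>v'. reduces n AA v v' \<and> anchored_row v' \<and> lmonic d (v' 1) \<and> (\<forall>i. 1 < i \<longrightarrow> i < k \<longrightarrow> degree (v' i) < d)" if "k \<le> n" for k
    using that
  proof (induction k)
    case 0
    show ?case using v d(2) reduces_refl by (intro exI[of _ v]) auto
  next
    case (Suc k)
    then obtain u where u: "reduces n AA v u" "anchored_row u" "lmonic d (u 1)" "\<And>i. 1 < i \<Longrightarrow> i < k \<Longrightarrow> degree (u i) < d" by auto
    show ?case
    proof (cases "1 < k")
      case False
      then have "\<forall>i. 1 < i \<longrightarrow> i < Suc k \<longrightarrow> degree (u i) < d" by auto
      then show ?thesis using u by blast
    next
      case True
      obtain e where e: "degree (u 1) \<le> d" "coeff (u 1) d = l ^ e" using u(3) unfolding lmonic_def by blast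
      obtain s h where sh: "degree (smult ((l ^ e) ^ s) (u k) - h * u 1) < d"
        using pseudo_division[of UNIV "u 1" d "l ^ e" "u k"] e d(1) by (auto simp: is_ideal_def)
      define a where "a = u(k := [:l ^ (e * s):] * u k, 1 := [:l ^ (e * s):] * u 1)"
      have ra: "reduces n AA u a" unfolding a_def by (rule scale[OF u(2)]) (use True Suc.prems in auto)
      have a: "anchored_row a" by (rule row_red[OF u(2) ra]) (use u(2) True in \<open>simp add: a_def anchored_row_def\<close>)
      define B where "B = ideal_of (a ` ({..<n} - {k}) \<union> AA)"
      have B: "is_ideal B" "AA \<subseteq> B" by (auto simp: B_def ideal_of_ideal intro: ideal_of_base)
      have aB: "a i \<in> B" if "i < n" "i \<noteq> k" for i using that by (auto simp: B_def intro!: ideal_of_base)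
      have wB: "w \<in> B" using aB[of 0] a True n by (simp add: anchored_row_def)
      have "[:l ^ (e * s):] * u 1 \<in> B" using aB[of 1] True Suc.prems by (simp add: a_def)
      then have "u 1 \<in> B" by (rule l_cancel[OF B(1) wB B(2)])
      then have "(- h) * u 1 \<in> B" by (rule ideal_mult[OF B(1)])
      then have rb: "reduces n AA a (a(k := a k + (- h) * u 1))" unfolding B_def
        by (rule reduces_add_ideal[OF A, rotated]) (use Suc.prems in simp)
      define b where "b = a(k := a k + (- h) * u 1)"
      have rb': "reduces n AA a b" using rb by (simp add: b_def)
      have b: "anchored_row b" by (rule row_red[OF a rb']) (use a True in \<open>simp add: b_def anchored_row_def\<close>)
      have b1: "b 1 = [:l ^ (e * s):] * u 1" using True by (simp add: b_def a_def)
      have bk: "b k = smult ((l ^ e) ^ s) (u k) - h * u 1" using True by (simp add: b_def a_def power_mult)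
      have bo: "b i = u i" if "i \<noteq> 1" "i \<noteq> k" for i using that by (simp add: b_def a_def)
      have "degree (b i) < d" if "1 < i" "i < Suc k" for i
        using that sh bk bo[of i] u(4)[of i] by (cases "i = k") auto
      moreover have "lmonic d (b 1)" unfolding b1 by (rule lmonic_scale[OF u(3)])
      moreover have "reduces n AA v b" using reduces_trans[OF u(1) reduces_trans[OF ra rb']] .
      ultimately show ?thesis using b by blast
    qed
  qed
  from this[of n] show ?thesis by simp
qed

end

section \<open>Lowering the degree of the pivot\<close>

text \<open>
  Simultaneous additions to the entries in \<open>L\<close> from the ideal of the entries outside \<open>L\<close>.
\<close>
lemma reduces_add_family:
  assumes A: "is_ideal A" and K: "finite K" "K \<subseteq> L" "L \<subseteq> {..<n}"
    and x: "\<And>i. i \<in> L \<Longrightarrow> x i \<in> ideal_of (v ` ({..<n} - L) \<union> A)"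
  shows "reduces n A v (\<lambda>i. if i \<in> K then v i + x i else v i)"
  using K(1) K(2)
proof (induction K)
  case empty
  show ?case by (simp add: reduces_refl)
next
  case (insert j K)
  let ?u = "\<lambda>i. if i \<in> K then v i + x i else v i"
  have j: "j \<in> L" "j \<notin> K" "K \<subseteq> L" using insert.hyps insert.prems by auto
  have 1: "reduces n A v ?u" using insert.IH j by blast
  have "v i \<in> ?u ` ({..<n} - {j})" if "i < n" "i \<notin> L" for i
    using that j by (intro image_eqI[of _ _ i]) auto
  then have "v ` ({..<n} - L) \<union> A \<subseteq> ?u ` ({..<n} - {j}) \<union> A" by auto
  then have "x j \<in> ideal_of (?u ` ({..<n} - {j}) \<union> A)" using x[OF j(1)] ideal_of_mono by blast
  then have 2: "reduces n A ?u (?u(j := ?u j + x j))" by (rule reduces_add_ideal[OF A, rotated]) (use j K(3) in auto)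
  have 3: "?u(j := ?u j + x j) = (\<lambda>i. if i \<in> insert j K then v i + x i else v i)"
  proof (rule HOL.ext)
    fix i show "(?u(j := ?u j + x j)) i = (if i \<in> insert j K then v i + x i else v i)"
      using j(2) by (cases "i = j") simp_all
  qed
  show ?case using reduces_trans[OF 1 2] unfolding 3 .
qed

context anchored begin

lemma row0: "anchored_row v \<Longrightarrow> v 0 = w" by (simp add: anchored_row_def)

text \<open>
  At a prime avoiding \<open>l\<close>, entries lying in \<open>P[X]\<close> are not needed for the unimodularity of the row, by
  Nakayama's lemma, so the others generate a constant outside \<open>P\<close>.
\<close>
lemma nakayama_row:
  assumes v: "anchored_row v" and P: "is_prime P" "l \<notin> P" and K: "K \<subseteq> {..<n}" "\<And>k. k \<in> K \<Longrightarrow> v k \<in> ext P"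
    and Q: "Q = ideal_of (v ` ({..<n} - K) \<union> AA)" and F: "F \<in> Q" "lmonic d F"
  shows "\<not> contr Q \<subseteq> P"
proof -
  have QI: "is_ideal Q" by (simp add: Q ideal_of_ideal)
  have E: "is_ideal (ext P)" by (rule ext_ideal[OF prime_ideal[OF P(1)]])
  have "v i \<in> v ` K \<union> Q" if "i < n" for i using that by (cases "i \<in> K") (auto simp: Q intro: ideal_of_base)
  then have "v ` {..<n} \<union> AA \<subseteq> v ` K \<union> Q" by (auto simp: Q intro: ideal_of_base)
  then have "1 \<in> ideal_of (v ` K \<union> Q)" using v ideal_of_mono unfolding anchored_row_def unimod_def by blast
  then obtain c where c: "1 - (\<Sum>i\<in>K. c i * v i) \<in> Q"
    using ideal_of_image[OF QI finite_subset[OF K(1)], of 1 v] by auto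
  have "1 - (1 - (\<Sum>i\<in>K. c i * v i)) \<in> ext P"
    using ideal_sum[OF E, of K "\<lambda>i. c i * v i"] ideal_mult[OF E] K(2) by simp
  moreover obtain e where "degree F \<le> d" "coeff F d = l ^ e" using F(2) unfolding lmonic_def by blast
  moreover have "l ^ e \<notin> P" using P prime_power by blast
  ultimately obtain r where "r \<notin> P" "[:r:] \<in> Q"
    using nakayama_constant[OF P(1) QI c _ F(1)] by metis
  then show ?thesis by (auto simp: contr_def)
qed

lemma subleads_ideal:
  fixes Q :: "'a poly set"
  assumes Q: "is_ideal Q" and "0 < d"
  shows "is_ideal {coeff G (d - 1) | G. G \<in> Q \<and> degree G < (d::nat)}"
proof -
  have "coeff G (d - 1) + coeff G' (d - 1) = coeff (G + G') (d - 1) \<and> G + G' \<in> Q \<and> degree (G + G') < d"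
    if "G \<in> Q" "degree G < d" "G' \<in> Q" "degree G' < d" for G G' :: "'a poly"
    using that ideal_add[OF Q] degree_add_less by auto
  moreover have "c * coeff G (d - 1) = coeff ([:c:] * G) (d - 1) \<and> [:c:] * G \<in> Q \<and> degree ([:c:] * G) < d"
    if "G \<in> Q" "degree G < d" for c and G :: "'a poly"
    using that ideal_mult[OF Q that(1), of "[:c:]"] degree_smult_le[of c G] by simp
  moreover have "0 = coeff 0 (d - 1) \<and> 0 \<in> Q \<and> degree (0::'a poly) < d" using \<open>0 < d\<close> ideal_zero[OF Q] by simp
  ultimately show ?thesis unfolding is_ideal_def by blast
qed

text \<open>
  Suslin's trick: if \<open>G\<close> has degree less than \<open>d\<close>, then \<open>l\<^sup>e X G - g F\<close> with \<open>g\<close> the coefficient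
  of \<open>G\<close> of degree \<open>d - 1\<close> again has degree less than \<open>d\<close>.  Its coefficient of degree \<open>d - 1\<close> is, modulo \<open>g\<close>, a multiple
  of the next coefficient of \<open>G\<close>; so all coefficients of \<open>G\<close> lie in \<open>p\<close>.
\<close>
lemma subleads_coeffs:
  assumes Q: "is_ideal Q" and p: "is_prime p" "l \<notin> p" and F: "F \<in> Q" "degree F \<le> d" "coeff F d = l ^ e"
    and sub: "\<And>G. G \<in> Q \<Longrightarrow> degree G < d \<Longrightarrow> coeff G (d - 1) \<in> p"
    and G: "G \<in> Q" "degree G < d"
  shows "G \<in> ext p"
proof -
  have pI: "is_ideal p" by (rule prime_ideal[OF p(1)])
  have "\<forall>G. G \<in> Q \<longrightarrow> degree G < d \<longrightarrow> coeff G (d - 1 - k) \<in> p" if "k \<le> d - 1" for k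
    using that
  proof (induction k)
    case 0
    show ?case using sub by simp
  next
    case (Suc k)
    show ?case
    proof (intro allI impI)
      fix G assume G: "G \<in> Q" "degree G < d"
      define g where "g = coeff G (d - 1)"
      define H where "H = monom (l ^ e) 1 * G - [:g:] * F"
      have HQ: "H \<in> Q" unfolding H_def by (rule ideal_diff[OF Q ideal_mult[OF Q G(1)] ideal_mult[OF Q F(1)]])
      have "coeff H i = 0" if "i \<ge> d" for i
      proof (cases "i = d")
        case True
        then show ?thesis using Suc.prems F(3) by (simp add: H_def coeff_monom_mult g_def)
      next
        case False
        then have "degree G < i - 1" "degree F < i" using that G(2) F(2) by auto
        then show ?thesis by (simp add: H_def coeff_monom_mult coeff_eq_0)
      qed
      then have Hd: "degree H < d" using Suc.prems by (intro degree_lessI) auto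
      have "coeff H (d - 1 - k) = l ^ e * coeff G (d - 1 - Suc k) - g * coeff F (d - 1 - k)"
        using Suc.prems by (simp add: H_def coeff_monom_mult)
      moreover have "coeff H (d - 1 - k) \<in> p" using Suc HQ Hd by simp
      moreover have "g * coeff F (d - 1 - k) \<in> p" unfolding g_def by (rule ideal_mult2[OF pI sub[OF G]])
      ultimately have "(l ^ e * coeff G (d - 1 - Suc k) - g * coeff F (d - 1 - k)) + g * coeff F (d - 1 - k) \<in> p"
        using ideal_add[OF pI] by metis
      then have "l ^ e * coeff G (d - 1 - Suc k) \<in> p" by simp
      then show "coeff G (d - 1 - Suc k) \<in> p" using prime_mult[OF p(1)] prime_power[OF p(1)] p(2) by blast
    qed
  qed
  then have low: "coeff G (d - 1 - k) \<in> p" if "k \<le> d - 1" for k using that G by blast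
  have "coeff G i \<in> p" for i
  proof (cases "i < d")
    case True
    then show ?thesis using low[of "d - 1 - i"] by simp
  next
    case False
    then show ?thesis using G(2) ideal_zero[OF pI] by (simp add: coeff_eq_0)
  qed
  then show ?thesis by (simp add: ext_def)
qed

text \<open>
  The entries \<open>2, \<dots>, n - 2\<close> have \<open>d (n - 3) \<ge> n - 1\<close> coefficients in degrees below \<open>d\<close>.  They are put
  in general position by constants from the ideal of the entries \<open>0, 1, n - 1\<close>; a prime containing all of
  them but not those constants would have height \<open>n - 1\<close> and thus contain \<open>l\<close>.
\<close>
lemma spread_coefficients:
  assumes u: "anchored_row u" and d: "2 \<le> d" and deg: "\<And>i. 1 < i \<Longrightarrow> i < n \<Longrightarrow> degree (u i) < d"
  defines "N \<equiv> n - 1"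
  shows "\<exists>u'. reduces n AA u u' \<and> anchored_row u' \<and> (\<forall>i. i \<notin> {2..<N} \<longrightarrow> u' i = u i) \<and> (\<forall>i. 1 < i \<longrightarrow> i < n \<longrightarrow> degree (u' i) < d) \<and>
    (\<forall>P. is_prime P \<longrightarrow> I \<subseteq> P \<longrightarrow> l \<notin> P \<longrightarrow> (\<forall>i\<in>{2..<N}. u' i \<in> ext P) \<longrightarrow>
      contr (ideal_of (u' ` ({..<n} - {2..<N}) \<union> AA)) \<subseteq> P)"
proof -
  have N: "n = Suc N" "4 \<le> N" using n by (auto simp: N_def)
  define Q where "Q = ideal_of (u ` ({..<n} - {2..<N}) \<union> AA)"
  have Q: "is_ideal Q" by (simp add: Q_def ideal_of_ideal)
  define J where "J = contr Q"
  have J: "is_ideal J" unfolding J_def by (rule contr_ideal[OF Q])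
  obtain t where t: "\<And>k. k < d * (N - 2) \<Longrightarrow> t k \<in> J"
    and tP: "\<And>P. is_prime P \<Longrightarrow> I \<subseteq> P \<Longrightarrow> (\<forall>k<d * (N - 2). coeff (u (2 + k div d)) (k mod d) + t k \<in> P) \<Longrightarrow>
      \<not> J \<subseteq> P \<Longrightarrow> ht_ge I (d * (N - 2)) P"
    using stable_range[OF noeth I(1) J, of "d * (N - 2)" "\<lambda>k. coeff (u (2 + k div d)) (k mod d)"] by blast
  define \<tau> where "\<tau> i = (\<Sum>j<d. monom (t ((i - 2) * d + j)) j)" for i
  have \<tau>c: "coeff (\<tau> i) j = (if j < d then t ((i - 2) * d + j) else 0)" for i j
    by (simp add: \<tau>_def coeff_sum coeff_monom)
  have \<tau>Q: "\<tau> i \<in> Q" if i: "i \<in> {2..<N}" for i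
    unfolding \<tau>_def
  proof (rule ideal_sum[OF Q])
    fix j assume j: "j \<in> {..<d}"
    have "(i - 2) * d + j < (i - 2) * d + d" using j by simp
    also have "\<dots> = Suc (i - 2) * d" by simp
    also have "\<dots> \<le> (N - 2) * d" using i by (intro mult_right_mono) auto
    finally have "(i - 2) * d + j < d * (N - 2)" by (simp add: mult.commute)
    then have "[:t ((i - 2) * d + j):] \<in> Q" using t by (simp add: J_def contr_def)
    from ideal_mult2[OF Q this, of "monom 1 j"] show "monom (t ((i - 2) * d + j)) j \<in> Q"
      by (simp add: smult_monom)
  qed
  define u' where "u' = (\<lambda>i. if i \<in> {2..<N} then u i + \<tau> i else u i)"
  have r: "reduces n AA u u'" unfolding u'_def
    by (rule reduces_add_family[OF A, where L = "{2..<N}"]) (use N \<tau>Q in \<open>auto simp: Q_def\<close>)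
  have u': "anchored_row u'" by (rule row_red[OF u r]) (use u in \<open>simp add: u'_def anchored_row_def\<close>)
  have same: "u' i = u i" if "i \<notin> {2..<N}" for i using that by (auto simp: u'_def)
  have img: "u' ` ({..<n} - {2..<N}) = u ` ({..<n} - {2..<N})" using same by (auto intro!: image_cong)
  have dg: "degree (u' i) < d" if "1 < i" "i < n" for i
  proof -
    have "degree (\<tau> i) < d" using \<tau>c d by (intro degree_lessI) auto
    then show ?thesis using deg[OF that] by (simp add: u'_def degree_add_less)
  qed
  have "J \<subseteq> P" if P: "is_prime P" "I \<subseteq> P" "l \<notin> P" "\<And>i. i \<in> {2..<N} \<Longrightarrow> u' i \<in> ext P" for P
  proof (rule ccontr)
    assume nJ: "\<not> J \<subseteq> P"
    have "coeff (u (2 + k div d)) (k mod d) + t k \<in> P" if k: "k < d * (N - 2)" for k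
    proof -
      have "k div d < N - 2" using k d by (simp add: less_mult_imp_div_less mult.commute)
      then have i: "2 + k div d \<in> {2..<N}" by auto
      then have "coeff (u' (2 + k div d)) (k mod d) \<in> P" using P(4) unfolding ext_def by blast
      then show ?thesis using i d by (simp add: u'_def \<tau>c)
    qed
    then have "ht_ge I (d * (N - 2)) P" using tP[OF P(1,2) _ nJ] by blast
    moreover have "n - 1 \<le> d * (N - 2)"
    proof -
      have "n - 1 \<le> 2 * (N - 2)" using N by simp
      also have "\<dots> \<le> d * (N - 2)" by (rule mult_right_mono) (use d in auto)
      finally show ?thesis .
    qed
    ultimately have "ht_ge I (n - 1) P" using ht_ge_less by blast
    then show False using high P(3) by blast
  qed
  then show ?thesis using r u' same dg unfolding J_def Q_def img[symmetric] by (intro exI[of _ u'] conjI allI impI) auto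
qed

text \<open>
  Among the elements of degree less than \<open>d\<close> in the ideal \<open>Q\<close> of all entries but the last, there is one, \<open>G\<close>, whose
  coefficient of degree \<open>d - 1\<close> is a power of \<open>l\<close>; it is used to give the last entry such a leading
  coefficient.  Otherwise, by Suslin's trick, a prime \<open>p\<close> avoiding \<open>l\<close> contains the coefficients of the entries
  \<open>2, \<dots>, n - 2\<close>.  General position then puts the constants in the ideal of the entries \<open>0, 1, n - 1\<close> into \<open>p\<close>,
  contrary to Nakayama's lemma.
\<close>
lemma lower_degree:
  assumes v: "anchored_row v" and d: "2 \<le> d" "lmonic d (v 1)"
  shows "\<exists>v'. reduces n AA v v' \<and> anchored_row v' \<and> lmonic (d - 1) (v' 1)"
proof -
  define N where "N = n - 1"
  have N: "n = Suc N" "4 \<le> N" using n by (auto simp: N_def)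
  obtain u0 where u0: "reduces n AA v u0" "anchored_row u0" "lmonic d (u0 1)" "\<And>i. 1 < i \<Longrightarrow> i < n \<Longrightarrow> degree (u0 i) < d"
    using reduce_others[OF v _ d(2)] d(1) by auto
  obtain u where u: "reduces n AA u0 u" "anchored_row u" "u 1 = u0 1" "\<And>i. 1 < i \<Longrightarrow> i < n \<Longrightarrow> degree (u i) < d"
    and key: "\<And>P. is_prime P \<Longrightarrow> I \<subseteq> P \<Longrightarrow> l \<notin> P \<Longrightarrow> \<forall>i\<in>{2..<N}. u i \<in> ext P \<Longrightarrow>
      contr (ideal_of (u ` ({..<n} - {2..<N}) \<union> AA)) \<subseteq> P"
  proof -
    have one: "1 \<notin> {2..<N}" by simp
    have "\<exists>u. reduces n AA u0 u \<and> anchored_row u \<and> (\<forall>i. i \<notin> {2..<N} \<longrightarrow> u i = u0 i) \<and> (\<forall>i. 1 < i \<longrightarrow> i < n \<longrightarrow> degree (u i) < d) \<and>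
      (\<forall>P. is_prime P \<longrightarrow> I \<subseteq> P \<longrightarrow> l \<notin> P \<longrightarrow> (\<forall>i\<in>{2..<N}. u i \<in> ext P) \<longrightarrow>
      contr (ideal_of (u ` ({..<n} - {2..<N}) \<union> AA)) \<subseteq> P)" unfolding N_def by (rule spread_coefficients[OF u0(2) d(1)]) (rule u0(4))
    then obtain u where
      *: "reduces n AA u0 u" "anchored_row u" "\<forall>i. i \<notin> {2..<N} \<longrightarrow> u i = u0 i" "\<forall>i. 1 < i \<longrightarrow> i < n \<longrightarrow> degree (u i) < d"
      "\<forall>P. is_prime P \<longrightarrow> I \<subseteq> P \<longrightarrow> l \<notin> P \<longrightarrow> (\<forall>i\<in>{2..<N}. u i \<in> ext P) \<longrightarrow>
      contr (ideal_of (u ` ({..<n} - {2..<N}) \<union> AA)) \<subseteq> P" by (elim exE conjE)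
    show ?thesis
    proof (rule that[of u])
      show "u 1 = u0 1" using *(3) one by blast
      show "degree (u i) < d" if "1 < i" "i < n" for i using *(4) that by blast
      show "contr (ideal_of (u ` ({..<n} - {2..<N}) \<union> AA)) \<subseteq> P"
        if "is_prime P" "I \<subseteq> P" "l \<notin> P" "\<forall>i\<in>{2..<N}. u i \<in> ext P" for P
        using *(5)[rule_format, OF that(1-3)] that(4) by blast
    qed (rule *)+
  qed
  have mon: "lmonic d (u 1)" using u0(3) u(3) by simp
  then obtain e where e: "degree (u 1) \<le> d" "coeff (u 1) d = l ^ e" unfolding lmonic_def by blast
  define Q where "Q = ideal_of (u ` ({..<n} - {N}) \<union> AA)"
  have Q: "is_ideal Q" "AA \<subseteq> Q" by (auto simp: Q_def ideal_of_ideal intro: ideal_of_base)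
  have uQ: "u i \<in> Q" if "i < N" for i using that N by (auto simp: Q_def intro!: ideal_of_base)
  define \<Lambda> where "\<Lambda> = {coeff G (d - 1) | G. G \<in> Q \<and> degree G < d}"
  have d0: "0 < d" using d by simp
  have \<Lambda>: "is_ideal \<Lambda>" unfolding \<Lambda>_def by (rule subleads_ideal[OF Q(1) d0])
  have "\<exists>k. l ^ k \<in> \<Lambda>"
  proof (rule ccontr)
    assume "\<not> ?thesis"
    then have "\<And>k. l ^ k \<notin> \<Lambda>" by blast
    then obtain p where p: "is_prime p" "\<Lambda> \<subseteq> p" "l \<notin> p" using prime_over[OF noeth \<Lambda>] by blast
    have sub: "coeff G (d - 1) \<in> p" if "G \<in> Q" "degree G < d" for G using that p(2) unfolding \<Lambda>_def by blast
    have ext: "G \<in> ext p" if "G \<in> Q" "degree G < d" for G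
      by (rule subleads_coeffs[OF Q(1) p(1,3) uQ[of 1] e sub that]) (use N in simp)
    have "I \<subseteq> p"
    proof
      fix r assume "r \<in> I"
      then have "[:r:] \<in> Q" using ext_const[OF I(1)] Q(2) by blast
      then have "[:r:] \<in> ext p" using ext d0 by simp
      then show "r \<in> p" by (simp only: ext_const[OF prime_ideal[OF p(1)]])
    qed
    moreover have K: "u i \<in> ext p" if "i \<in> {2..<N}" for i using ext[OF uQ u(4)] that N by simp
    ultimately have "contr (ideal_of (u ` ({..<n} - {2..<N}) \<union> AA)) \<subseteq> p" using key[OF p(1) _ p(3)] by blast
    moreover have "\<not> contr (ideal_of (u ` ({..<n} - {2..<N}) \<union> AA)) \<subseteq> p"
    proof (rule nakayama_row[OF u(2) p(1,3) _ K refl _ mon])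
      show "u 1 \<in> ideal_of (u ` ({..<n} - {2..<N}) \<union> AA)" using n by (intro ideal_of_base) auto
    qed (use N in auto)
    ultimately show False by blast
  qed
  then obtain k where "l ^ k \<in> \<Lambda>" by blast
  then obtain G where G: "G \<in> Q" "degree G < d" "l ^ k = coeff G (d - 1)" unfolding \<Lambda>_def by blast
  define a where "a = u(N := [:l ^ k:] * u N, 1 := [:l ^ k:] * u 1)"
  have ra: "reduces n AA u a" unfolding a_def by (rule scale[OF u(2)]) (use N in auto)
  have a: "anchored_row a" by (rule row_red[OF u(2) ra]) (use row0[OF u(2)] N(2) in \<open>simp add: a_def\<close>)
  define B where "B = ideal_of (a ` ({..<n} - {N}) \<union> AA)"
  have B: "is_ideal B" "AA \<subseteq> B" by (auto simp: B_def ideal_of_ideal intro: ideal_of_base)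
  have aB: "a i \<in> B" if "i < N" for i using that N by (auto simp: B_def intro!: ideal_of_base)
  have wB: "w \<in> B" using aB[of 0] row0[OF a] N(2) by simp
  have "[:l ^ k:] * u 1 \<in> B" using aB[of 1] N by (simp add: a_def)
  then have u1: "u 1 \<in> B" by (rule l_cancel[OF B(1) wB B(2)])
  have "u i \<in> B" if "i < N" for i using aB[OF that] u1 that by (cases "i = 1") (auto simp: a_def)
  then have "u ` ({..<n} - {N}) \<union> AA \<subseteq> B" using N B(2) less_Suc_eq by auto
  then have "Q \<subseteq> B" unfolding Q_def by (rule ideal_of_least[OF B(1)])
  then have GB: "[:1 - coeff (u N) (d - 1):] * G \<in> B" using ideal_mult[OF B(1)] G(1) by blast
  \<comment> \<open>With \<open>c\<close> the old coefficient of degree \<open>d - 1\<close>, the new one is \<open>l\<^sup>k c + (1 - c) l\<^sup>k = l\<^sup>k\<close>.\<close>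
  define b where "b = a(N := a N + [:1 - coeff (u N) (d - 1):] * G)"
  have rb: "reduces n AA a b" unfolding b_def
    by (rule reduces_add_ideal[OF A _ GB[unfolded B_def]]) (use N in simp)
  have b: "anchored_row b" by (rule row_red[OF a rb]) (use row0[OF a] N(2) in \<open>simp add: b_def\<close>)
  have bN: "b N = [:l ^ k:] * u N + [:1 - coeff (u N) (d - 1):] * G" using N by (simp add: b_def a_def)
  have "coeff (b N) (d - 1) = l ^ k * coeff (u N) (d - 1) + (1 - coeff (u N) (d - 1)) * l ^ k" unfolding bN G(3) by simp
  also have "\<dots> = l ^ k" by (simp add: algebra_simps)
  finally have c: "coeff (b N) (d - 1) = l ^ k" .
  have "degree (b N) < d" unfolding bN
  proof (rule degree_add_less)
    show "degree ([:l ^ k:] * u N) < d" using degree_smult_le[of "l ^ k" "u N"] u(4)[of N] N by simp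
    show "degree ([:1 - coeff (u N) (d - 1):] * G) < d"
      using degree_smult_le[of "1 - coeff (u N) (d - 1)" G] G(2) by simp
  qed
  then have "degree (b N) \<le> d - 1" using d by simp
  then have "lmonic (d - 1) (b N)" using c unfolding lmonic_def by blast
  then obtain b' where "reduces n AA b b'" "anchored_row b'" "lmonic (d - 1) (b' 1)" using lmonic_swap[OF b, of N] N by auto
  then show ?thesis using reduces_trans[OF u0(1) reduces_trans[OF u(1) reduces_trans[OF ra reduces_trans[OF rb]]]] by blast
qed

lemma exists_lmonic_one:
  assumes v: "anchored_row v" shows "\<exists>v'. reduces n AA v v' \<and> anchored_row v' \<and> lmonic 1 (v' 1)"
proof -
  have "\<exists>v'. reduces n AA v v' \<and> anchored_row v' \<and> lmonic 1 (v' 1)" if "anchored_row v" "lmonic (Suc d) (v 1)" for v d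
    using that
  proof (induction d arbitrary: v)
    case 0
    then show ?case using reduces_refl by auto
  next
    case (Suc d)
    obtain u where u: "reduces n AA v u" "anchored_row u" "lmonic (Suc d) (u 1)"
      using lower_degree[OF Suc.prems(1) _ Suc.prems(2)] by auto
    then obtain u' where "reduces n AA u u'" "anchored_row u'" "lmonic 1 (u' 1)" using Suc.IH[OF u(2,3)] by blast
    then show ?case using reduces_trans[OF u(1)] by blast
  qed
  moreover obtain u d where u: "reduces n AA v u" "anchored_row u" "0 < d" "lmonic d (u 1)" using exists_lmonic[OF v] by blast
  moreover have "d = Suc (d - 1)" using u(3) by simp
  ultimately obtain u' where "reduces n AA u u'" "anchored_row u'" "lmonic 1 (u' 1)" by metis
  then show ?thesis using reduces_trans[OF u(1)] by blast
qed

section \<open>Two constants in general position\<close>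

text \<open>
  The ideal whose elements may be added to the entry \<open>k\<close>.
\<close>
definition others :: "(nat \<Rightarrow> 'a poly) \<Rightarrow> nat \<Rightarrow> 'a poly set" where
  "others v k = ideal_of (v ` ({..<n} - {k}) \<union> AA)"

lemma others_ideal: "is_ideal (others v k)" by (simp add: others_def ideal_of_ideal)

lemma others_base: "i < n \<Longrightarrow> i \<noteq> k \<Longrightarrow> v i \<in> others v k"
  by (auto simp: others_def intro!: ideal_of_base)

lemma others_I: "r \<in> I \<Longrightarrow> r \<in> contr (others v k)"
  using ext_const[OF I(1)] by (auto simp: others_def contr_def intro: ideal_of_base)

text \<open>
  The entry \<open>k\<close> is moved out of those primes of \<open>S\<close> where this is possible.  By Nakayama's lemma it is possible
  at each prime that avoids \<open>l\<close> and contains the entry.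
\<close>
lemma avoid_constant:
  assumes v: "anchored_row v" "lmonic 1 (v 1)" and k: "1 < k" "k < n" "v k = [:c:]"
    and S: "finite S" "\<And>P. P \<in> S \<Longrightarrow> is_prime P"
  shows "\<exists>b. reduces n AA v (v(k := [:b:])) \<and> anchored_row (v(k := [:b:])) \<and>
    (\<forall>P\<in>S. b \<in> P \<longrightarrow> contr (others v k) \<subseteq> P) \<and>
    (\<forall>P. is_prime P \<longrightarrow> l \<notin> P \<longrightarrow> b \<in> P \<longrightarrow> \<not> contr (others v k) \<subseteq> P)"
proof -
  define J where "J = contr (others v k)"
  have J: "is_ideal J" unfolding J_def by (rule contr_ideal[OF others_ideal])
  obtain t where t: "t \<in> J" "\<And>P. P \<in> S \<Longrightarrow> \<not> J \<subseteq> P \<Longrightarrow> c + t \<notin> P"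
  proof -
    have "\<exists>t\<in>J. \<forall>P\<in>{P\<in>S. \<not> J \<subseteq> P}. c + t \<notin> P"
      by (rule prime_avoid[OF _ _ J]) (simp_all add: S)
    then show ?thesis using that by blast
  qed
  have "[:t:] \<in> others v k" using t(1) by (simp add: J_def contr_def)
  then have "reduces n AA v (v(k := v k + [:t:]))" unfolding others_def by (rule reduces_add_ideal[OF A k(2)])
  then have r: "reduces n AA v (v(k := [:c + t:]))" using k(3) by simp
  have anchored_row: "anchored_row (v(k := [:c + t:]))" by (rule row_red[OF v(1) r]) (use k v in \<open>simp add: anchored_row_def\<close>)
  have img: "(v(k := [:c + t:])) ` ({..<n} - {k}) = v ` ({..<n} - {k})" by (auto intro!: image_cong)
  have "\<not> J \<subseteq> P" if P: "is_prime P" "l \<notin> P" "c + t \<in> P" for P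
    unfolding J_def
  proof (rule nakayama_row[OF anchored_row P(1,2), of "{k}" _ "v 1" 1])
    show "others v k = ideal_of ((v(k := [:c + t:])) ` ({..<n} - {k}) \<union> AA)" unfolding others_def img ..
    show "v 1 \<in> others v k" using k n by (intro others_base) auto
    show "(v(k := [:c + t:])) j \<in> ext P" if "j \<in> {k}" for j
      using that P(3) ext_const[OF prime_ideal[OF P(1)], of "c + t"] by (simp del: add_pCons)
  qed (use k v(2) in auto)
  then show ?thesis using r anchored_row t(2) unfolding J_def[symmetric] by (intro exI[of _ "c + t"]) blast
qed

text \<open>
  First \<open>b\<close> is moved out of all minimal primes over \<open>I\<close> that avoid \<open>l\<close>, then \<open>c\<close> out of the minimal primes
  over \<open>I + (b)\<close> that avoid \<open>l\<close>, and out of those over \<open>I + (l)\<close> if possible.  Let \<open>P\<close> contain \<open>I\<close>, \<open>b\<close>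
  and \<open>c\<close>.  If it avoids \<open>l\<close>, or is not minimal over \<open>I + (l)\<close>, two strict inclusions below \<open>P\<close> are immediate.
  Otherwise \<open>c\<close> could not be moved out of \<open>P\<close>, so \<open>P\<close> contains the ideal \<open>J\<close> of admissible changes of \<open>c\<close>.
  That ideal contains \<open>b\<close> and is saturated with respect to \<open>l\<close>, so some prime between \<open>J\<close> and \<open>P\<close> avoids \<open>l\<close>; it has
  height at least one because it contains \<open>b\<close>.
\<close>
lemma two_constants:
  assumes v: "anchored_row v" "lmonic 1 (v 1)" and con: "\<And>i. 1 < i \<Longrightarrow> i < n \<Longrightarrow> degree (v i) < 1"
  shows "\<exists>v' b c. reduces n AA v v' \<and> anchored_row v' \<and> v' (n - 1) = [:b:] \<and> v' (n - 2) = [:c:] \<and>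
    (\<forall>P. is_prime P \<longrightarrow> I \<subseteq> P \<longrightarrow> b \<in> P \<longrightarrow> c \<in> P \<longrightarrow> ht_ge I 2 P)"
proof -
  have cst: "\<exists>c. v i = [:c:]" if "1 < i" "i < n" for i
    using con[OF that] degree_eq_zeroE[of "v i"] by auto
  have k1: "1 < n - 1" "n - 1 < n" and k2: "1 < n - 2" "n - 2 < n" "n - 2 \<noteq> n - 1" using n by auto
  obtain c1 c2 where c12: "v (n - 1) = [:c1:]" "v (n - 2) = [:c2:]" using cst[OF k1] cst[OF k2(1,2)] by blast
  obtain S1 where S1: "finite S1" "\<And>P. P \<in> S1 \<Longrightarrow> is_prime P \<and> I \<subseteq> P"
    "\<And>P. is_prime P \<Longrightarrow> I \<subseteq> P \<Longrightarrow> \<exists>Q\<in>S1. Q \<subseteq> P" using prime_cover[OF noeth I(1)] by meson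
  have "\<exists>b. reduces n AA v (v(n - 1 := [:b:])) \<and> anchored_row (v(n - 1 := [:b:])) \<and>
    (\<forall>P\<in>S1. b \<in> P \<longrightarrow> contr (others v (n - 1)) \<subseteq> P) \<and>
    (\<forall>P. is_prime P \<longrightarrow> l \<notin> P \<longrightarrow> b \<in> P \<longrightarrow> \<not> contr (others v (n - 1)) \<subseteq> P)"
    by (rule avoid_constant[OF v k1 c12(1) S1(1)]) (use S1(2) in blast)
  then obtain b where b1: "reduces n AA v (v(n - 1 := [:b:]))" "anchored_row (v(n - 1 := [:b:]))"
    and b2: "\<And>P. P \<in> S1 \<Longrightarrow> l \<notin> P \<Longrightarrow> b \<notin> P" using S1(2) by meson
  define u where "u = v(n - 1 := [:b:])"
  have u: "anchored_row u" "lmonic 1 (u 1)" "u (n - 2) = [:c2:]" "u (n - 1) = [:b:]"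
    using b1(2) v(2) c12 k1 k2 by (auto simp: u_def)
  obtain Sb where Sb: "finite Sb" "\<And>P. P \<in> Sb \<Longrightarrow> is_prime P \<and> ideal_of (insert b I) \<subseteq> P"
    "\<And>P. is_prime P \<Longrightarrow> ideal_of (insert b I) \<subseteq> P \<Longrightarrow> \<exists>Q\<in>Sb. Q \<subseteq> P"
    using prime_cover[OF noeth ideal_of_ideal[of "insert b I"]] by (elim exE conjE) blast
  obtain Sl where Sl: "finite Sl" "\<And>P. P \<in> Sl \<Longrightarrow> is_prime P \<and> ideal_of (insert l I) \<subseteq> P"
    "\<And>P. is_prime P \<Longrightarrow> ideal_of (insert l I) \<subseteq> P \<Longrightarrow> \<exists>Q\<in>Sl. Q \<subseteq> P"
    using prime_cover[OF noeth ideal_of_ideal[of "insert l I"]] by (elim exE conjE) blast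
  define J where "J = contr (others u (n - 2))"
  have "\<exists>c. reduces n AA u (u(n - 2 := [:c:])) \<and> anchored_row (u(n - 2 := [:c:])) \<and>
    (\<forall>P\<in>Sb \<union> Sl. c \<in> P \<longrightarrow> contr (others u (n - 2)) \<subseteq> P) \<and>
    (\<forall>P. is_prime P \<longrightarrow> l \<notin> P \<longrightarrow> c \<in> P \<longrightarrow> \<not> contr (others u (n - 2)) \<subseteq> P)"
    by (rule avoid_constant[OF u(1,2) k2(1,2) u(3)]) (use Sb(1,2) Sl(1,2) in auto)
  then obtain c where c1: "reduces n AA u (u(n - 2 := [:c:]))" "anchored_row (u(n - 2 := [:c:]))"
    and c2: "\<And>P. P \<in> Sb \<union> Sl \<Longrightarrow> c \<in> P \<Longrightarrow> J \<subseteq> P"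
    and c3: "\<And>P. is_prime P \<Longrightarrow> l \<notin> P \<Longrightarrow> c \<in> P \<Longrightarrow> \<not> J \<subseteq> P"
    unfolding J_def by meson
  have sub: "ideal_of (insert x I) \<subseteq> P \<longleftrightarrow> x \<in> P \<and> I \<subseteq> P" if "is_prime P" for x P
    using ideal_of_subset_iff[OF prime_ideal[OF that]] by auto
  have J: "is_ideal J" unfolding J_def by (rule contr_ideal[OF others_ideal])
  have bJ: "b \<in> J" unfolding J_def using others_base[OF k1(2) k2(3)[symmetric], of u] unfolding u(4) by (simp add: contr_def)
  have IJ: "I \<subseteq> J" unfolding J_def using others_I by blast
  have one: "ht_ge I 1 P" if P: "is_prime P" "I \<subseteq> P" "b \<in> P" "l \<notin> P" for P
  proof -
    obtain Q where Q: "Q \<in> S1" "Q \<subseteq> P" using S1(3)[OF P(1,2)] by blast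
    have "b \<notin> Q" using b2[OF Q(1)] Q(2) P(4) by blast
    then have "Q \<subset> P" using Q(2) P(3) by blast
    moreover have "ht_ge I 0 Q" using S1(2)[OF Q(1)] by simp
    ultimately show ?thesis using ht_ge_Suc[of I 0 Q P] P(1) by simp
  qed
  have up: "ht_ge I 2 P" if "ht_ge I 1 Q" "is_prime P" "Q \<subset> P" for P Q
    using ht_ge_Suc[OF that] by (simp add: numeral_2_eq_2)
  have "ht_ge I 2 P" if P: "is_prime P" "I \<subseteq> P" "b \<in> P" "c \<in> P" for P
  proof (cases "l \<in> P")
    case False
    obtain Q where Q: "Q \<in> Sb" "Q \<subseteq> P" using Sb(3)[OF P(1)] sub[OF P(1)] P by blast
    have Qp: "is_prime Q" "b \<in> Q" "I \<subseteq> Q" using Sb(2)[OF Q(1)] sub by auto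
    have "Q \<noteq> P" using c2[of Q] c3[OF P(1) False P(4)] Q(1) P(4) by auto
    then have "Q \<subset> P" using Q(2) by blast
    moreover have "l \<notin> Q" using False Q(2) by blast
    ultimately show ?thesis using up[OF one[OF Qp(1,3,2)] P(1)] by blast
  next
    case True
    obtain Q where Q: "Q \<in> Sl" "Q \<subseteq> P" using Sl(3)[OF P(1)] sub[OF P(1)] P True by blast
    have Qp: "is_prime Q" "l \<in> Q" "I \<subseteq> Q" using Sl(2)[OF Q(1)] sub by auto
    show ?thesis
    proof (cases "Q = P")
      case False
      then have "Q \<subset> P" using Q(2) by blast
      then show ?thesis using up[OF hl[OF Qp(1,3,2)] P(1)] by blast
    next
      case eq: True
      then have JP: "J \<subseteq> P" using c2[of P] Q(1) P(4) by blast
      \<comment> \<open>A prime disjoint from this set lies in \<open>P\<close> and avoids \<open>l\<close>.\<close>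
      define S where "S = {l ^ k * s | k s. s \<notin> P}"
      have S1: "1 \<in> S" unfolding S_def using prime_one[OF P(1)] by (intro CollectI exI[of _ 0] exI[of _ 1]) simp
      have SM: "x * y \<in> S" if "x \<in> S" "y \<in> S" for x y
      proof -
        obtain k s where ks: "x = l ^ k * s" "s \<notin> P" using \<open>x \<in> S\<close> unfolding S_def by blast
        obtain k' s' where ks': "y = l ^ k' * s'" "s' \<notin> P" using \<open>y \<in> S\<close> unfolding S_def by blast
        have "s * s' \<notin> P" using ks ks' prime_mult[OF P(1)] by blast
        moreover have "x * y = l ^ (k + k') * (s * s')" unfolding ks(1) ks'(1) by (simp add: power_add algebra_simps)
        ultimately show ?thesis unfolding S_def by blast
      qed
      have D: "J \<inter> S = {}"
      proof (rule ccontr)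
        assume "J \<inter> S \<noteq> {}"
        then obtain k s where ks: "l ^ k * s \<in> J" "s \<notin> P" unfolding S_def by auto
        have "[:l ^ k:] * [:s:] \<in> others u (n - 2)" using ks(1) by (simp add: J_def contr_def mult.commute)
        moreover have "w \<in> others u (n - 2)" using others_base[of 0 "n - 2" u] u(1) n by (simp add: anchored_row_def)
        moreover have "AA \<subseteq> others u (n - 2)" by (auto simp: others_def intro: ideal_of_base)
        ultimately have "[:s:] \<in> others u (n - 2)" using l_cancel[OF others_ideal] by blast
        then have "s \<in> J" by (simp add: J_def contr_def)
        then show False using JP ks(2) by blast
      qed
      obtain Z where Z: "is_prime Z" "J \<subseteq> Z" "Z \<inter> S = {}" using prime_disjoint[OF noeth J S1 SM D] by blast
      have "x \<in> S" if "x \<notin> P" for x unfolding S_def by (intro CollectI exI[of _ 0] exI[of _ x]) (use that in simp)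
      then have ZP: "Z \<subseteq> P" using Z(3) by blast
      have "l \<in> S" unfolding S_def
        by (intro CollectI exI[of _ 1] exI[of _ 1]) (use prime_one[OF P(1)] in simp)
      then have lZ: "l \<notin> Z" using Z(3) by blast
      then have "Z \<subset> P" using ZP True by blast
      then show ?thesis using up[OF one[OF Z(1) _ _ lZ] P(1)] IJ bJ Z(2) by blast
    qed
  qed
  moreover have "reduces n AA v (u(n - 2 := [:c:]))" using reduces_trans[OF b1(1)] c1(1) unfolding u_def by blast
  moreover have "(u(n - 2 := [:c:])) (n - 1) = [:b:]" "(u(n - 2 := [:c:])) (n - 2) = [:c:]" using u(4) k2(3) by auto
  ultimately show ?thesis using c1(2) by (intro exI[of _ "u(n - 2 := [:c:])"] exI[of _ b] exI[of _ c]) blast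
qed

text \<open>
  Adding the two constants to \<open>I\<close> lowers the dimension by two, and the other \<open>n - 2\<close> entries are
  unimodular modulo the new ideal.
\<close>
lemma completable_by_induction:
  assumes v: "anchored_row v"
    and IH: "\<And>(I :: 'a set) (u :: nat \<Rightarrow> 'a poly). is_ideal I \<Longrightarrow> dim_le I (n - 3) \<Longrightarrow> unimod (n - 2) (ext I) u \<Longrightarrow> completable (n - 2) (ext I) u"
  shows "completable n AA v"
proof -
  obtain v1 where v1: "reduces n AA v v1" "anchored_row v1" "lmonic 1 (v1 1)" using exists_lmonic_one[OF v] by blast
  obtain v2 where v2: "reduces n AA v1 v2" "anchored_row v2" "lmonic 1 (v2 1)" "\<And>i. 1 < i \<Longrightarrow> i < n \<Longrightarrow> degree (v2 i) < 1"
    using reduce_others[OF v1(2) _ v1(3)] by auto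
  obtain v3 b c where v3: "reduces n AA v2 v3" "anchored_row v3" "v3 (n - 1) = [:b:]" "v3 (n - 2) = [:c:]"
    and ht: "\<And>P. is_prime P \<Longrightarrow> I \<subseteq> P \<Longrightarrow> b \<in> P \<Longrightarrow> c \<in> P \<Longrightarrow> ht_ge I 2 P"
  proof -
    have "\<exists>v' b c. reduces n AA v2 v' \<and> anchored_row v' \<and> v' (n - 1) = [:b:] \<and> v' (n - 2) = [:c:] \<and>
      (\<forall>P. is_prime P \<longrightarrow> I \<subseteq> P \<longrightarrow> b \<in> P \<longrightarrow> c \<in> P \<longrightarrow> ht_ge I 2 P)"
      by (rule two_constants[OF v2(2,3)]) (rule v2(4))
    then show ?thesis using that by (elim exE conjE) blast
  qed
  define k where "k = n - 2"
  have k: "n = Suc (Suc k)" "n - 2 = k" "n - 1 = Suc k" using n by (auto simp: k_def)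
  define L where "L = ideal_of ({b, c} \<union> I)"
  have L: "is_ideal L" "I \<subseteq> L" "b \<in> L" "c \<in> L" by (auto simp: L_def ideal_of_ideal intro: ideal_of_base)
  have dL: "dim_le L (n - 3)"
    unfolding dim_le_def
  proof (rule allI, rule notI)
    fix P assume P: "ht_ge L (Suc (n - 3)) P"
    have "ht_ge I (Suc (n - 3) + 2) P"
    proof (rule ht_ge_base[OF P])
      fix Q assume "is_prime Q" "L \<subseteq> Q"
      then show "ht_ge I 2 Q" using ht L by blast
    qed
    moreover have *: "Suc (n - 3) + 2 = Suc (n - 1)" using n by simp
    ultimately have "ht_ge I (Suc (n - 1)) P" by (simp only:)
    then show False using dim unfolding dim_le_def by blast
  qed
  define B where "B = ideal_of ({v3 k, v3 (Suc k)} \<union> AA)"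
  have BL: "ext L \<subseteq> B"
  proof -
    have BI: "is_ideal B" by (simp add: B_def ideal_of_ideal)
    have "r \<in> contr B" if "r \<in> I" for r using that ext_const[OF I(1)] by (auto simp: B_def contr_def intro: ideal_of_base)
    moreover have "b \<in> contr B" "c \<in> contr B" using v3(3,4) k by (auto simp: B_def contr_def intro!: ideal_of_base)
    ultimately have "L \<subseteq> contr B" unfolding L_def by (intro ideal_of_least[OF contr_ideal[OF BI]]) auto
    then show ?thesis by (simp add: ext_subset_iff BI L(1))
  qed
  have "unimod k (ext L) v3"
  proof -
    have EL: "is_ideal (ext L)" by (rule ext_ideal[OF L(1)])
    let ?T = "ideal_of (v3 ` {..<k} \<union> ext L)"
    have bc: "[:b:] \<in> ext L" "[:c:] \<in> ext L" by (simp_all only: ext_const[OF L(1)] L)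
    have "v3 i \<in> ?T" if i: "i < n" for i
    proof -
      consider "i < k" | "i = k" | "i = Suc k" using i k(1) by linarith
      then show ?thesis using bc v3(3,4) k by cases (auto intro: ideal_of_base)
    qed
    moreover have "AA \<subseteq> ?T" using ext_mono[OF L(2)] by (auto intro: ideal_of_base)
    ultimately have "v3 ` {..<n} \<union> AA \<subseteq> ?T" by auto
    then show ?thesis using v3(2) ideal_of_least[OF ideal_of_ideal] unfolding anchored_row_def unimod_def by blast
  qed
  then have "completable k (ext L) v3" using IH[OF L(1) dL] k(2) by simp
  then have "completable k B v3" using BL unfolding completable_def by blast
  then have "completable n AA v3" unfolding B_def k(1) by (rule completable_absorb[OF A])
  then show ?thesis using reduces_compl[OF reduces_trans[OF v1(1) reduces_trans[OF v2(1) v3(1)]]] by blast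
qed

end

section \<open>Completion of rows of odd length\<close>

text \<open>
  If \<open>R/I\<close> has dimension at most \<open>n - 2\<close>, the row is elementarily equivalent to the first basis vector.
  Otherwise the maximal ideal has positive height over \<open>I\<close>, so there is an element \<open>l\<close> of it outside the
  minimal primes, and modulo \<open>l\<close> the first case provides the anchor.
\<close>
lemma (in local_noeth) completable_odd:
  fixes v :: "nat \<Rightarrow> 'a poly"
  assumes h: "h + h = (1::'a)" and "odd n" "3 \<le> n" "is_ideal I" "dim_le I (n - 1)" "unimod n (ext I) v"
  shows "completable n (ext I) v"
  using assms(2-)
proof (induction n arbitrary: I v rule: less_induct)
  case (less n)
  note I = less.prems(3) and dim = less.prems(4) and u = less.prems(5)
  have A: "is_ideal (ext I)" by (rule ext_ideal[OF I])
  consider "1 \<in> I" | "n = 3" | "1 \<notin> I" "5 \<le> n" "dim_le I (n - 2)" | "1 \<notin> I" "5 \<le> n" "\<not> dim_le I (n - 2)"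
  proof -
    have "n \<noteq> 4" using less.prems(1) by auto
    then have "n = 3 \<or> 5 \<le> n" using less.prems(2) by linarith
    then show ?thesis using that by blast
  qed
  then show ?case
  proof cases
    case 1
    then have "ext I = UNIV" by (rule ext_UNIV[OF I])
    then show ?thesis by (simp add: completable_def)
  next
    case 2
    then show ?thesis using completable_three[OF h I] dim u by simp
  next
    case 3
    obtain b where b: "simE n v b" "b 0 - 1 \<in> ext I" "\<And>k. 0 < k \<Longrightarrow> k < n \<Longrightarrow> b k \<in> ext I"
      using elementary_to_e0[OF less.prems(2) I 3(3) u] by auto
    have "completable n (ext I) b" by (rule completable_e0[OF A]) (use 3(2) b in auto)
    moreover have "reduces n (ext I) v b" using b(1)[unfolded simE_def, rule_format, OF A] .
    ultimately show ?thesis using reduces_compl by blast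
  next
    case 4
    have Im: "I \<subseteq> m" by (rule proper_ideal[OF I 4(1)])
    obtain P where "ht_ge I (Suc (n - 2)) P" using 4(3) unfolding dim_le_def by blast
    moreover from this have "is_prime P" using ht_ge_prime by blast
    ultimately have "ht_ge I (Suc (n - 2)) m" using ht_ge_mono[OF _ m_prime prime_sub_m] by blast
    then have m1: "ht_ge I 1 m" by (rule ht_ge_less) simp
    \<comment> \<open>General position for the single element \<open>0\<close>, modified inside the maximal ideal.\<close>
    obtain t where t: "\<forall>k<1. t k \<in> m" and tP: "\<And>P. is_prime P \<Longrightarrow> I \<subseteq> P \<Longrightarrow> (\<forall>k<(1::nat). 0 + t k \<in> P) \<Longrightarrow>
        \<not> m \<subseteq> P \<Longrightarrow> ht_ge I 1 P"
      using stable_range[OF noeth I m_ideal, of 1 "\<lambda>_. 0"] by blast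
    define l where "l = t (0::nat)"
    have l: "l \<in> m" using t by (simp add: l_def)
    have hl: "ht_ge I 1 P" if P: "is_prime P" "I \<subseteq> P" "l \<in> P" for P
    proof (cases "m \<subseteq> P")
      case True
      then have "P = m" using prime_sub_m[OF P(1)] by blast
      then show ?thesis using m1 by simp
    next
      case False
      then show ?thesis using tP[OF P(1,2)] P(3) by (simp add: l_def)
    qed
    define L where "L = ideal_of (insert l I)"
    have L: "is_ideal L" "I \<subseteq> L" "l \<in> L" by (auto simp: L_def ideal_of_ideal intro: ideal_of_base)
    have dL: "dim_le L (n - 2)"
      unfolding dim_le_def
    proof (rule allI, rule notI)
      fix P assume P: "ht_ge L (Suc (n - 2)) P"
      have "ht_ge I (Suc (n - 2) + 1) P"
      proof (rule ht_ge_base[OF P])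
        fix Q assume "is_prime Q" "L \<subseteq> Q"
        then show "ht_ge I 1 Q" using hl L by blast
      qed
      moreover have *: "Suc (n - 2) + 1 = Suc (n - 1)" using 4 by simp
      ultimately have "ht_ge I (Suc (n - 1)) P" by (simp only:)
    then show False using dim unfolding dim_le_def by blast
    qed
    have uL: "unimod n (ext L) v"
      using u ideal_of_mono[of "v ` {..<n} \<union> ext I" "v ` {..<n} \<union> ext L"] ext_mono[OF L(2)] unfolding unimod_def by blast
    obtain b where b: "simE n v b" "b 0 - 1 \<in> ext L"
      using elementary_to_e0[OF less.prems(2) L(1) dL uL] by auto
    have rb: "reduces n (ext I) v b" using b(1)[unfolded simE_def, rule_format, OF A] .
    interpret anchored m I l "b 0" n
      by unfold_locales (use I 4 l dim b(2) hl in \<open>simp_all add: L_def\<close>)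
    have "anchored_row b" using reduces_unimod[OF rb u] by (simp add: anchored_row_def)
    then have "completable n (ext I) b"
    proof (rule completable_by_induction)
      fix I' and u :: "nat \<Rightarrow> 'a poly"
      assume "is_ideal I'" "dim_le I' (n - 3)" "unimod (n - 2) (ext I') u"
      moreover have "n - 2 < n" "odd (n - 2)" "3 \<le> n - 2" "n - 2 - 1 = n - 3" using 4(2) less.prems(1) by auto
      ultimately show "completable (n - 2) (ext I') u" using less.IH[of "n - 2" I' u] by simp
    qed
    then show ?thesis by (rule reduces_compl[OF rb])
  qed
qed

section \<open>Local Noetherian rings as records, and matrices\<close>

lemma ring_of_type_algebra_simps:
  "carrier (ring_of_type_algebra :: 'a::comm_ring_1 ring) = UNIV"
  "x \<otimes>\<^bsub>ring_of_type_algebra :: 'a ring\<^esub> y = x * y"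
  "\<one>\<^bsub>ring_of_type_algebra :: 'a ring\<^esub> = 1"
  "\<zero>\<^bsub>ring_of_type_algebra :: 'a ring\<^esub> = 0"
  "x \<oplus>\<^bsub>ring_of_type_algebra :: 'a ring\<^esub> y = x + y"
  by (simp_all add: ring_of_type_algebra_def)

lemma ideal_ring_of_type_algebra:
  "ideal I (ring_of_type_algebra :: 'a::comm_ring_1 ring) \<longleftrightarrow> is_ideal I"
proof
  assume I: "ideal I (ring_of_type_algebra :: 'a ring)"
  have S: "additive_subgroup I (ring_of_type_algebra :: 'a ring)" by (rule ideal.axioms(1)[OF I])
  have "0 \<in> I" using additive_subgroup.zero_closed[OF S] unfolding ring_of_type_algebra_simps .
  moreover have "x + y \<in> I" if "x \<in> I" "y \<in> I" for x y
    using additive_subgroup.a_closed[OF S that] unfolding ring_of_type_algebra_simps .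
  moreover have "c * x \<in> I" if "x \<in> I" for c x
    using ideal.I_l_closed[OF I that, of c] unfolding ring_of_type_algebra_simps by simp
  ultimately show "is_ideal I" by (simp add: is_ideal_def)
next
  assume I: "is_ideal I"
  interpret R: ring "ring_of_type_algebra :: 'a ring" by (rule ring_from_type_algebra)
  show "ideal I (ring_of_type_algebra :: 'a ring)"
  proof (rule idealI[OF R.ring_axioms])
    show "subgroup I (add_monoid (ring_of_type_algebra :: 'a ring))"
    proof (rule R.add.subgroupI)
      show "I \<noteq> {}" using ideal_zero[OF I] by blast
      show "\<ominus>\<^bsub>ring_of_type_algebra\<^esub> a \<in> I" if "a \<in> I" for a
      proof -
        have "\<ominus>\<^bsub>ring_of_type_algebra\<^esub> a = - a"
          by (rule R.minus_equality) (simp_all add: ring_of_type_algebra_simps)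
        then show ?thesis using ideal_uminus[OF I that] by simp
      qed
    qed (use I in \<open>simp_all add: ring_of_type_algebra_simps ideal_add\<close>)
  qed (use I in \<open>simp_all add: ring_of_type_algebra_simps ideal_mult ideal_mult2\<close>)
qed

lemma primeideal_ring_of_type_algebra:
  "is_prime P \<Longrightarrow> primeideal P (ring_of_type_algebra :: 'a::comm_ring_1 ring)"
proof (rule primeidealI)
  assume P: "is_prime P"
  show "ideal P (ring_of_type_algebra :: 'a ring)"
    using prime_ideal[OF P] by (simp add: ideal_ring_of_type_algebra)
  show "cring (ring_of_type_algebra :: 'a ring)" by (rule cring_from_type_algebra)
  show "carrier (ring_of_type_algebra :: 'a ring) \<noteq> P"
    using prime_one[OF P] by (auto simp: ring_of_type_algebra_simps)
  show "a \<in> P \<or> b \<in> P" if "a \<otimes>\<^bsub>ring_of_type_algebra\<^esub> b \<in> P" for a b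
    using that prime_mult[OF P] by (simp add: ring_of_type_algebra_simps)
qed

lemma maximalideal_ring_of_type_algebra:
  "maximalideal M (ring_of_type_algebra :: 'a::comm_ring_1 ring) \<longleftrightarrow>
     is_ideal M \<and> 1 \<notin> M \<and> (\<forall>J. is_ideal J \<longrightarrow> M \<subseteq> J \<longrightarrow> 1 \<notin> J \<longrightarrow> J = M)"
proof -
  have U: "J = UNIV \<longleftrightarrow> 1 \<in> J" if "is_ideal J" for J :: "'a set" using ideal_one[OF that] by blast
  show ?thesis
    unfolding maximalideal_def maximalideal_axioms_def ideal_ring_of_type_algebra
    unfolding ring_of_type_algebra_simps using U by blast
qed

lemma noeth_ring_of_type_algebra:
  assumes "noetherian_ring (ring_of_type_algebra :: 'a::comm_ring_1 ring)"
  shows "noeth TYPE('a)"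
  unfolding noeth_def
proof
  fix f :: "nat \<Rightarrow> 'a"
  interpret R: noetherian_ring "ring_of_type_algebra :: 'a ring" by (rule assms)
  define C where "C = range (\<lambda>n. ideal_of (f ` {..<n}))"
  have "subset.chain {I. ideal I (ring_of_type_algebra :: 'a ring)} C"
    unfolding subset_chain_def
  proof (intro conjI ballI)
    show "C \<subseteq> {I. ideal I (ring_of_type_algebra :: 'a ring)}"
      by (auto simp: C_def ideal_ring_of_type_algebra ideal_of_ideal)
    fix U Y assume "U \<in> C" "Y \<in> C"
    then obtain i j where ij: "U = ideal_of (f ` {..<i})" "Y = ideal_of (f ` {..<j})" unfolding C_def by blast
    show "U \<subseteq> Y \<or> Y \<subseteq> U"
    proof (cases "i \<le> j")
      case True
      then have "f ` {..<i} \<subseteq> f ` {..<j}" by auto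
      then have "U \<subseteq> Y" unfolding ij by (rule ideal_of_mono)
      then show ?thesis ..
    next
      case False
      then have "f ` {..<j} \<subseteq> f ` {..<i}" by auto
      then have "Y \<subseteq> U" unfolding ij by (rule ideal_of_mono)
      then show ?thesis ..
    qed
  qed
  moreover have "C \<noteq> {}" by (simp add: C_def)
  ultimately have "\<Union>C \<in> C" by (rule R.ideal_chain_is_trivial[rotated])
  then obtain n where n: "\<Union>C = ideal_of (f ` {..<n})" unfolding C_def by blast
  have "f n \<in> ideal_of (f ` {..<Suc n})" by (intro ideal_of_base) auto
  then have "f n \<in> \<Union>C" unfolding C_def by blast
  then show "\<exists>n. f n \<in> ideal_of (f ` {..<n})" using n by blast
qed

text \<open>
  An element outside the only maximal ideal is a unit: otherwise the Noetherian property yields an ideal maximal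
  among the proper ones containing it.
\<close>
lemma local_noeth_of_local_ring:
  assumes "is_local_ring (ring_of_type_algebra :: 'a::comm_ring_1 ring)"
    and "noetherian_ring (ring_of_type_algebra :: 'a ring)"
  shows "\<exists>m :: 'a set. local_noeth m"
proof -
  obtain m where m: "maximalideal m (ring_of_type_algebra :: 'a ring)"
    and uniq: "\<And>M. maximalideal M (ring_of_type_algebra :: 'a ring) \<Longrightarrow> M = m"
    using assms(1) unfolding is_local_ring_def by blast
  have N: "noeth TYPE('a)" by (rule noeth_ring_of_type_algebra[OF assms(2)])
  have mI: "is_ideal m" "1 \<notin> m" using m by (auto simp: maximalideal_ring_of_type_algebra)
  have unit: "x dvd 1" if x: "x \<notin> m" for x
  proof (rule ccontr)
    assume nx: "\<not> x dvd 1"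
    have "1 \<notin> ideal_of {x}"
    proof
      assume "1 \<in> ideal_of {x}"
      then obtain c where "1 = c * x" using principal_ideal by blast
      then have "1 = x * c" by (simp add: mult.commute)
      then have "x dvd 1" by (rule dvdI)
      with nx show False by (rule notE)
    qed
    define F where "F = {J. is_ideal J \<and> x \<in> J \<and> 1 \<notin> J}"
    have "ideal_of {x} \<in> F" using \<open>1 \<notin> ideal_of {x}\<close> by (simp add: F_def ideal_of_ideal ideal_of_base)
    then have "F \<noteq> {}" by blast
    then have "\<exists>M\<in>F. \<forall>J\<in>F. M \<subseteq> J \<longrightarrow> J = M"
      by (rule noeth_maximal[OF N]) (simp add: F_def)
    then obtain M where M: "M \<in> F" "\<And>J. J \<in> F \<Longrightarrow> M \<subseteq> J \<Longrightarrow> J = M" by (elim bexE) simp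
    have "J = M" if "is_ideal J" "M \<subseteq> J" "1 \<notin> J" for J
      by (rule M(2)) (use that M(1) in \<open>auto simp: F_def\<close>)
    then have "maximalideal M (ring_of_type_algebra :: 'a ring)"
      unfolding maximalideal_ring_of_type_algebra using M(1) by (simp add: F_def)
    then have "M = m" by (rule uniq)
    then show False using M(1) x by (simp add: F_def)
  qed
  have "is_prime m"
    unfolding is_prime_def
  proof (intro conjI allI impI mI)
    fix a b assume ab: "a * b \<in> m"
    show "a \<in> m \<or> b \<in> m"
    proof (cases "a \<in> m")
      case False
      from unit[OF this] obtain c where "1 = a * c" by (elim dvdE)
      then have "c * (a * b) = b" by (metis mult.assoc mult.commute mult_1)
      then show ?thesis using ideal_mult[OF mI(1) ab, of c] by simp
    qed simp
  qed
  then show ?thesis using N unit by (intro exI[of _ m] local_noeth.intro)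
qed

lemma ht_ge_chain:
  "ht_ge W k P \<Longrightarrow> \<exists>f. (\<forall>i\<le>k. is_prime (f i)) \<and> (\<forall>i<k. f i \<subset> f (Suc i)) \<and> f k = P"
proof (induction k arbitrary: P)
  case 0
  then show ?case by (intro exI[of _ "\<lambda>_. P"]) simp
next
  case (Suc k)
  then obtain Q where Q: "ht_ge W k Q" "Q \<subset> P" and P: "is_prime P" unfolding ht_ge.simps by blast
  obtain f where f: "\<forall>i\<le>k. is_prime (f i)" "\<forall>i<k. f i \<subset> f (Suc i)" "f k = Q" using Suc.IH[OF Q(1)] by blast
  show ?case
    by (rule exI[of _ "f(Suc k := P)"]) (use f Q(2) P in \<open>auto simp: le_Suc_eq less_Suc_eq\<close>)
qed

text \<open>
  A chain longer than \<open>d\<close> would exceed the supremum.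
\<close>
lemma dim_le_of_krull_dim:
  assumes "krull_dim (ring_of_type_algebra :: 'a::comm_ring_1 ring) = enat d" "d \<le> e"
  shows "dim_le ({0} :: 'a set) e"
  unfolding dim_le_def
proof (intro allI notI)
  fix P :: "'a set" assume "ht_ge {0} (Suc e) P"
  from ht_ge_chain[OF this] obtain f :: "nat \<Rightarrow> 'a set"
    where f: "\<forall>i\<le>Suc e. is_prime (f i)" "\<forall>i<Suc e. f i \<subset> f (Suc i)" by (elim exE conjE)
  have "enat (Suc e) \<le> krull_dim (ring_of_type_algebra :: 'a ring)"
    unfolding krull_dim_def
    by (rule Sup_upper, rule CollectI, rule exI[of _ "Suc e"], intro conjI refl exI[of _ f] allI impI)
       (simp_all add: f primeideal_ring_of_type_algebra)
  then show False using assms by simp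
qed

lemma half_of_fact_unit:
  assumes "(of_nat (fact d) :: 'a::comm_ring_1) dvd 1" "2 \<le> d"
  shows "\<exists>h::'a. h + h = 1"
proof -
  have "(2::nat) dvd fact d" using assms(2) by (intro dvd_fact) auto
  then obtain k where k: "fact d = 2 * (k::nat)" by (elim dvdE)
  obtain c where "1 = (of_nat (fact d) :: 'a) * c" using assms(1) by (elim dvdE)
  then have "1 = of_nat k * c + of_nat k * c" unfolding k by (simp add: algebra_simps)
  then show ?thesis by (intro exI[of _ "of_nat k * c"]) (rule sym)
qed

lemma (in local_noeth) unimodular_row_completable:
  fixes v :: "nat \<Rightarrow> 'a poly"
  assumes h: "h + h = (1::'a)" and n: "3 \<le> n" and I: "is_ideal I" "dim_le I (n - 1)" and v: "unimod n (ext I) v"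
  shows "completable n (ext I) v"
  using completable_even[OF ext_ideal[OF I(1)] _ v] completable_odd[OF h _ n I v] by blast

lemma completable_zero_matrix:
  fixes \<alpha> :: "'b::comm_ring_1 mat"
  assumes \<alpha>: "\<alpha> \<in> carrier_mat 1 n" and c: "completable n {0} (\<lambda>i. \<alpha> $$ (0, i))"
  shows "\<exists>\<gamma>\<in>Um 2 n. first_row \<gamma> = \<alpha>"
proof -
  obtain w p q where h: "dot n (\<lambda>i. \<alpha> $$ (0, i)) p = 1" "dot n (\<lambda>i. \<alpha> $$ (0, i)) q = 0" "dot n w p = 0" "dot n w q = 1"
    using c unfolding completable_def by auto
  define \<gamma> where "\<gamma> = mat 2 n (\<lambda>(i, j). if i = 0 then \<alpha> $$ (0, j) else w j)"
  define \<beta> where "\<beta> = mat n 2 (\<lambda>(i, j). if j = 0 then p i else q i)"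
  have "\<gamma> * \<beta> = 1\<^sub>m 2"
  proof (rule eq_matI)
    fix i j assume "i < dim_row (1\<^sub>m 2 :: 'b mat)" "j < dim_col (1\<^sub>m 2 :: 'b mat)"
    then have ij: "i < 2" "j < 2" by auto
    have "(\<gamma> * \<beta>) $$ (i, j) = dot n (\<lambda>k. if i = 0 then \<alpha> $$ (0, k) else w k) (\<lambda>k. if j = 0 then p k else q k)"
      using ij by (simp add: \<gamma>_def \<beta>_def scalar_prod_def dot_def lessThan_atLeast0)
    also have "\<dots> = 1\<^sub>m 2 $$ (i, j)"
      using ij h by (auto simp: less_2_cases_iff)
    finally show "(\<gamma> * \<beta>) $$ (i, j) = 1\<^sub>m 2 $$ (i, j)" .
  qed (simp_all add: \<gamma>_def \<beta>_def)
  then have "\<gamma> \<in> Um 2 n" unfolding Um_def by (auto simp: \<gamma>_def \<beta>_def)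
  moreover have "first_row \<gamma> = \<alpha>"
    using \<alpha> by (intro eq_matI) (auto simp: first_row_def \<gamma>_def)
  ultimately show ?thesis by blast
qed

lemma Um_row_unimod:
  fixes \<alpha> :: "'b::comm_ring_1 mat"
  assumes "\<alpha> \<in> Um 1 n"
  shows "\<alpha> \<in> carrier_mat 1 n" "unimod n A (\<lambda>i. \<alpha> $$ (0, i))"
proof -
  obtain \<beta> where b: "\<alpha> \<in> carrier_mat 1 n" "\<beta> \<in> carrier_mat n 1" "\<alpha> * \<beta> = 1\<^sub>m 1"
    using assms by (auto simp: Um_def)
  show "\<alpha> \<in> carrier_mat 1 n" by (rule b(1))
  have "(\<alpha> * \<beta>) $$ (0, 0) = (\<Sum>i<n. \<alpha> $$ (0, i) * \<beta> $$ (i, 0))"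
    using b(1,2) by (simp add: scalar_prod_def lessThan_atLeast0)
  then have "1 = (\<Sum>i<n. \<alpha> $$ (0, i) * \<beta> $$ (i, 0))" unfolding b(3) by simp
  also have "\<dots> \<in> ideal_of ((\<lambda>i. \<alpha> $$ (0, i)) ` {..<n} \<union> A)"
    by (intro ideal_sum[OF ideal_of_ideal] ideal_mult2[OF ideal_of_ideal] ideal_of_base) auto
  finally show "unimod n A (\<lambda>i. \<alpha> $$ (0, i))" unfolding unimod_def .
qed

theorem lemma5p1:
  fixes d n :: nat
  assumes "is_local_ring (ring_of_type_algebra :: 'a :: comm_ring_1 ring)"
    and "noetherian_ring (ring_of_type_algebra :: 'a ring)"
    and "krull_dim (ring_of_type_algebra :: 'a ring) = enat d"
    and "d \<ge> 2"
    and "(of_nat (fact d) :: 'a) dvd 1"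
    and "n \<ge> d + 1"
  shows "Row1 n ` (Um_orbits 2 n :: 'a poly mat set set) = Um_orbits 1 n"
proof
  show "Row1 n ` (Um_orbits 2 n :: 'a poly mat set set) \<subseteq> Um_orbits 1 n"
    using Row1_in_Um_orbits by blast
  obtain m :: "'a set" where "local_noeth m" using local_noeth_of_local_ring[OF assms(1,2)] by blast
  then interpret local_noeth m .
  obtain h :: 'a where h: "h + h = 1" using half_of_fact_unit[OF assms(5,4)] by blast
  have n: "3 \<le> n" using assms(4,6) by simp
  have zero: "is_ideal ({0} :: 'a set)" by (simp add: is_ideal_def)
  have dim: "dim_le ({0} :: 'a set) (n - 1)"
    by (rule dim_le_of_krull_dim[OF assms(3)]) (use assms(6) in simp)
  have ext0: "ext ({0} :: 'a set) = {0}" by (auto simp: ext_def poly_eq_iff)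
  show "(Um_orbits 1 n :: 'a poly mat set set) \<subseteq> Row1 n ` Um_orbits 2 n"
  proof
    fix C :: "'a poly mat set" assume "C \<in> Um_orbits 1 n"
    then obtain \<alpha> where \<alpha>: "\<alpha> \<in> Um 1 n" "C = E_orbit n \<alpha>" unfolding Um_orbits_def by blast
    have "completable n {0} (\<lambda>i. \<alpha> $$ (0, i))"
      using unimodular_row_completable[OF h n zero dim Um_row_unimod(2)[OF \<alpha>(1)]] unfolding ext0 .
    then obtain \<gamma> where \<gamma>: "\<gamma> \<in> Um 2 n" "first_row \<gamma> = \<alpha>"
      using completable_zero_matrix[OF Um_row_unimod(1)[OF \<alpha>(1)]] by blast
    then have "Row1 n (E_orbit n \<gamma>) = C" using Row1_E_orbit[OF \<gamma>(1)] \<alpha>(2) by simp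
    then show "C \<in> Row1 n ` Um_orbits 2 n" using \<gamma>(1) unfolding Um_orbits_def by blast
  qed
qed

end
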